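(* Let $R$ be a commutative ring with identity and $S$ a multiplicative subset of $R$. Then the following assertions are equivalent: (1) $R$ is an $S$-coherent ring; (2) any direct product of flat $R$-modules is $s$-flat; (3) any direct product of projective $R$-modules is $s$-flat; (4) any direct product of copies of $R$ is $s$-flat.
   Context: All modules are unitary. A multiplicative subset $S$ of $R$ is a subset with $1\in S$ and $s_1s_2\in S$ for all $s_1,s_2\in S$. An $R$-module $M$ is $S$-finite if there exist a finitely generated submodule $K\subseteq M$ and $s\in S$ with $sM\subseteq K$. An $R$-module $M$ is $S$-finitely presented if there is an exact sequence $0\to K\to F\to M\to 0$ with $K$ $S$-finite and $F$ finitely generated free. The ring $R$ is $S$-coherent if every finitely generated ideal of $R$ is an $S$-finitely presented $R$-module. An $R$-module $F$ is $s$-flat if for every finitely presented $R$-module $M$ there exists $s\in S$ (depending on $M$) such that $s\operatorname{Tor}_1^R(M,F)=0$. *)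

theory Defs
  imports
    "HOL-Algebra.Ideal"
    "HOL-Library.Equipollence"
    "Jordan_Normal_Form.Missing_VectorSpace"
begin

text \<open>
  Modules are records over a commutative ring \<open>R\<close> in the sense of the locale \<^locale>\<open>module\<close>;
  the fields \<open>mult\<close> and \<open>one\<close> of the record carry no meaning for a module.

  Notions that quantify over all modules (flat, projective, s-flat) are relative to a universe,
  given by a type argument \<open>TYPE('u)\<close>: the test modules are those whose carrier is a subset of
  \<open>'u\<close>. If \<open>'u\<close> is infinite and at least as large as \<open>R\<close>, it contains a copy of every ideal of
  \<open>R\<close>, of every finitely presented module, and of the free module on any subset of \<open>'u\<close>, so
  that enlarging the universe changes neither flatness and s-flatness of any module nor projectivity
  of a module in \<open>'u\<close>.
\<close>

section \<open>Constructions\<close>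

definition regular_module :: "('r, 'c) ring_scheme \<Rightarrow> ('r, 'r) module" where
  "regular_module R =
    \<lparr>carrier = carrier R, monoid.mult = (\<otimes>\<^bsub>R\<^esub>), monoid.one = \<one>\<^bsub>R\<^esub>,
     ring.zero = \<zero>\<^bsub>R\<^esub>, ring.add = (\<oplus>\<^bsub>R\<^esub>), module.smult = (\<otimes>\<^bsub>R\<^esub>)\<rparr>"

definition direct_product :: "'i set \<Rightarrow> ('i \<Rightarrow> ('r, 'm) module) \<Rightarrow> ('r, 'i \<Rightarrow> 'm) module" where
  "direct_product I M =
    \<lparr>carrier = (\<Pi>\<^sub>E i\<in>I. carrier (M i)), monoid.mult = undefined, monoid.one = undefined,
     ring.zero = (\<lambda>i\<in>I. \<zero>\<^bsub>M i\<^esub>),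
     ring.add = (\<lambda>f g. \<lambda>i\<in>I. f i \<oplus>\<^bsub>M i\<^esub> g i),
     module.smult = (\<lambda>r f. \<lambda>i\<in>I. r \<odot>\<^bsub>M i\<^esub> f i)\<rparr>"

definition free_module :: "('r, 'c) ring_scheme \<Rightarrow> 'x set \<Rightarrow> ('r, 'x \<Rightarrow> 'r) module" where
  "free_module R X = (direct_product X (\<lambda>_. regular_module R))
    \<lparr>carrier := {f \<in> X \<rightarrow>\<^sub>E carrier R. finite {x \<in> X. f x \<noteq> \<zero>\<^bsub>R\<^esub>}}\<rparr>"

definition free_gen :: "('r, 'c) ring_scheme \<Rightarrow> 'x set \<Rightarrow> 'x \<Rightarrow> 'x \<Rightarrow> 'r" where
  "free_gen R X x = (\<lambda>y\<in>X. if y = x then \<one>\<^bsub>R\<^esub> else \<zero>\<^bsub>R\<^esub>)"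

text \<open>The linear extension to \<open>free_module R X\<close> of a map \<open>g\<close> from \<open>X\<close> to \<open>M\<close>.\<close>

definition free_lift ::
    "('r, 'c) ring_scheme \<Rightarrow> 'x set \<Rightarrow> ('r, 'm) module \<Rightarrow> ('x \<Rightarrow> 'm) \<Rightarrow> ('x \<Rightarrow> 'r) \<Rightarrow> 'm" where
  "free_lift R X M g \<phi> = (\<Oplus>\<^bsub>M\<^esub> x \<in> {x \<in> X. \<phi> x \<noteq> \<zero>\<^bsub>R\<^esub>}. \<phi> x \<odot>\<^bsub>M\<^esub> g x)"

definition quot_module :: "('r, 'm) module \<Rightarrow> 'm set \<Rightarrow> ('r, 'm set) module" where
  "quot_module M N =
    \<lparr>carrier = a_rcosets\<^bsub>M\<^esub> N, monoid.mult = undefined, monoid.one = undefined, ring.zero = N,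
     ring.add = (<+>\<^bsub>M\<^esub>),
     module.smult = (\<lambda>r X. \<Union>x\<in>X. N +>\<^bsub>M\<^esub> (r \<odot>\<^bsub>M\<^esub> x))\<rparr>"

definition tensor_relations ::
    "('r, 'c) ring_scheme \<Rightarrow> ('r, 'm) module \<Rightarrow> ('r, 'n) module \<Rightarrow> ('m \<times> 'n \<Rightarrow> 'r) set" where
  "tensor_relations R M N =
    (let F = free_module R (carrier M \<times> carrier N);
         e = free_gen R (carrier M \<times> carrier N)
     in {e (x \<oplus>\<^bsub>M\<^esub> x', y) \<ominus>\<^bsub>F\<^esub> (e (x, y) \<oplus>\<^bsub>F\<^esub> e (x', y)) | x x' y.
            x \<in> carrier M \<and> x' \<in> carrier M \<and> y \<in> carrier N}
      \<union> {e (x, y \<oplus>\<^bsub>N\<^esub> y') \<ominus>\<^bsub>F\<^esub> (e (x, y) \<oplus>\<^bsub>F\<^esub> e (x, y')) | x y y'.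
            x \<in> carrier M \<and> y \<in> carrier N \<and> y' \<in> carrier N}
      \<union> {e (r \<odot>\<^bsub>M\<^esub> x, y) \<ominus>\<^bsub>F\<^esub> r \<odot>\<^bsub>F\<^esub> e (x, y) | r x y.
            r \<in> carrier R \<and> x \<in> carrier M \<and> y \<in> carrier N}
      \<union> {e (x, r \<odot>\<^bsub>N\<^esub> y) \<ominus>\<^bsub>F\<^esub> r \<odot>\<^bsub>F\<^esub> e (x, y) | r x y.
            r \<in> carrier R \<and> x \<in> carrier M \<and> y \<in> carrier N})"

definition tensor_kernel ::
    "('r, 'c) ring_scheme \<Rightarrow> ('r, 'm) module \<Rightarrow> ('r, 'n) module \<Rightarrow> ('m \<times> 'n \<Rightarrow> 'r) set" where
  "tensor_kernel R M N =
    module.span R (free_module R (carrier M \<times> carrier N)) (tensor_relations R M N)"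

definition tensor_module ::
    "('r, 'c) ring_scheme \<Rightarrow> ('r, 'm) module \<Rightarrow> ('r, 'n) module
      \<Rightarrow> ('r, ('m \<times> 'n \<Rightarrow> 'r) set) module" where
  "tensor_module R M N =
    quot_module (free_module R (carrier M \<times> carrier N)) (tensor_kernel R M N)"

definition pure_tensor ::
    "('r, 'c) ring_scheme \<Rightarrow> ('r, 'm) module \<Rightarrow> ('r, 'n) module \<Rightarrow> 'm \<Rightarrow> 'n
      \<Rightarrow> ('m \<times> 'n \<Rightarrow> 'r) set" where
  "pure_tensor R M N x y =
    tensor_kernel R M N +>\<^bsub>free_module R (carrier M \<times> carrier N)\<^esub>
      free_gen R (carrier M \<times> carrier N) (x, y)"

text \<open>
  For a homomorphism \<open>f\<close> from \<open>M\<close> to \<open>M'\<close>, the homomorphism from \<open>tensor_module R M N\<close> to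
  \<open>tensor_module R M' N\<close> induced by \<open>f\<close> and the identity of \<open>N\<close>. The linear extension of
  \<open>(x, y) \<mapsto> f x \<otimes> y\<close> is constant on each coset, hence the use of \<^const>\<open>the_elem\<close>.
\<close>

definition tensor_map ::
    "('r, 'c) ring_scheme \<Rightarrow> ('r, 'm) module \<Rightarrow> ('r, 'm2) module \<Rightarrow> ('r, 'n) module \<Rightarrow> ('m \<Rightarrow> 'm2)
      \<Rightarrow> ('m \<times> 'n \<Rightarrow> 'r) set \<Rightarrow> ('m2 \<times> 'n \<Rightarrow> 'r) set" where
  "tensor_map R M M' N f T =
    the_elem (free_lift R (carrier M \<times> carrier N) (tensor_module R M' N)
      (\<lambda>(x, y). pure_tensor R M' N (f x) y) ` T)"

text \<open>
  The first Tor module is the homology at \<open>P1 \<otimes> N\<close> of \<open>P2 \<otimes> N \<rightarrow> P1 \<otimes> N \<rightarrow> P0 \<otimes> N\<close>, where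
  \<open>P2 \<rightarrow> P1 \<rightarrow> P0 \<rightarrow> M \<rightarrow> 0\<close> is the beginning of the standard free resolution of \<open>M\<close>: \<open>P0\<close> is
  free on the elements of \<open>M\<close>, and each further term is free on the elements of the kernel of
  the preceding map. As for any projective resolution, the choice does not matter up to
  isomorphism.
\<close>

definition Tor1 ::
    "('r, 'c) ring_scheme \<Rightarrow> ('r, 'm) module \<Rightarrow> ('r, 'n) module
      \<Rightarrow> ('r, ((('m \<Rightarrow> 'r) \<Rightarrow> 'r) \<times> 'n \<Rightarrow> 'r) set set) module" where
  "Tor1 R M N =
    (let P0 = free_module R (carrier M);
         d0 = free_lift R (carrier M) M (\<lambda>x. x);
         Z0 = a_kernel P0 M d0;
         P1 = free_module R Z0;
         d1 = free_lift R Z0 P0 (\<lambda>x. x);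
         Z1 = a_kernel P1 P0 d1;
         P2 = free_module R Z1;
         d2 = free_lift R Z1 P1 (\<lambda>x. x);
         C0 = tensor_module R P0 N;
         C1 = tensor_module R P1 N;
         C2 = tensor_module R P2 N
     in quot_module (C1\<lparr>carrier := a_kernel C1 C0 (tensor_map R P1 P0 N d1)\<rparr>)
          (tensor_map R P2 P1 N d2 ` carrier C2))"

section \<open>Finiteness conditions\<close>

definition finitely_generated :: "('r, 'c) ring_scheme \<Rightarrow> ('r, 'm) module \<Rightarrow> bool" where
  "finitely_generated R M \<longleftrightarrow>
    (\<exists>A. finite A \<and> A \<subseteq> carrier M \<and> module.span R M A = carrier M)"

definition fg_free :: "('r, 'c) ring_scheme \<Rightarrow> ('r, 'm) module \<Rightarrow> bool" where
  "fg_free R F \<longleftrightarrow>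
    module R F \<and>
    (\<exists>B. finite B \<and> B \<subseteq> carrier F \<and> module.span R F B = carrier F \<and> \<not> module.lin_dep R F B)"

text \<open>Exactness of \<open>0 \<rightarrow> K \<rightarrow> F \<rightarrow> M \<rightarrow> 0\<close> with maps \<open>i\<close> and \<open>p\<close>.\<close>

definition short_exact ::
    "('r, 'c) ring_scheme \<Rightarrow> ('r, 'k) module \<Rightarrow> ('r, 'f) module \<Rightarrow> ('r, 'm) module
      \<Rightarrow> ('k \<Rightarrow> 'f) \<Rightarrow> ('f \<Rightarrow> 'm) \<Rightarrow> bool" where
  "short_exact R K F M i p \<longleftrightarrow>
    module R K \<and> module R F \<and> module R M \<and>
    i \<in> LinearCombinations.module_hom R K F \<and> p \<in> LinearCombinations.module_hom R F M \<and>
    inj_on i (carrier K) \<and> i ` carrier K = a_kernel F M p \<and> p ` carrier F = carrier M"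

definition S_finite :: "('r, 'c) ring_scheme \<Rightarrow> 'r set \<Rightarrow> ('r, 'm) module \<Rightarrow> bool" where
  "S_finite R S M \<longleftrightarrow>
    (\<exists>K. \<exists>s\<in>S. LinearCombinations.submodule R K M \<and> finitely_generated R (M\<lparr>carrier := K\<rparr>) \<and>
      (\<forall>x\<in>carrier M. s \<odot>\<^bsub>M\<^esub> x \<in> K))"

text \<open>
  In the next two definitions \<open>F\<close> and \<open>K\<close> range over modules whose elements have type
  \<open>nat \<Rightarrow> 'r\<close>. This is no restriction: every finitely generated free module has a copy of the
  form \<open>free_module R {..<n}\<close>, and \<open>K\<close> is isomorphic to a submodule of \<open>F\<close>.
\<close>

definition finitely_presented :: "('r, 'c) ring_scheme \<Rightarrow> ('r, 'm) module \<Rightarrow> bool" where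
  "finitely_presented R M \<longleftrightarrow>
    (\<exists>(K :: ('r, nat \<Rightarrow> 'r) module) (F :: ('r, nat \<Rightarrow> 'r) module) i p.
      short_exact R K F M i p \<and> finitely_generated R K \<and> fg_free R F)"

definition S_finitely_presented :: "('r, 'c) ring_scheme \<Rightarrow> 'r set \<Rightarrow> ('r, 'm) module \<Rightarrow> bool" where
  "S_finitely_presented R S M \<longleftrightarrow>
    (\<exists>(K :: ('r, nat \<Rightarrow> 'r) module) (F :: ('r, nat \<Rightarrow> 'r) module) i p.
      short_exact R K F M i p \<and> S_finite R S K \<and> fg_free R F)"

definition S_coherent :: "('r, 'c) ring_scheme \<Rightarrow> 'r set \<Rightarrow> bool" where
  "S_coherent R S \<longleftrightarrow>
    (\<forall>A. finite A \<and> A \<subseteq> carrier R \<longrightarrow>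
      S_finitely_presented R S ((regular_module R)\<lparr>carrier := Idl\<^bsub>R\<^esub> A\<rparr>))"

section \<open>Flat, projective and s-flat modules\<close>

definition flat :: "'u itself \<Rightarrow> ('r, 'c) ring_scheme \<Rightarrow> ('r, 'm) module \<Rightarrow> bool" where
  "flat _ R F \<longleftrightarrow>
    module R F \<and>
    (\<forall>(A :: ('r, 'u) module) (B :: ('r, 'u) module) f.
      module R A \<and> module R B \<and> f \<in> LinearCombinations.module_hom R A B \<and> inj_on f (carrier A)
        \<longrightarrow> inj_on (tensor_map R A B F f) (carrier (tensor_module R A F)))"

definition projective :: "'u itself \<Rightarrow> ('r, 'c) ring_scheme \<Rightarrow> ('r, 'm) module \<Rightarrow> bool" where
  "projective _ R P \<longleftrightarrow>
    module R P \<and>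
    (\<forall>(A :: ('r, 'u) module) (B :: ('r, 'u) module) g f.
      module R A \<and> module R B \<and> g \<in> LinearCombinations.module_hom R A B \<and>
      g ` carrier A = carrier B \<and> f \<in> LinearCombinations.module_hom R P B
        \<longrightarrow> (\<exists>h \<in> LinearCombinations.module_hom R P A. \<forall>x\<in>carrier P. g (h x) = f x))"

definition s_flat ::
    "'u itself \<Rightarrow> ('r, 'c) ring_scheme \<Rightarrow> 'r set \<Rightarrow> ('r, 'm) module \<Rightarrow> bool" where
  "s_flat _ R S F \<longleftrightarrow>
    module R F \<and>
    (\<forall>M :: ('r, 'u) module. finitely_presented R M \<longrightarrow>
      (\<exists>s\<in>S. \<forall>t\<in>carrier (Tor1 R M F). s \<odot>\<^bsub>Tor1 R M F\<^esub> t = \<zero>\<^bsub>Tor1 R M F\<^esub>))"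

end

theory Submission
  imports Defs "HOL-Algebra.Free_Abelian_Groups"
begin

text \<open>
  Each condition is compared with one about a single linear equation
  \<open>a\<^sub>1 x\<^sub>1 + \<dots> + a\<^sub>q x\<^sub>q = 0\<close> over \<open>R\<close>: after multiplication by a suitable \<open>s \<in> S\<close>, its solutions
  in \<open>R\<close> are combinations of finitely many fixed solutions. By Schanuel's lemma this is
  S-coherence.

  By the equational criterion, a solution in a flat module is a combination of solutions in \<open>R\<close>.
  Since both \<open>s\<close> and the finite family of solutions are independent of the module, the condition
  passes from \<open>R\<close> to products of flat modules; by induction on the number of equations it extends
  to finite systems. For a finitely presented \<open>M\<close> and a product \<open>N\<close>, every element of
  \<open>Tor\<^sub>1(M, N)\<close> is described by a solution in \<open>N\<close> of a finite system that depends only on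
  \<open>M\<close>, and is therefore annihilated by \<open>s\<close>.

  Conversely, let \<open>N\<close> be the power of \<open>R\<close> indexed by all solutions of the equation in \<open>R\<close>. The
  generic solution in \<open>N\<close> gives an element of \<open>Tor\<^sub>1(R/(a\<^sub>1, \<dots>, a\<^sub>q), N)\<close>; if \<open>s\<close>
  annihilates it, then \<open>s\<close> times the generic solution is a combination of finitely many solutions
  in \<open>R\<close>, and reading off components gives the condition.
\<close>

section \<open>Homomorphisms, submodules and finite sums\<close>

text \<open>Types shape the proof. Flatness, projectivity and s-flatness are tested inside the
  universe \<open>'u\<close>, so ideals, cyclic modules, free modules and the set of all solutions
  of an equation are carried into \<open>'u\<close> along injections; this is where the size of
  \<open>'u\<close> enters. Moreover the factors in (2) and (3) have elements of type
  \<open>'u\<close>, while those in (4) are \<open>R\<close> itself. The converse is therefore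
  proved once, for powers of a module with homomorphisms from and to \<open>R\<close> that compose
  to the identity of \<open>R\<close>. One fact about tensors, \<open>tensor_vanish\<close>, serves
  both directions. Let J be the ideal of the coefficients. Applied to J tensor F it turns flatness
  of F into the equational criterion; applied to J tensor N it turns annihilation in Tor into a
  statement about solutions in N. Tor is defined by a resolution that is free on all elements of
  \<open>M\<close>, so nothing finite is visible in it. Explicit chain maps to a finite presentation
  reduce its cycles to finite tuples over N. Systems of several equations arise at this point: there
  is one equation for each basis element of the free module in the presentation.\<close>

abbreviation mhom ::
    "('r, 'c) ring_scheme \<Rightarrow> ('r, 'm) module \<Rightarrow> ('r, 'n) module \<Rightarrow> ('m \<Rightarrow> 'n) set" where
  "mhom R M N \<equiv> LinearCombinations.module_hom R M N"

abbreviation submod :: "('r, 'c) ring_scheme \<Rightarrow> 'm set \<Rightarrow> ('r, 'm) module \<Rightarrow> bool" where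
  "submod R N M \<equiv> LinearCombinations.submodule R N M"

lemma mhomI:
  assumes "\<And>x. x \<in> carrier M \<Longrightarrow> f x \<in> carrier N"
    and "\<And>x y. x \<in> carrier M \<Longrightarrow> y \<in> carrier M \<Longrightarrow> f (x \<oplus>\<^bsub>M\<^esub> y) = f x \<oplus>\<^bsub>N\<^esub> f y"
    and "\<And>r x. r \<in> carrier R \<Longrightarrow> x \<in> carrier M \<Longrightarrow> f (r \<odot>\<^bsub>M\<^esub> x) = r \<odot>\<^bsub>N\<^esub> f x"
  shows "f \<in> mhom R M N"
  using assms unfolding LinearCombinations.module_hom_def by auto

lemma mhom_closed: "f \<in> mhom R M N \<Longrightarrow> x \<in> carrier M \<Longrightarrow> f x \<in> carrier N"
  unfolding LinearCombinations.module_hom_def by auto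

lemma mhom_add:
  "f \<in> mhom R M N \<Longrightarrow> x \<in> carrier M \<Longrightarrow> y \<in> carrier M \<Longrightarrow> f (x \<oplus>\<^bsub>M\<^esub> y) = f x \<oplus>\<^bsub>N\<^esub> f y"
  unfolding LinearCombinations.module_hom_def by auto

lemma mhom_smult:
  "f \<in> mhom R M N \<Longrightarrow> r \<in> carrier R \<Longrightarrow> x \<in> carrier M \<Longrightarrow> f (r \<odot>\<^bsub>M\<^esub> x) = r \<odot>\<^bsub>N\<^esub> f x"
  unfolding LinearCombinations.module_hom_def by auto

lemma mhom_zero:
  assumes "module R M" "module R N" "f \<in> mhom R M N"
  shows "f \<zero>\<^bsub>M\<^esub> = \<zero>\<^bsub>N\<^esub>"
proof -
  interpret mod_hom R M N f by (intro mod_hom.intro mod_hom_axioms.intro assms)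
  show ?thesis by (rule f0_is_0)
qed

lemma mhom_minus:
  assumes "module R M" "module R N" "f \<in> mhom R M N" "x \<in> carrier M" "y \<in> carrier M"
  shows "f (x \<ominus>\<^bsub>M\<^esub> y) = f x \<ominus>\<^bsub>N\<^esub> f y"
proof -
  interpret mod_hom R M N f by (intro mod_hom.intro mod_hom_axioms.intro assms)
  show ?thesis by (intro f_minus assms)
qed

lemma mhom_finsum:
  assumes "module R M" "module R N" "f \<in> mhom R M N" "g \<in> A \<rightarrow> carrier M"
  shows "f (finsum M g A) = finsum N (\<lambda>a. f (g a)) A"
proof -
  interpret M: module R M by fact
  interpret N: module R N by fact
  show ?thesis using assms(4)
  proof (induct A rule: infinite_finite_induct)
    case (insert a A)
    then have "f (finsum M g (insert a A)) = f (g a) \<oplus>\<^bsub>N\<^esub> f (finsum M g A)"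
      using assms(3) by (subst M.finsum_insert) (auto simp: mhom_add)
    also have "\<dots> = finsum N (\<lambda>a. f (g a)) (insert a A)"
      using insert assms(3) by (subst N.finsum_insert) (auto intro: mhom_closed)
    finally show ?case .
  qed (use assms mhom_zero in auto)
qed

lemma mhom_id: "(\<lambda>x. x) \<in> mhom R M M"
  by (rule mhomI) auto

lemma mhom_comp: "f \<in> mhom R M N \<Longrightarrow> g \<in> mhom R N P \<Longrightarrow> (\<lambda>x. g (f x)) \<in> mhom R M P"
  by (rule mhomI) (auto simp: mhom_closed mhom_add mhom_smult)

lemma mhom_const_zero:
  assumes "module R N" shows "(\<lambda>_. \<zero>\<^bsub>N\<^esub>) \<in> mhom R M N"
proof -
  interpret N: module R N by fact
  show ?thesis by (rule mhomI) auto
qed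

lemma mhom_plus:
  assumes "module R N" "f \<in> mhom R M N" "g \<in> mhom R M N"
  shows "(\<lambda>x. f x \<oplus>\<^bsub>N\<^esub> g x) \<in> mhom R M N"
proof -
  interpret N: module R N by fact
  show ?thesis
    using assms
    by (intro mhomI)
      (auto simp: mhom_closed mhom_add mhom_smult N.smult_r_distr N.a_ac)
qed

lemma mhom_scale:
  assumes "module R N" "f \<in> mhom R M N" "r \<in> carrier R"
  shows "(\<lambda>x. r \<odot>\<^bsub>N\<^esub> f x) \<in> mhom R M N"
proof -
  interpret N: module R N by fact
  show ?thesis
    using assms
    by (intro mhomI)
      (auto simp: mhom_closed mhom_add mhom_smult N.smult_r_distr N.R.m_comm N.smult_assoc1[symmetric])
qed

lemma mhom_uminus:
  assumes "module R N" "f \<in> mhom R M N"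
  shows "(\<lambda>x. \<ominus>\<^bsub>N\<^esub> f x) \<in> mhom R M N"
proof -
  interpret N: module R N by fact
  show ?thesis
    using assms
    by (intro mhomI)
      (auto simp: mhom_closed mhom_add mhom_smult N.smult_r_minus N.M.minus_add N.a_ac)
qed

lemma mhom_diff:
  assumes "module R N" "f \<in> mhom R M N" "g \<in> mhom R M N"
  shows "(\<lambda>x. f x \<ominus>\<^bsub>N\<^esub> g x) \<in> mhom R M N"
  unfolding a_minus_def by (intro mhom_plus mhom_uminus assms)

lemma mhom_sum:
  assumes "module R N" "\<And>a. a \<in> A \<Longrightarrow> f a \<in> mhom R M N"
  shows "(\<lambda>x. \<Oplus>\<^bsub>N\<^esub>a\<in>A. f a x) \<in> mhom R M N"
proof -
  interpret N: module R N by fact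
  have closed: "(\<lambda>a. f a x) \<in> A \<rightarrow> carrier N" if "x \<in> carrier M" for x
    using assms(2) that by (auto intro: mhom_closed)
  show ?thesis
  proof (rule mhomI)
    fix x y assume xy: "x \<in> carrier M" "y \<in> carrier M"
    have "(\<Oplus>\<^bsub>N\<^esub>a\<in>A. f a (x \<oplus>\<^bsub>M\<^esub> y)) = (\<Oplus>\<^bsub>N\<^esub>a\<in>A. f a x \<oplus>\<^bsub>N\<^esub> f a y)"
      using closed[OF xy(1)] closed[OF xy(2)] assms(2) xy
      by (intro N.finsum_cong') (auto intro!: mhom_add)
    then show "(\<Oplus>\<^bsub>N\<^esub>a\<in>A. f a (x \<oplus>\<^bsub>M\<^esub> y)) = (\<Oplus>\<^bsub>N\<^esub>a\<in>A. f a x) \<oplus>\<^bsub>N\<^esub> (\<Oplus>\<^bsub>N\<^esub>a\<in>A. f a y)"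
      using closed xy by (simp add: N.finsum_addf)
  next
    fix r x assume rx: "r \<in> carrier R" "x \<in> carrier M"
    have "(\<Oplus>\<^bsub>N\<^esub>a\<in>A. f a (r \<odot>\<^bsub>M\<^esub> x)) = (\<Oplus>\<^bsub>N\<^esub>a\<in>A. r \<odot>\<^bsub>N\<^esub> f a x)"
      using closed[OF rx(2)] assms(2) rx
      by (intro N.finsum_cong') (auto intro!: mhom_smult)
    then show "(\<Oplus>\<^bsub>N\<^esub>a\<in>A. f a (r \<odot>\<^bsub>M\<^esub> x)) = r \<odot>\<^bsub>N\<^esub> (\<Oplus>\<^bsub>N\<^esub>a\<in>A. f a x)"
      using closed rx by (simp add: N.finsum_smult)
  qed (intro N.finsum_closed closed)
qed

lemma mhom_restrict:
  assumes "f \<in> mhom R M N" "K \<subseteq> carrier N" "\<And>x. x \<in> carrier M \<Longrightarrow> f x \<in> K"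
  shows "f \<in> mhom R M (N\<lparr>carrier := K\<rparr>)"
  using assms by (intro mhomI) (auto simp: mhom_add mhom_smult)

section \<open>Submodules, kernels, images and spans\<close>

lemma submodI:
  assumes "module R M" "N \<subseteq> carrier M" "\<zero>\<^bsub>M\<^esub> \<in> N"
    and "\<And>x y. x \<in> N \<Longrightarrow> y \<in> N \<Longrightarrow> x \<oplus>\<^bsub>M\<^esub> y \<in> N"
    and "\<And>r x. r \<in> carrier R \<Longrightarrow> x \<in> N \<Longrightarrow> r \<odot>\<^bsub>M\<^esub> x \<in> N"
  shows "submod R N M"
  using assms by (intro LinearCombinations.submodule.intro)

lemma submod_subset: "submod R N M \<Longrightarrow> x \<in> N \<Longrightarrow> x \<in> carrier M"
  unfolding LinearCombinations.submodule_def by auto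

lemma submod_module: "submod R N M \<Longrightarrow> module R (M\<lparr>carrier := N\<rparr>)"
  by (rule LinearCombinations.module.submodule_is_module[OF LinearCombinations.submodule.module])

lemma submod_incl:
  assumes "submod R K M" shows "(\<lambda>x. x) \<in> mhom R (M\<lparr>carrier := K\<rparr>) M"
  using submod_subset[OF assms] by (intro mhomI) auto

lemma submod_uminus:
  assumes "submod R N M" "x \<in> N" shows "\<ominus>\<^bsub>M\<^esub> x \<in> N"
proof -
  interpret LinearCombinations.submodule R N M by fact
  interpret M: module R M by (rule module)
  have "\<ominus>\<^bsub>M\<^esub> x = (\<ominus>\<^bsub>R\<^esub> \<one>\<^bsub>R\<^esub>) \<odot>\<^bsub>M\<^esub> x"
    using assms subset by (simp add: M.smult_l_minus subsetD)
  then show ?thesis using assms by auto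
qed

lemma submod_finsum:
  assumes "submod R N M" "f \<in> A \<rightarrow> N" shows "finsum M f A \<in> N"
proof -
  interpret LinearCombinations.submodule R N M by fact
  interpret M: module R M by (rule module)
  show ?thesis using assms(2)
  proof (induct A rule: infinite_finite_induct)
    case (insert a A)
    then show ?case using subset by (subst M.finsum_insert) auto
  qed auto
qed

lemma submod_vimage:
  assumes "module R M" "module R N" "f \<in> mhom R M N" "submod R K N"
  shows "submod R {x \<in> carrier M. f x \<in> K} M"
proof -
  interpret M: module R M by fact
  interpret LinearCombinations.submodule R K N by fact
  show ?thesis using assms
    by (intro submodI) (auto simp: mhom_add mhom_smult mhom_zero)
qed

lemma submod_image:
  assumes "module R M" "module R N" "f \<in> mhom R M N"
  shows "submod R (f ` carrier M) N"
proof -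
  interpret mod_hom R M N f by (intro mod_hom.intro mod_hom_axioms.intro assms)
  show ?thesis using im_is_submodule by (simp add: im_def)
qed

lemma submod_zero:
  assumes "module R M" shows "submod R {\<zero>\<^bsub>M\<^esub>} M"
proof -
  interpret M: module R M by fact
  show ?thesis by (rule submodI) (auto simp: assms)
qed

lemma submod_kernel:
  assumes "module R M" "module R N" "f \<in> mhom R M N"
  shows "submod R (a_kernel M N f) M"
  using submod_vimage[OF assms submod_zero] assms(2) by (simp add: a_kernel_def')

lemma span_le:
  assumes "submod R K M" "G \<subseteq> K" shows "module.span R M G \<subseteq> K"
  by (meson assms LinearCombinations.module.span_is_subset LinearCombinations.submodule.module)

lemma span_submod:
  assumes "module R M" "G \<subseteq> carrier M" shows "submod R (module.span R M G) M"
  using assms by (rule LinearCombinations.module.span_is_submodule)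

lemma span_gen:
  assumes "module R M" "G \<subseteq> carrier M" "x \<in> G" shows "x \<in> module.span R M G"
  using LinearCombinations.module.in_own_span[OF assms(1,2)] assms(3) by auto

section \<open>Linear combinations of finite tuples\<close>

abbreviation tuples :: "nat \<Rightarrow> ('a, 'b) partial_object_scheme \<Rightarrow> (nat \<Rightarrow> 'a) set" where
  "tuples n M \<equiv> {..<n} \<rightarrow> carrier M"

definition lsum :: "('r, 'm) module \<Rightarrow> nat \<Rightarrow> (nat \<Rightarrow> 'r) \<Rightarrow> (nat \<Rightarrow> 'm) \<Rightarrow> 'm" where
  "lsum M n c x = (\<Oplus>\<^bsub>M\<^esub>j\<in>{..<n}. c j \<odot>\<^bsub>M\<^esub> x j)"

lemma lsum_closed:
  assumes "module R M" "c \<in> tuples n R" "x \<in> tuples n M"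
  shows "lsum M n c x \<in> carrier M"
proof -
  interpret M: module R M by fact
  show ?thesis unfolding lsum_def using assms by (intro M.finsum_closed) auto
qed

lemma lsum_cong:
  assumes "module R M" "c \<in> tuples n R" "x \<in> tuples n M"
    and "\<And>j. j < n \<Longrightarrow> c j = c' j" "\<And>j. j < n \<Longrightarrow> x j = x' j"
  shows "lsum M n c x = lsum M n c' x'"
proof -
  interpret M: module R M by fact
  show ?thesis unfolding lsum_def
    using assms(2,3) by (intro M.finsum_cong') (auto simp: assms(4,5)[symmetric] Pi_iff)
qed

lemma submod_lsum:
  assumes "submod R N M" "c \<in> tuples n R" "x \<in> {..<n} \<rightarrow> N"
  shows "lsum M n c x \<in> N"
  unfolding lsum_def using assms
  by (intro submod_finsum[OF assms(1)]) (auto intro!: LinearCombinations.submodule.smult_closed)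

lemma mhom_lsum:
  assumes "module R M" "module R N" "f \<in> mhom R M N"
    and "c \<in> tuples n R" "x \<in> tuples n M"
  shows "f (lsum M n c x) = lsum N n c (\<lambda>j. f (x j))"
proof -
  interpret M: module R M by fact
  interpret N: module R N by fact
  have "f (lsum M n c x) = (\<Oplus>\<^bsub>N\<^esub>j\<in>{..<n}. f (c j \<odot>\<^bsub>M\<^esub> x j))"
    unfolding lsum_def using assms by (intro mhom_finsum) auto
  also have "\<dots> = lsum N n c (\<lambda>j. f (x j))"
    unfolding lsum_def using assms mhom_closed[OF assms(3)]
    by (intro N.finsum_cong') (auto simp: mhom_smult Pi_iff)
  finally show ?thesis .
qed

lemma lsum_submod:
  assumes "submod R K M" "c \<in> tuples n R" "x \<in> {..<n} \<rightarrow> K"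
  shows "lsum (M\<lparr>carrier := K\<rparr>) n c x = lsum M n c x"
  using assms(2,3)
  by (intro mhom_lsum[OF submod_module LinearCombinations.submodule.module submod_incl, OF assms(1,1,1)]) simp_all

text \<open>Members of \<open>tuples\<close> are arbitrary beyond \<open>n\<close>, whereas elements
  of a power of \<open>R\<close> are extensional; this is the passage from the former to the latter
  when a tuple has to become an element of a module.\<close>

lemma lsum_restrict:
  assumes "module R M" "c \<in> tuples n R" "x \<in> tuples n M"
  shows "lsum M n (restrict c {..<n}) x = lsum M n c x"
  using assms(2) by (intro lsum_cong[OF assms(1) _ assms(3)]) auto

lemma finsum_swap:
  assumes "module R M" "finite B" "\<And>a b. a \<in> A \<Longrightarrow> b \<in> B \<Longrightarrow> g a b \<in> carrier M"
  shows "(\<Oplus>\<^bsub>M\<^esub>a\<in>A. \<Oplus>\<^bsub>M\<^esub>b\<in>B. g a b) = (\<Oplus>\<^bsub>M\<^esub>b\<in>B. \<Oplus>\<^bsub>M\<^esub>a\<in>A. g a b)"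
proof -
  interpret M: module R M by fact
  show ?thesis using assms(2,3)
  proof (induct B rule: finite_induct)
    case (insert b B)
    have "(\<Oplus>\<^bsub>M\<^esub>a\<in>A. \<Oplus>\<^bsub>M\<^esub>b\<in>insert b B. g a b) = (\<Oplus>\<^bsub>M\<^esub>a\<in>A. g a b \<oplus>\<^bsub>M\<^esub> (\<Oplus>\<^bsub>M\<^esub>b\<in>B. g a b))"
      using insert by (intro M.finsum_cong') (auto simp: M.finsum_insert Pi_iff)
    also have "\<dots> = (\<Oplus>\<^bsub>M\<^esub>a\<in>A. g a b) \<oplus>\<^bsub>M\<^esub> (\<Oplus>\<^bsub>M\<^esub>a\<in>A. \<Oplus>\<^bsub>M\<^esub>b\<in>B. g a b)"
      using insert by (intro M.finsum_addf) auto
    also have "\<dots> = (\<Oplus>\<^bsub>M\<^esub>b\<in>insert b B. \<Oplus>\<^bsub>M\<^esub>a\<in>A. g a b)"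
      using insert by (subst M.finsum_insert) auto
    finally show ?case .
  qed auto
qed

section \<open>The ring as a module over itself\<close>

lemma regular_module_simps [simp]:
  "carrier (regular_module R) = carrier R"
  "\<zero>\<^bsub>regular_module R\<^esub> = \<zero>\<^bsub>R\<^esub>"
  "x \<oplus>\<^bsub>regular_module R\<^esub> y = x \<oplus>\<^bsub>R\<^esub> y"
  "x \<odot>\<^bsub>regular_module R\<^esub> y = x \<otimes>\<^bsub>R\<^esub> y"
  by (simp_all add: regular_module_def)

lemma regular_module:
  assumes "cring R" shows "module R (regular_module R)"
proof -
  interpret cring R by fact
  show ?thesis
    by (rule LinearCombinations.module_criteria[OF assms])
      (auto simp: a_ac m_ac l_distr r_distr intro: r_neg intro!: bexI[of _ "\<ominus>\<^bsub>R\<^esub> _"])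
qed

text \<open>\<open>finsum\<close> reads only the carrier, the addition and the zero of the record,
  and these agree. A relation in \<open>R\<close> can thus be written as an \<open>lsum\<close> over
  \<open>regular_module R\<close>.\<close>

lemma finsum_regular: "finsum (regular_module R) = finsum R"
  by (intro ext) (simp add: finsum_def finprod_def regular_module_def)

lemma lsum_scale_coeff:
  assumes "module R M" "c \<in> tuples n R" "x \<in> tuples n M" "r \<in> carrier R"
  shows "lsum M n (\<lambda>j. r \<otimes>\<^bsub>R\<^esub> c j) x = r \<odot>\<^bsub>M\<^esub> lsum M n c x"
proof -
  interpret M: module R M by fact
  show ?thesis
    unfolding lsum_def using assms
    by (subst M.finsum_smult_ldistr) (auto intro!: M.finsum_cong' simp: M.smult_assoc1 Pi_iff)
qed

lemma lsum_scale:
  assumes "module R M" "c \<in> tuples n R" "x \<in> tuples n M" "r \<in> carrier R"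
  shows "lsum M n c (\<lambda>j. r \<odot>\<^bsub>M\<^esub> x j) = r \<odot>\<^bsub>M\<^esub> lsum M n c x"
  using mhom_lsum[OF assms(1,1) mhom_scale[OF assms(1) mhom_id assms(4)] assms(2,3)] by simp

text \<open>Associativity for a row \<open>c\<close>, a matrix \<open>d\<close> and a column
  \<open>x\<close>, obtained by exchanging two finite sums. With it solutions of one equation are
  substituted into another.\<close>

lemma lsum_assoc:
  assumes "module R M" "c \<in> tuples n R" "\<And>j. j < n \<Longrightarrow> d j \<in> tuples m R"
    and "x \<in> tuples m M"
  shows "lsum M n c (\<lambda>j. lsum M m (d j) x)
       = lsum M m (\<lambda>v. lsum (regular_module R) n c (\<lambda>j. d j v)) x"
proof -
  interpret M: module R M by fact
  have "lsum M n c (\<lambda>j. lsum M m (d j) x) = (\<Oplus>\<^bsub>M\<^esub>j\<in>{..<n}. \<Oplus>\<^bsub>M\<^esub>v\<in>{..<m}. c j \<odot>\<^bsub>M\<^esub> (d j v \<odot>\<^bsub>M\<^esub> x v))"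
    unfolding lsum_def using assms(2-4)
    by (intro M.finsum_cong' M.finsum_smult_ldistr) (fastforce simp: Pi_iff)+
  also have "\<dots> = (\<Oplus>\<^bsub>M\<^esub>v\<in>{..<m}. \<Oplus>\<^bsub>M\<^esub>j\<in>{..<n}. c j \<odot>\<^bsub>M\<^esub> (d j v \<odot>\<^bsub>M\<^esub> x v))"
    using assms(2-4) by (intro finsum_swap[OF assms(1)]) (fastforce simp: Pi_iff)+
  also have "\<dots> = (\<Oplus>\<^bsub>M\<^esub>v\<in>{..<m}. (\<Oplus>\<^bsub>R\<^esub>j\<in>{..<n}. c j \<otimes>\<^bsub>R\<^esub> d j v) \<odot>\<^bsub>M\<^esub> x v)"
  proof (intro M.finsum_cong' refl)
    fix v assume "v \<in> {..<m}"
    then show "(\<Oplus>\<^bsub>M\<^esub>j\<in>{..<n}. c j \<odot>\<^bsub>M\<^esub> (d j v \<odot>\<^bsub>M\<^esub> x v)) = (\<Oplus>\<^bsub>R\<^esub>j\<in>{..<n}. c j \<otimes>\<^bsub>R\<^esub> d j v) \<odot>\<^bsub>M\<^esub> x v"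
      using assms(2-4)
      by (subst M.finsum_smult_r)
        (fastforce simp: Pi_iff M.smult_assoc1 intro!: M.finsum_cong')+
  qed (use assms(2-4) in \<open>fastforce simp: Pi_iff intro!: M.R.finsum_closed M.smult_closed\<close>)
  finally show ?thesis
    by (simp add: lsum_def finsum_regular)
qed

lemma lsum_delta:
  assumes "module R M" "x \<in> tuples n M" "i < n"
  shows "lsum M n (\<lambda>j. if j = i then \<one>\<^bsub>R\<^esub> else \<zero>\<^bsub>R\<^esub>) x = x i"
proof -
  interpret M: module R M by fact
  have "lsum M n (\<lambda>j. if j = i then \<one>\<^bsub>R\<^esub> else \<zero>\<^bsub>R\<^esub>) x
      = (\<Oplus>\<^bsub>M\<^esub>j\<in>{..<n}. if j = i then x j else \<zero>\<^bsub>M\<^esub>)"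
    unfolding lsum_def using assms by (intro M.finsum_cong') (auto simp: Pi_iff)
  also have "\<dots> = x i"
    using assms(2,3) by (intro M.add.finprod_singleton_swap) auto
  finally show ?thesis .
qed

lemma lsum_regular_comm:
  assumes "cring R" "c \<in> tuples n R" "x \<in> tuples n R"
  shows "lsum (regular_module R) n c x = lsum (regular_module R) n x c"
proof -
  interpret cring R by fact
  show ?thesis unfolding lsum_def finsum_regular using assms(2,3)
    by (intro finsum_cong') (auto simp: m_comm Pi_iff)
qed

section \<open>Products, free modules and quotients\<close>

lemma direct_product_simps [simp]:
  "carrier (direct_product I M) = (\<Pi>\<^sub>E i\<in>I. carrier (M i))"
  "\<zero>\<^bsub>direct_product I M\<^esub> = (\<lambda>i\<in>I. \<zero>\<^bsub>M i\<^esub>)"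
  "x \<oplus>\<^bsub>direct_product I M\<^esub> y = (\<lambda>i\<in>I. x i \<oplus>\<^bsub>M i\<^esub> y i)"
  "r \<odot>\<^bsub>direct_product I M\<^esub> x = (\<lambda>i\<in>I. r \<odot>\<^bsub>M i\<^esub> x i)"
  by (simp_all add: direct_product_def)

lemma direct_product_module:
  assumes "cring R" "\<And>i. i \<in> I \<Longrightarrow> module R (M i)"
  shows "module R (direct_product I M)"
proof -
  note am = module.axioms(2)[OF assms(2)]
  note ag = abelian_group.axioms(1)[OF am]
  note [simp] = abelian_monoid.a_closed[OF ag] abelian_monoid.a_assoc[OF ag]
    abelian_monoid.r_zero[OF ag] abelian_monoid.zero_closed[OF ag]
    abelian_group.a_inv_closed[OF am] abelian_group.r_neg[OF am]
    module.smult_closed[OF assms(2)] module.smult_assoc1[OF assms(2)] module.smult_one[OF assms(2)]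
    module.smult_l_distr[OF assms(2)] module.smult_r_distr[OF assms(2)]
  show ?thesis
  proof (rule LinearCombinations.module_criteria[OF assms(1)])
    show "\<forall>v\<in>carrier (direct_product I M). \<exists>neg_v\<in>carrier (direct_product I M).
        v \<oplus>\<^bsub>direct_product I M\<^esub> neg_v = \<zero>\<^bsub>direct_product I M\<^esub>"
    proof
      fix v assume "v \<in> carrier (direct_product I M)"
      then show "\<exists>neg_v\<in>carrier (direct_product I M).
          v \<oplus>\<^bsub>direct_product I M\<^esub> neg_v = \<zero>\<^bsub>direct_product I M\<^esub>"
        by (intro bexI[of _ "\<lambda>i\<in>I. \<ominus>\<^bsub>M i\<^esub> v i"]) (auto intro!: restrict_ext simp: PiE_iff)
    qed
    show "\<forall>v w. v \<in> carrier (direct_product I M) \<and> w \<in> carrier (direct_product I M) \<longrightarrow>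
        v \<oplus>\<^bsub>direct_product I M\<^esub> w = w \<oplus>\<^bsub>direct_product I M\<^esub> v"
      by (auto intro!: restrict_ext abelian_monoid.a_comm[OF ag] simp: PiE_iff)
    show "\<forall>v\<in>carrier (direct_product I M).
        v \<oplus>\<^bsub>direct_product I M\<^esub> \<zero>\<^bsub>direct_product I M\<^esub> = v"
    proof
      fix v assume v: "v \<in> carrier (direct_product I M)"
      then have "v i \<in> carrier (M i)" if "i \<in> I" for i using that by auto
      then show "v \<oplus>\<^bsub>direct_product I M\<^esub> \<zero>\<^bsub>direct_product I M\<^esub> = v"
        using v by (simp cong: restrict_cong)
    qed
    show "\<forall>v\<in>carrier (direct_product I M). \<one>\<^bsub>R\<^esub> \<odot>\<^bsub>direct_product I M\<^esub> v = v"
    proof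
      fix v assume v: "v \<in> carrier (direct_product I M)"
      then have "v i \<in> carrier (M i)" if "i \<in> I" for i using that by auto
      then show "\<one>\<^bsub>R\<^esub> \<odot>\<^bsub>direct_product I M\<^esub> v = v"
        using v by (simp cong: restrict_cong)
    qed
  qed (auto intro!: restrict_ext cring.cring_simprules(1,5)[OF assms(1)] simp: PiE_iff)
qed

lemma proj_mhom: "i \<in> I \<Longrightarrow> (\<lambda>f. f i) \<in> mhom R (direct_product I M) (M i)"
  by (rule mhomI) (auto simp: PiE_iff)

lemma tuple_mhom:
  assumes "\<And>i. i \<in> I \<Longrightarrow> h i \<in> mhom R P (M i)"
  shows "(\<lambda>x. \<lambda>i\<in>I. h i x) \<in> mhom R P (direct_product I M)"
  by (intro mhomI)
    (auto simp: mhom_closed[OF assms] mhom_add[OF assms] mhom_smult[OF assms] intro!: restrict_ext)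

lemma lsum_direct_product:
  assumes "cring R" "\<And>i. i \<in> I \<Longrightarrow> module R (M i)" "i \<in> I"
    and "c \<in> tuples n R" "x \<in> tuples n (direct_product I M)"
  shows "lsum (direct_product I M) n c x i = lsum (M i) n c (\<lambda>j. x j i)"
  using mhom_lsum[OF direct_product_module assms(2)[OF assms(3)] proj_mhom[OF assms(3)] assms(4,5)]
    assms(1,2) by auto

section \<open>Free modules\<close>

lemma free_module_simps [simp]:
  "carrier (free_module R X) = {f \<in> X \<rightarrow>\<^sub>E carrier R. finite {x \<in> X. f x \<noteq> \<zero>\<^bsub>R\<^esub>}}"
  "\<zero>\<^bsub>free_module R X\<^esub> = (\<lambda>x\<in>X. \<zero>\<^bsub>R\<^esub>)"
  "f \<oplus>\<^bsub>free_module R X\<^esub> g = (\<lambda>x\<in>X. f x \<oplus>\<^bsub>R\<^esub> g x)"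
  "r \<odot>\<^bsub>free_module R X\<^esub> f = (\<lambda>x\<in>X. r \<otimes>\<^bsub>R\<^esub> f x)"
  by (simp_all add: free_module_def)

lemma free_module_submod:
  assumes "cring R"
  shows "submod R {f \<in> X \<rightarrow>\<^sub>E carrier R. finite {x \<in> X. f x \<noteq> \<zero>\<^bsub>R\<^esub>}}
    (direct_product X (\<lambda>_. regular_module R))"
proof -
  interpret cring R by fact
  show ?thesis
  proof (rule submodI)
    show "module R (direct_product X (\<lambda>_. regular_module R))"
      by (intro direct_product_module assms regular_module)
  next
    fix f g assume fg: "f \<in> {f \<in> X \<rightarrow>\<^sub>E carrier R. finite {x \<in> X. f x \<noteq> \<zero>\<^bsub>R\<^esub>}}"
      "g \<in> {f \<in> X \<rightarrow>\<^sub>E carrier R. finite {x \<in> X. f x \<noteq> \<zero>\<^bsub>R\<^esub>}}"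
    have "finite {x \<in> X. f x \<oplus>\<^bsub>R\<^esub> g x \<noteq> \<zero>\<^bsub>R\<^esub>}"
      by (rule finite_subset[of _ "{x \<in> X. f x \<noteq> \<zero>\<^bsub>R\<^esub>} \<union> {x \<in> X. g x \<noteq> \<zero>\<^bsub>R\<^esub>}"]) (use fg in auto)
    then show "f \<oplus>\<^bsub>direct_product X (\<lambda>_. regular_module R)\<^esub> g
        \<in> {f \<in> X \<rightarrow>\<^sub>E carrier R. finite {x \<in> X. f x \<noteq> \<zero>\<^bsub>R\<^esub>}}"
      using fg by (auto simp: PiE_iff cong: conj_cong)
  next
    fix r f assume rf: "r \<in> carrier R" "f \<in> {f \<in> X \<rightarrow>\<^sub>E carrier R. finite {x \<in> X. f x \<noteq> \<zero>\<^bsub>R\<^esub>}}"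
    have "finite {x \<in> X. r \<otimes>\<^bsub>R\<^esub> f x \<noteq> \<zero>\<^bsub>R\<^esub>}"
      by (rule finite_subset[of _ "{x \<in> X. f x \<noteq> \<zero>\<^bsub>R\<^esub>}"]) (use rf in auto)
    then show "r \<odot>\<^bsub>direct_product X (\<lambda>_. regular_module R)\<^esub> f
        \<in> {f \<in> X \<rightarrow>\<^sub>E carrier R. finite {x \<in> X. f x \<noteq> \<zero>\<^bsub>R\<^esub>}}"
      using rf by (auto simp: PiE_iff cong: conj_cong)
  qed (auto cong: conj_cong)
qed

lemma free_module:
  assumes "cring R" shows "module R (free_module R X)"
  using submod_module[OF free_module_submod[OF assms]] by (simp add: free_module_def)

lemma coeff_mhom: "x \<in> X \<Longrightarrow> (\<lambda>f. f x) \<in> mhom R (free_module R X) (regular_module R)"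
  by (rule mhomI) (auto simp: PiE_iff)

lemma free_gen_closed:
  assumes "cring R" "x \<in> X" shows "free_gen R X x \<in> carrier (free_module R X)"
proof -
  interpret cring R by fact
  have "finite {y \<in> X. free_gen R X x y \<noteq> \<zero>\<^bsub>R\<^esub>}"
    by (rule finite_subset[of _ "{x}"]) (auto simp: free_gen_def split: if_splits)
  then show ?thesis by (auto simp: free_gen_def)
qed

lemma free_lift_gen:
  assumes "module R M" "x \<in> X" "g x \<in> carrier M"
  shows "free_lift R X M g (free_gen R X x) = g x"
proof -
  interpret M: module R M by fact
  show ?thesis
  proof (cases "\<one>\<^bsub>R\<^esub> = \<zero>\<^bsub>R\<^esub>")
    \<comment> \<open>Over the zero ring the generator has empty support, so the sum is zero; so is
      \<open>g x\<close>, being its own multiple by one.\<close>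
    case True
    then have e: "{y \<in> X. free_gen R X x y \<noteq> \<zero>\<^bsub>R\<^esub>} = {}" by (auto simp: free_gen_def)
    have "g x = \<zero>\<^bsub>M\<^esub>" using True M.smult_one[OF assms(3)] assms(3) by simp
    then show ?thesis unfolding free_lift_def e by simp
  next
    case False
    then have "{y \<in> X. free_gen R X x y \<noteq> \<zero>\<^bsub>R\<^esub>} = {x}"
      using assms by (auto simp: free_gen_def)
    then show ?thesis using assms by (simp add: free_lift_def free_gen_def)
  qed
qed

text \<open>The support varies with the function; padding with zero terms allows the sums for
  several functions to be compared over one finite index set.\<close>

lemma free_lift_superset:
  assumes "module R M" "g \<in> X \<rightarrow> carrier M" "\<phi> \<in> carrier (free_module R X)"
    and "finite Y" "{x \<in> X. \<phi> x \<noteq> \<zero>\<^bsub>R\<^esub>} \<subseteq> Y" "Y \<subseteq> X"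
  shows "free_lift R X M g \<phi> = (\<Oplus>\<^bsub>M\<^esub>x\<in>Y. \<phi> x \<odot>\<^bsub>M\<^esub> g x)"
proof -
  interpret M: module R M by fact
  show ?thesis unfolding free_lift_def
    using assms(2-6)
    by (intro M.add.finprod_mono_neutral_cong_left)
      (auto simp: Pi_iff PiE_iff subset_iff intro!: M.smult_closed)
qed

lemma free_lift_mhom:
  assumes "module R M" "g \<in> X \<rightarrow> carrier M"
  shows "free_lift R X M g \<in> mhom R (free_module R X) M"
proof -
  interpret M: module R M by fact
  have F: "module R (free_module R X)" by (rule free_module) (rule M.is_cring)
  interpret F: module R "free_module R X" by fact
  let ?s = "\<lambda>\<phi>. {x \<in> X. \<phi> x \<noteq> \<zero>\<^bsub>R\<^esub>}"
  have cl: "(\<lambda>x. \<phi> x \<odot>\<^bsub>M\<^esub> g x) \<in> Y \<rightarrow> carrier M" if "\<phi> \<in> carrier (free_module R X)" "Y \<subseteq> X" for \<phi> Y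
    using that assms(2) by (auto simp: Pi_iff PiE_iff)
  show ?thesis
  proof (rule mhomI)
    fix \<phi> assume \<phi>: "\<phi> \<in> carrier (free_module R X)"
    then show "free_lift R X M g \<phi> \<in> carrier M"
      unfolding free_lift_def by (intro M.finsum_closed cl) auto
  next
    fix \<phi> \<psi> assume \<phi>: "\<phi> \<in> carrier (free_module R X)" and \<psi>: "\<psi> \<in> carrier (free_module R X)"
    have s: "\<phi> \<oplus>\<^bsub>free_module R X\<^esub> \<psi> \<in> carrier (free_module R X)" using \<phi> \<psi> by (rule F.a_closed)
    \<comment> \<open>Cancellation may shrink the support of the sum, so all three values are
      computed over the union of the two supports.\<close>
    let ?Y = "?s \<phi> \<union> ?s \<psi>"
    have Y: "finite ?Y" "?Y \<subseteq> X" using \<phi> \<psi> by auto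
    have "free_lift R X M g (\<phi> \<oplus>\<^bsub>free_module R X\<^esub> \<psi>)
        = (\<Oplus>\<^bsub>M\<^esub>x\<in>?Y. (\<phi> \<oplus>\<^bsub>free_module R X\<^esub> \<psi>) x \<odot>\<^bsub>M\<^esub> g x)"
      by (rule free_lift_superset[OF assms s Y(1) _ Y(2)]) auto
    also have "\<dots> = (\<Oplus>\<^bsub>M\<^esub>x\<in>?Y. \<phi> x \<odot>\<^bsub>M\<^esub> g x \<oplus>\<^bsub>M\<^esub> \<psi> x \<odot>\<^bsub>M\<^esub> g x)"
      using assms(2) \<phi> \<psi>
      by (intro M.finsum_cong' refl Pi_I M.a_closed M.smult_closed)
        (auto simp: Pi_iff PiE_iff intro!: M.smult_l_distr)
    also have "\<dots> = (\<Oplus>\<^bsub>M\<^esub>x\<in>?Y. \<phi> x \<odot>\<^bsub>M\<^esub> g x) \<oplus>\<^bsub>M\<^esub> (\<Oplus>\<^bsub>M\<^esub>x\<in>?Y. \<psi> x \<odot>\<^bsub>M\<^esub> g x)"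
      by (intro M.finsum_addf cl \<phi> \<psi> Y)
    also have "(\<Oplus>\<^bsub>M\<^esub>x\<in>?Y. \<phi> x \<odot>\<^bsub>M\<^esub> g x) = free_lift R X M g \<phi>"
      by (rule free_lift_superset[OF assms \<phi> Y(1) _ Y(2), symmetric]) auto
    also have "(\<Oplus>\<^bsub>M\<^esub>x\<in>?Y. \<psi> x \<odot>\<^bsub>M\<^esub> g x) = free_lift R X M g \<psi>"
      by (rule free_lift_superset[OF assms \<psi> Y(1) _ Y(2), symmetric]) auto
    finally show "free_lift R X M g (\<phi> \<oplus>\<^bsub>free_module R X\<^esub> \<psi>)
        = free_lift R X M g \<phi> \<oplus>\<^bsub>M\<^esub> free_lift R X M g \<psi>" .
  next
    fix r \<phi> assume r: "r \<in> carrier R" and \<phi>: "\<phi> \<in> carrier (free_module R X)"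
    have s: "r \<odot>\<^bsub>free_module R X\<^esub> \<phi> \<in> carrier (free_module R X)" using r \<phi> by (rule F.smult_closed)
    have Y: "finite (?s \<phi>)" "?s \<phi> \<subseteq> X" using \<phi> by auto
    have "free_lift R X M g (r \<odot>\<^bsub>free_module R X\<^esub> \<phi>)
        = (\<Oplus>\<^bsub>M\<^esub>x\<in>?s \<phi>. (r \<odot>\<^bsub>free_module R X\<^esub> \<phi>) x \<odot>\<^bsub>M\<^esub> g x)"
      by (rule free_lift_superset[OF assms s Y(1) _ Y(2)]) (use r in auto)
    also have "\<dots> = (\<Oplus>\<^bsub>M\<^esub>x\<in>?s \<phi>. r \<odot>\<^bsub>M\<^esub> (\<phi> x \<odot>\<^bsub>M\<^esub> g x))"
      using r \<phi> assms(2)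
      by (intro M.finsum_cong' refl Pi_I M.smult_closed)
        (auto simp: Pi_iff PiE_iff intro!: M.smult_assoc1)
    also have "\<dots> = r \<odot>\<^bsub>M\<^esub> free_lift R X M g \<phi>"
      unfolding free_lift_def by (intro M.finsum_smult[symmetric] r cl \<phi>) auto
    finally show "free_lift R X M g (r \<odot>\<^bsub>free_module R X\<^esub> \<phi>) = r \<odot>\<^bsub>M\<^esub> free_lift R X M g \<phi>" .
  qed
qed

text \<open>At each coordinate at most one term of the sum survives. This is the spanning property
  behind \<open>free_module_hom_ext\<close> and \<open>tensor_induct\<close>.\<close>

lemma free_module_expansion:
  assumes "cring R" "\<phi> \<in> carrier (free_module R X)"
  shows "free_lift R X (free_module R X) (free_gen R X) \<phi> = \<phi>"
proof -
  interpret cring R by fact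
  interpret F: module R "free_module R X" by (rule free_module) fact
  let ?h = "free_lift R X (free_module R X) (free_gen R X)"
  have g: "free_gen R X \<in> X \<rightarrow> carrier (free_module R X)"
    by (intro Pi_I free_gen_closed[OF assms(1)])
  have \<phi>: "\<phi> x \<in> carrier R" if "x \<in> X" for x using assms(2) that by (simp add: PiE_iff)
  have h: "?h \<in> mhom R (free_module R X) (free_module R X)"
    by (rule free_lift_mhom[OF F.module_axioms g])
  have "?h \<phi> \<in> carrier (free_module R X)" by (rule mhom_closed[OF h assms(2)])
  moreover have "?h \<phi> x = \<phi> x" if x: "x \<in> X" for x
  proof -
    let ?Y = "{x \<in> X. \<phi> x \<noteq> \<zero>\<^bsub>R\<^esub>}"
    have "?h \<phi> x = (\<Oplus>\<^bsub>regular_module R\<^esub>y\<in>?Y. (\<phi> y \<odot>\<^bsub>free_module R X\<^esub> free_gen R X y) x)"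
      unfolding free_lift_def
    proof (rule mhom_finsum[OF F.module_axioms regular_module[OF assms(1)] coeff_mhom[OF x]], rule Pi_I)
      fix y assume "y \<in> ?Y"
      then have "\<phi> y \<in> carrier R" "free_gen R X y \<in> carrier (free_module R X)"
        using \<phi>[of y] free_gen_closed[OF assms(1), of y X] by simp_all
      then show "\<phi> y \<odot>\<^bsub>free_module R X\<^esub> free_gen R X y \<in> carrier (free_module R X)"
        by (rule F.smult_closed)
    qed
    also have "\<dots> = (\<Oplus>\<^bsub>R\<^esub>y\<in>?Y. if x = y then \<phi> y else \<zero>\<^bsub>R\<^esub>)"
      unfolding finsum_regular using \<phi> x
      by (intro finsum_cong') (auto simp: free_gen_def)
    also have "\<dots> = \<phi> x"
    proof (cases "x \<in> ?Y")
      case True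
      then show ?thesis using assms(2) \<phi> by (intro add.finprod_singleton) auto
    next
      case False
      have "(\<Oplus>\<^bsub>R\<^esub>y\<in>?Y. if x = y then \<phi> y else \<zero>\<^bsub>R\<^esub>) = (\<Oplus>\<^bsub>R\<^esub>y\<in>?Y. \<zero>\<^bsub>R\<^esub>)"
        using False by (intro finsum_cong') auto
      then show ?thesis using False x by simp
    qed
    finally show ?thesis .
  qed
  ultimately show ?thesis
    using assms(2) by (intro PiE_ext[of "?h \<phi>" X "\<lambda>_. carrier R"]) simp_all
qed

lemma free_module_hom_ext:
  assumes "module R M" "f \<in> mhom R (free_module R X) M" "g \<in> mhom R (free_module R X) M"
    and "\<And>x. x \<in> X \<Longrightarrow> f (free_gen R X x) = g (free_gen R X x)"
    and "\<phi> \<in> carrier (free_module R X)"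
  shows "f \<phi> = g \<phi>"
proof -
  interpret M: module R M by fact
  have R: "cring R" by (rule M.is_cring)
  interpret F: module R "free_module R X" by (rule free_module[OF R])
  let ?Y = "{x \<in> X. \<phi> x \<noteq> \<zero>\<^bsub>R\<^esub>}"
  have \<phi>: "\<phi> x \<in> carrier R" if "x \<in> X" for x using assms(5) that by auto
  have gen: "free_gen R X x \<in> carrier (free_module R X)" if "x \<in> X" for x
    by (rule free_gen_closed[OF R that])
  have exp: "h \<phi> = (\<Oplus>\<^bsub>M\<^esub>x\<in>?Y. \<phi> x \<odot>\<^bsub>M\<^esub> h (free_gen R X x))"
    if h: "h \<in> mhom R (free_module R X) M" for h
  proof -
    have "h \<phi> = h (\<Oplus>\<^bsub>free_module R X\<^esub>x\<in>?Y. \<phi> x \<odot>\<^bsub>free_module R X\<^esub> free_gen R X x)"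
      using free_module_expansion[OF R assms(5)] by (simp add: free_lift_def)
    also have "\<dots> = (\<Oplus>\<^bsub>M\<^esub>x\<in>?Y. h (\<phi> x \<odot>\<^bsub>free_module R X\<^esub> free_gen R X x))"
      by (rule mhom_finsum[OF F.module_axioms assms(1) h]) (auto intro: F.smult_closed[OF \<phi> gen] simp del: free_module_simps)
    also have "\<dots> = (\<Oplus>\<^bsub>M\<^esub>x\<in>?Y. \<phi> x \<odot>\<^bsub>M\<^esub> h (free_gen R X x))"
    proof (rule M.finsum_cong'[OF refl], rule Pi_I)
      fix x assume "x \<in> ?Y"
      then have x: "x \<in> X" by simp
      show "\<phi> x \<odot>\<^bsub>M\<^esub> h (free_gen R X x) \<in> carrier M"
        by (rule M.smult_closed[OF \<phi>[OF x] mhom_closed[OF h gen[OF x]]])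
    next
      fix x assume "x \<in> ?Y"
      then have x: "x \<in> X" by simp
      show "h (\<phi> x \<odot>\<^bsub>free_module R X\<^esub> free_gen R X x) = \<phi> x \<odot>\<^bsub>M\<^esub> h (free_gen R X x)"
        by (rule mhom_smult[OF h \<phi>[OF x] gen[OF x]])
    qed
    finally show ?thesis .
  qed
  show ?thesis
    unfolding exp[OF assms(2)] exp[OF assms(3)]
  proof (rule M.finsum_cong'[OF refl], rule Pi_I)
    fix x assume "x \<in> ?Y"
    then have x: "x \<in> X" by simp
    show "\<phi> x \<odot>\<^bsub>M\<^esub> g (free_gen R X x) \<in> carrier M"
      by (rule M.smult_closed[OF \<phi>[OF x] mhom_closed[OF assms(3) gen[OF x]]])
  qed (simp add: assms(4))
qed

section \<open>Quotient modules\<close>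

definition coset_of :: "('r, 'm) module \<Rightarrow> 'm set \<Rightarrow> 'm \<Rightarrow> 'm set" where
  "coset_of M N x = N +>\<^bsub>M\<^esub> x"

lemma submod_abelian_subgroup:
  assumes "submod R N M" shows "abelian_subgroup N M"
proof -
  interpret LinearCombinations.submodule R N M by fact
  interpret M: module R M by (rule module)
  have "additive_subgroup N M"
    by (intro additive_subgroup.intro M.add.subgroupI)
      (use assms subset zero_closed in
        \<open>auto simp: a_inv_def[symmetric] simp del: zero_closed intro: submod_uminus\<close>)
  then show ?thesis by (rule abelian_subgroupI3) (rule M.abelian_group_axioms)
qed

lemma quot_module_carrier: "carrier (quot_module M N) = coset_of M N ` carrier M"
  by (auto simp: quot_module_def coset_of_def A_RCOSETS_def')

lemma quot_module_zero: "\<zero>\<^bsub>quot_module M N\<^esub> = N"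
  by (simp add: quot_module_def)

lemma coset_of_eq_iff:
  assumes "submod R N M" "x \<in> carrier M" "y \<in> carrier M"
  shows "coset_of M N x = coset_of M N y \<longleftrightarrow> x \<ominus>\<^bsub>M\<^esub> y \<in> N"
proof -
  interpret abelian_subgroup N M by (rule submod_abelian_subgroup[OF assms(1)])
  show ?thesis
  proof
    assume "coset_of M N x = coset_of M N y"
    then have "x \<in> N +>\<^bsub>M\<^esub> y" using a_rcos_self[OF assms(2)] by (simp add: coset_of_def)
    then show "x \<ominus>\<^bsub>M\<^esub> y \<in> N" using a_rcos_module[OF assms(3,2)] by (simp add: a_minus_def)
  next
    assume "x \<ominus>\<^bsub>M\<^esub> y \<in> N"
    then have "x \<in> N +>\<^bsub>M\<^esub> y" using a_rcos_module[OF assms(3,2)] by (simp add: a_minus_def)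
    then show "coset_of M N x = coset_of M N y"
      unfolding coset_of_def by (rule a_repr_independence'[OF _ assms(3), symmetric])
  qed
qed

lemma coset_of_eq_self_iff:
  assumes "submod R N M" "x \<in> carrier M"
  shows "coset_of M N x = N \<longleftrightarrow> x \<in> N"
proof -
  interpret abelian_subgroup N M by (rule submod_abelian_subgroup[OF assms(1)])
  show ?thesis
    unfolding coset_of_def using assms a_rcos_const a_rcos_self by blast
qed

lemma coset_of_add:
  assumes "submod R N M" "x \<in> carrier M" "y \<in> carrier M"
  shows "coset_of M N x \<oplus>\<^bsub>quot_module M N\<^esub> coset_of M N y = coset_of M N (x \<oplus>\<^bsub>M\<^esub> y)"
proof -
  interpret abelian_subgroup N M by (rule submod_abelian_subgroup[OF assms(1)])
  show ?thesis
    using assms by (simp add: coset_of_def quot_module_def a_rcos_sum)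
qed

text \<open>Scalar multiplication in \<open>quot_module\<close> is a union over all representatives.
  Since \<open>r\<close> maps \<open>N\<close> into itself, every representative contributes the
  same coset, and the union is over a nonempty set.\<close>

lemma coset_of_smult:
  assumes "submod R N M" "r \<in> carrier R" "x \<in> carrier M"
  shows "r \<odot>\<^bsub>quot_module M N\<^esub> coset_of M N x = coset_of M N (r \<odot>\<^bsub>M\<^esub> x)"
proof -
  interpret S: LinearCombinations.submodule R N M by fact
  interpret M: module R M by (rule S.module)
  interpret abelian_subgroup N M by (rule submod_abelian_subgroup[OF assms(1)])
  have "coset_of M N (r \<odot>\<^bsub>M\<^esub> y) = coset_of M N (r \<odot>\<^bsub>M\<^esub> x)" if "y \<in> N +>\<^bsub>M\<^esub> x" for y
  proof -
    have y: "y \<in> carrier M" using that assms(3) a_elemrcos_carrier by blast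
    have "y \<ominus>\<^bsub>M\<^esub> x \<in> N" using that y assms(3) a_rcos_module by (simp add: a_minus_def)
    then have "r \<odot>\<^bsub>M\<^esub> (y \<ominus>\<^bsub>M\<^esub> x) \<in> N" using assms by auto
    then have "r \<odot>\<^bsub>M\<^esub> y \<ominus>\<^bsub>M\<^esub> r \<odot>\<^bsub>M\<^esub> x \<in> N"
      using y assms by (simp add: a_minus_def M.smult_r_distr M.smult_r_minus)
    then show ?thesis using y assms by (subst coset_of_eq_iff[OF assms(1)]) auto
  qed
  moreover have "N +>\<^bsub>M\<^esub> x \<noteq> {}" using a_rcos_self[OF assms(3)] by blast
  ultimately have "(\<Union>y\<in>N +>\<^bsub>M\<^esub> x. coset_of M N (r \<odot>\<^bsub>M\<^esub> y)) = coset_of M N (r \<odot>\<^bsub>M\<^esub> x)"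
    by (intro SUP_eq_const)
  then show ?thesis by (simp add: quot_module_def coset_of_def)
qed

lemma quot_module:
  assumes "submod R N M" shows "module R (quot_module M N)"
proof -
  interpret S: LinearCombinations.submodule R N M by fact
  interpret M: module R M by (rule S.module)
  note [simp] = coset_of_add[OF assms] coset_of_smult[OF assms] quot_module_carrier
  have zero: "\<zero>\<^bsub>quot_module M N\<^esub> = coset_of M N \<zero>\<^bsub>M\<^esub>"
    using coset_of_eq_self_iff[OF assms, of "\<zero>\<^bsub>M\<^esub>"] by (simp add: quot_module_zero)
  show ?thesis
  proof (rule LinearCombinations.module_criteria[OF M.is_cring])
    show "\<forall>v\<in>carrier (quot_module M N). \<exists>neg_v\<in>carrier (quot_module M N).
        v \<oplus>\<^bsub>quot_module M N\<^esub> neg_v = \<zero>\<^bsub>quot_module M N\<^esub>"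
    proof
      fix v assume "v \<in> carrier (quot_module M N)"
      then obtain x where x: "x \<in> carrier M" "v = coset_of M N x" by auto
      then show "\<exists>neg_v\<in>carrier (quot_module M N).
          v \<oplus>\<^bsub>quot_module M N\<^esub> neg_v = \<zero>\<^bsub>quot_module M N\<^esub>"
        by (intro bexI[of _ "coset_of M N (\<ominus>\<^bsub>M\<^esub> x)"]) (simp_all add: zero M.r_neg)
    qed
  qed (auto simp: zero M.a_ac M.smult_assoc1 M.smult_l_distr M.smult_r_distr)
qed

lemma coset_of_mhom:
  assumes "submod R N M" shows "coset_of M N \<in> mhom R M (quot_module M N)"
  by (rule mhomI) (auto simp: quot_module_carrier coset_of_add[OF assms] coset_of_smult[OF assms])

lemma coset_of_zero_iff:
  assumes "submod R N M" "x \<in> carrier M"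
  shows "coset_of M N x = \<zero>\<^bsub>quot_module M N\<^esub> \<longleftrightarrow> x \<in> N"
  using coset_of_eq_self_iff[OF assms] by (simp add: quot_module_zero)

section \<open>The universal property of the tensor product\<close>

definition bilinear_map ::
    "('r, 'c) ring_scheme \<Rightarrow> ('r, 'm) module \<Rightarrow> ('r, 'n) module \<Rightarrow> ('r, 'q) module
      \<Rightarrow> ('m \<Rightarrow> 'n \<Rightarrow> 'q) \<Rightarrow> bool" where
  "bilinear_map R M N Q \<beta> \<longleftrightarrow>
    (\<forall>y\<in>carrier N. (\<lambda>x. \<beta> x y) \<in> mhom R M Q) \<and> (\<forall>x\<in>carrier M. \<beta> x \<in> mhom R N Q)"

lemma bilinear_mapD:
  assumes "bilinear_map R M N Q \<beta>"
  shows "y \<in> carrier N \<Longrightarrow> (\<lambda>x. \<beta> x y) \<in> mhom R M Q" "x \<in> carrier M \<Longrightarrow> \<beta> x \<in> mhom R N Q"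
  using assms by (auto simp: bilinear_map_def)

lemma bilinear_map_comp:
  assumes "bilinear_map R M N Q \<beta>" "f \<in> mhom R M' M"
  shows "bilinear_map R M' N Q (\<lambda>x. \<beta> (f x))"
  unfolding bilinear_map_def
  using mhom_comp[OF assms(2) bilinear_mapD(1)[OF assms(1)]] bilinear_mapD(2)[OF assms(1)]
    mhom_closed[OF assms(2)] by auto

lemma bilinear_map_comp2:
  assumes "bilinear_map R M N Q \<beta>" "h \<in> mhom R Q Q'"
  shows "bilinear_map R M N Q' (\<lambda>x y. h (\<beta> x y))"
  unfolding bilinear_map_def
  using mhom_comp[OF bilinear_mapD(1)[OF assms(1)] assms(2)]
    mhom_comp[OF bilinear_mapD(2)[OF assms(1)] assms(2)] by auto

lemma bilinear_map_smult:
  assumes "module R M" shows "bilinear_map R (regular_module R) M M (\<lambda>r x. r \<odot>\<^bsub>M\<^esub> x)"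
proof -
  interpret M: module R M by fact
  show ?thesis
    unfolding bilinear_map_def
    by (auto intro!: mhomI simp: M.smult_l_distr M.smult_r_distr M.smult_assoc1[symmetric] M.R.m_comm)
qed

locale tensor_product =
  fixes R :: "('r, 'c) ring_scheme" and M :: "('r, 'm) module" and N :: "('r, 'n) module"
  assumes M_module: "module R M" and N_module: "module R N"
begin

interpretation M: module R M by (rule M_module)
interpretation N: module R N by (rule N_module)

abbreviation F where "F \<equiv> free_module R (carrier M \<times> carrier N)"
abbreviation e where "e \<equiv> free_gen R (carrier M \<times> carrier N)"
abbreviation K where "K \<equiv> tensor_kernel R M N"
abbreviation T where "T \<equiv> tensor_module R M N"
abbreviation pure where "pure \<equiv> pure_tensor R M N"

lemma F_module: "module R F"
  by (rule free_module[OF M.is_cring])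

interpretation F: module R F by (rule F_module)

lemma e_closed: "x \<in> carrier M \<Longrightarrow> y \<in> carrier N \<Longrightarrow> e (x, y) \<in> carrier F"
  by (rule free_gen_closed[OF M.is_cring]) simp

lemma relations_subset: "tensor_relations R M N \<subseteq> carrier F"
  unfolding tensor_relations_def Let_def
  using e_closed
  by (auto simp del: free_module_simps simp: M.smult_closed N.smult_closed
      intro!: F.M.minus_closed F.M.a_closed F.smult_closed)

lemma kernel_submod: "submod R K F"
  unfolding tensor_kernel_def by (rule span_submod[OF F_module relations_subset])

lemma tensor_module: "module R T"
  unfolding tensor_module_def by (rule quot_module[OF kernel_submod])

lemma pure_eq: "pure x y = coset_of F K (e (x, y))"
  by (simp add: pure_tensor_def coset_of_def)

lemma coset_mhom: "coset_of F K \<in> mhom R F T"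
  unfolding tensor_module_def by (rule coset_of_mhom[OF kernel_submod])

lemma relation_coset:
  assumes "f \<ominus>\<^bsub>F\<^esub> g \<in> tensor_relations R M N" "f \<in> carrier F" "g \<in> carrier F"
  shows "coset_of F K f = coset_of F K g"
  unfolding coset_of_eq_iff[OF kernel_submod assms(2,3)]
  unfolding tensor_kernel_def by (rule span_gen[OF F_module relations_subset assms(1)])

lemma pure_closed: "x \<in> carrier M \<Longrightarrow> y \<in> carrier N \<Longrightarrow> pure x y \<in> carrier T"
  unfolding pure_eq by (rule mhom_closed[OF coset_mhom e_closed])

lemma pure_bilinear: "bilinear_map R M N T pure"
  unfolding bilinear_map_def
proof (intro conjI ballI mhomI)
  fix x x' y assume xy: "x \<in> carrier M" "x' \<in> carrier M" "y \<in> carrier N"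
  have "pure (x \<oplus>\<^bsub>M\<^esub> x') y = coset_of F K (e (x, y) \<oplus>\<^bsub>F\<^esub> e (x', y))"
    unfolding pure_eq
    by (rule relation_coset)
      (use xy e_closed in \<open>auto simp: tensor_relations_def Let_def simp del: free_module_simps\<close>)
  then show "pure (x \<oplus>\<^bsub>M\<^esub> x') y = pure x y \<oplus>\<^bsub>T\<^esub> pure x' y"
    using xy by (simp add: mhom_add[OF coset_mhom] e_closed pure_eq del: free_module_simps)
next
  fix x y y' assume xy: "x \<in> carrier M" "y \<in> carrier N" "y' \<in> carrier N"
  have "pure x (y \<oplus>\<^bsub>N\<^esub> y') = coset_of F K (e (x, y) \<oplus>\<^bsub>F\<^esub> e (x, y'))"
    unfolding pure_eq
    by (rule relation_coset)
      (use xy e_closed in \<open>auto simp: tensor_relations_def Let_def simp del: free_module_simps\<close>)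
  then show "pure x (y \<oplus>\<^bsub>N\<^esub> y') = pure x y \<oplus>\<^bsub>T\<^esub> pure x y'"
    using xy by (simp add: mhom_add[OF coset_mhom] e_closed pure_eq del: free_module_simps)
next
  fix r x y assume xy: "r \<in> carrier R" "x \<in> carrier M" "y \<in> carrier N"
  have "pure (r \<odot>\<^bsub>M\<^esub> x) y = coset_of F K (r \<odot>\<^bsub>F\<^esub> e (x, y))"
    unfolding pure_eq
    by (rule relation_coset)
      (use xy e_closed in \<open>auto simp: tensor_relations_def Let_def simp del: free_module_simps\<close>)
  then show "pure (r \<odot>\<^bsub>M\<^esub> x) y = r \<odot>\<^bsub>T\<^esub> pure x y"
    using xy by (simp add: mhom_smult[OF coset_mhom] e_closed pure_eq del: free_module_simps)
  have "pure x (r \<odot>\<^bsub>N\<^esub> y) = coset_of F K (r \<odot>\<^bsub>F\<^esub> e (x, y))"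
    unfolding pure_eq
    by (rule relation_coset)
      (use xy e_closed in \<open>auto simp: tensor_relations_def Let_def simp del: free_module_simps\<close>)
  then show "pure x (r \<odot>\<^bsub>N\<^esub> y) = r \<odot>\<^bsub>T\<^esub> pure x y"
    using xy by (simp add: mhom_smult[OF coset_mhom] e_closed pure_eq del: free_module_simps)
qed (auto intro: pure_closed)

lemma pure_left: "y \<in> carrier N \<Longrightarrow> (\<lambda>x. pure x y) \<in> mhom R M T"
  by (rule bilinear_mapD(1)[OF pure_bilinear])

lemma pure_right: "x \<in> carrier M \<Longrightarrow> pure x \<in> mhom R N T"
  by (rule bilinear_mapD(2)[OF pure_bilinear])

text \<open>Scalars cross the tensor sign. If \<open>x\<close> solves the equation with coefficients
  \<open>a\<close>, the right side vanishes; both the flatness test and the cycle constructed for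
  Tor rely on this.\<close>

lemma pure_lsum:
  assumes "z \<in> carrier M" "a \<in> tuples q R" "x \<in> tuples q N"
  shows "(\<Oplus>\<^bsub>T\<^esub>j\<in>{..<q}. pure (a j \<odot>\<^bsub>M\<^esub> z) (x j)) = pure z (lsum N q a x)"
proof -
  interpret T: module R T by (rule tensor_module)
  have ax: "a j \<in> carrier R" "x j \<in> carrier N" if "j \<in> {..<q}" for j
    using assms(2,3) that by auto
  have "(\<Oplus>\<^bsub>T\<^esub>j\<in>{..<q}. pure (a j \<odot>\<^bsub>M\<^esub> z) (x j)) = lsum T q a (\<lambda>j. pure z (x j))"
    unfolding lsum_def
    by (intro T.finsum_cong' refl Pi_I T.smult_closed mhom_smult[OF pure_left] pure_closed ax assms(1))
  also have "\<dots> = pure z (lsum N q a x)"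
    by (rule mhom_lsum[OF N_module tensor_module pure_right[OF assms(1)] assms(2,3), symmetric])
  finally show ?thesis .
qed

text \<open>The preimage of \<open>D\<close> in the free module is a submodule containing the free
  generators, hence is everything.\<close>

lemma tensor_induct:
  assumes "submod R D T" "\<And>x y. x \<in> carrier M \<Longrightarrow> y \<in> carrier N \<Longrightarrow> pure x y \<in> D"
    and "t \<in> carrier T"
  shows "t \<in> D"
proof -
  obtain \<phi> where \<phi>: "\<phi> \<in> carrier F" "t = coset_of F K \<phi>"
    using assms(3) unfolding tensor_module_def quot_module_carrier by blast
  let ?V = "{\<phi> \<in> carrier F. coset_of F K \<phi> \<in> D}"
  have V: "submod R ?V F"
    by (rule submod_vimage[OF F_module tensor_module coset_mhom assms(1)])
  interpret V: LinearCombinations.submodule R ?V F by (rule V)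
  have "free_lift R (carrier M \<times> carrier N) F e \<phi> \<in> ?V"
    unfolding free_lift_def
  proof (rule submod_finsum[OF V], rule Pi_I, rule V.smult_closed)
    fix z assume "z \<in> {z \<in> carrier M \<times> carrier N. \<phi> z \<noteq> \<zero>\<^bsub>R\<^esub>}"
    then have z: "z \<in> carrier M \<times> carrier N" by simp
    then show "\<phi> z \<in> carrier R" using \<phi>(1) by (auto simp: PiE_iff)
    show "e z \<in> ?V" using z assms(2) e_closed by (auto simp: pure_eq simp del: free_module_simps)
  qed
  then show ?thesis
    unfolding free_module_expansion[OF M.is_cring \<phi>(1)] using \<phi>(2) by blast
qed

text \<open>The elements on which the difference of \<open>f\<close> and \<open>g\<close> vanishes
  form a submodule, so \<open>tensor_induct\<close> applies.\<close>

lemma tensor_hom_ext: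
  assumes "module R Q" "f \<in> mhom R T Q" "g \<in> mhom R T Q"
    and "\<And>x y. x \<in> carrier M \<Longrightarrow> y \<in> carrier N \<Longrightarrow> f (pure x y) = g (pure x y)"
    and "t \<in> carrier T"
  shows "f t = g t"
proof -
  interpret Q: module R Q by fact
  have "t \<in> {t \<in> carrier T. f t \<ominus>\<^bsub>Q\<^esub> g t \<in> {\<zero>\<^bsub>Q\<^esub>}}"
  proof (rule tensor_induct[OF submod_vimage[OF tensor_module assms(1) mhom_diff[OF assms(1-3)]
          submod_zero[OF assms(1)]] _ assms(5)])
    fix x y assume xy: "x \<in> carrier M" "y \<in> carrier N"
    then show "pure x y \<in> {t \<in> carrier T. f t \<ominus>\<^bsub>Q\<^esub> g t \<in> {\<zero>\<^bsub>Q\<^esub>}}"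
      using assms(4)[OF xy] pure_closed[OF xy] mhom_closed[OF assms(3) pure_closed[OF xy]]
      by simp
  qed
  then show ?thesis
    using mhom_closed[OF assms(2,5)] mhom_closed[OF assms(3,5)] by simp
qed

lemma tensor_map_to_submod:
  assumes "module R Q" "f \<in> mhom R T Q" "submod R D Q"
    and "\<And>x y. x \<in> carrier M \<Longrightarrow> y \<in> carrier N \<Longrightarrow> f (pure x y) \<in> D"
    and "t \<in> carrier T"
  shows "f t \<in> D"
  using tensor_induct[OF submod_vimage[OF tensor_module assms(1-3)] _ assms(5)] assms(4) pure_closed
  by blast

end

text \<open>The homomorphism induced by a bilinear map, written in the same way as
  \<open>tensor_map\<close>, which becomes a special case in
  \<open>tensor_map_eq_lift\<close>.\<close>

definition tensor_lift ::
    "('r, 'c) ring_scheme \<Rightarrow> ('r, 'm) module \<Rightarrow> ('r, 'n) module \<Rightarrow> ('r, 'q) module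
      \<Rightarrow> ('m \<Rightarrow> 'n \<Rightarrow> 'q) \<Rightarrow> ('m \<times> 'n \<Rightarrow> 'r) set \<Rightarrow> 'q" where
  "tensor_lift R M N Q \<beta> X =
    the_elem (free_lift R (carrier M \<times> carrier N) Q (\<lambda>(x, y). \<beta> x y) ` X)"

context tensor_product
begin

context
  fixes Q :: "('r, 'q) module" and \<beta> :: "'m \<Rightarrow> 'n \<Rightarrow> 'q"
  assumes Q: "module R Q" and \<beta>: "bilinear_map R M N Q \<beta>"
begin

interpretation M: module R M by (rule M_module)
interpretation N: module R N by (rule N_module)
interpretation F: module R F by (rule F_module)
interpretation Q: module R Q by (rule Q)

private abbreviation (input) L where
  "L \<equiv> free_lift R (carrier M \<times> carrier N) Q (\<lambda>(x, y). \<beta> x y)"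

private lemma \<beta>_closed: "x \<in> carrier M \<Longrightarrow> y \<in> carrier N \<Longrightarrow> \<beta> x y \<in> carrier Q"
  using bilinear_mapD(2)[OF \<beta>] by (auto intro: mhom_closed)

private lemma L_mhom: "L \<in> mhom R F Q"
  using \<beta>_closed by (intro free_lift_mhom[OF Q]) auto

private lemma L_gen: "x \<in> carrier M \<Longrightarrow> y \<in> carrier N \<Longrightarrow> L (e (x, y)) = \<beta> x y"
  using \<beta>_closed by (subst free_lift_gen[OF Q]) auto

private lemma L_relation:
  assumes "f \<in> carrier F" "g \<in> carrier F" "L f = L g"
  shows "f \<ominus>\<^bsub>F\<^esub> g \<in> a_kernel F Q L"
  unfolding a_kernel_def' mem_Collect_eq mhom_minus[OF F_module Q L_mhom assms(1,2)]
  using assms mhom_closed[OF L_mhom assms(2)] F.M.minus_closed by (simp del: free_module_simps)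

text \<open>Each generator of \<open>K\<close> is a difference of two elements on which
  \<open>L\<close> agrees, by bilinearity of \<open>\<beta>\<close>. Hence \<open>L\<close> is
  constant on cosets, which justifies \<open>the_elem\<close> in \<open>tensor_lift\<close>.\<close>

private lemma L_kernel: "K \<subseteq> a_kernel F Q L"
proof -
  have "tensor_relations R M N \<subseteq> a_kernel F Q L"
    unfolding tensor_relations_def Let_def
    by (auto intro!: L_relation e_closed F.M.a_closed F.smult_closed M.smult_closed N.smult_closed
        simp: L_gen e_closed mhom_add[OF L_mhom] mhom_smult[OF L_mhom]
          mhom_add[OF bilinear_mapD(1)[OF \<beta>]] mhom_add[OF bilinear_mapD(2)[OF \<beta>]]
          mhom_smult[OF bilinear_mapD(1)[OF \<beta>]] mhom_smult[OF bilinear_mapD(2)[OF \<beta>]]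
        simp del: free_module_simps)
  then show ?thesis
    unfolding tensor_kernel_def by (rule span_le[OF submod_kernel[OF F_module Q L_mhom]])
qed

private lemma lift_coset:
  assumes "\<phi> \<in> carrier F"
  shows "tensor_lift R M N Q \<beta> (coset_of F K \<phi>) = L \<phi>"
proof -
  interpret K: abelian_subgroup K F by (rule submod_abelian_subgroup[OF kernel_submod])
  have "L \<psi> = L \<phi>" if \<psi>: "\<psi> \<in> coset_of F K \<phi>" for \<psi>
  proof -
    have \<psi>': "\<psi> \<in> carrier F"
      using \<psi> assms K.a_elemrcos_carrier unfolding coset_of_def by blast
    have "\<psi> \<oplus>\<^bsub>F\<^esub> \<ominus>\<^bsub>F\<^esub> \<phi> \<in> K"
      using \<psi> K.a_rcos_module[OF assms \<psi>'] by (simp add: coset_of_def)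
    then have "L (\<psi> \<ominus>\<^bsub>F\<^esub> \<phi>) = \<zero>\<^bsub>Q\<^esub>"
      using L_kernel unfolding a_minus_def by (auto simp: a_kernel_def' simp del: free_module_simps)
    then show ?thesis
      using mhom_closed[OF L_mhom \<psi>'] mhom_closed[OF L_mhom assms]
      by (simp add: mhom_minus[OF F_module Q L_mhom \<psi>' assms] del: free_module_simps)
  qed
  moreover have "\<phi> \<in> coset_of F K \<phi>"
    unfolding coset_of_def by (rule K.a_rcos_self[OF assms])
  ultimately have "L ` coset_of F K \<phi> = {L \<phi>}" by blast
  then show ?thesis by (simp add: tensor_lift_def)
qed

lemma tensor_lift_mhom: "tensor_lift R M N Q \<beta> \<in> mhom R T Q"
proof (rule mhomI)
  fix X assume "X \<in> carrier T"
  then obtain \<phi> where "\<phi> \<in> carrier F" "X = coset_of F K \<phi>"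
    unfolding tensor_module_def quot_module_carrier by blast
  then show "tensor_lift R M N Q \<beta> X \<in> carrier Q"
    using lift_coset mhom_closed[OF L_mhom] by simp
next
  fix X Y assume "X \<in> carrier T" "Y \<in> carrier T"
  then obtain \<phi> \<psi> where \<phi>: "\<phi> \<in> carrier F" "X = coset_of F K \<phi>"
      and \<psi>: "\<psi> \<in> carrier F" "Y = coset_of F K \<psi>"
    unfolding tensor_module_def quot_module_carrier by blast
  show "tensor_lift R M N Q \<beta> (X \<oplus>\<^bsub>T\<^esub> Y) = tensor_lift R M N Q \<beta> X \<oplus>\<^bsub>Q\<^esub> tensor_lift R M N Q \<beta> Y"
    unfolding \<phi>(2) \<psi>(2) mhom_add[OF coset_mhom \<phi>(1) \<psi>(1), symmetric]
      lift_coset[OF \<phi>(1)] lift_coset[OF \<psi>(1)] lift_coset[OF F.M.a_closed[OF \<phi>(1) \<psi>(1)]]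
    by (rule mhom_add[OF L_mhom \<phi>(1) \<psi>(1)])
next
  fix r X assume r: "r \<in> carrier R" and "X \<in> carrier T"
  then obtain \<phi> where \<phi>: "\<phi> \<in> carrier F" "X = coset_of F K \<phi>"
    unfolding tensor_module_def quot_module_carrier by blast
  show "tensor_lift R M N Q \<beta> (r \<odot>\<^bsub>T\<^esub> X) = r \<odot>\<^bsub>Q\<^esub> tensor_lift R M N Q \<beta> X"
    unfolding \<phi>(2) mhom_smult[OF coset_mhom r \<phi>(1), symmetric]
      lift_coset[OF \<phi>(1)] lift_coset[OF F.smult_closed[OF r \<phi>(1)]]
    by (rule mhom_smult[OF L_mhom r \<phi>(1)])
qed

lemma tensor_lift_pure:
  "x \<in> carrier M \<Longrightarrow> y \<in> carrier N \<Longrightarrow> tensor_lift R M N Q \<beta> (pure x y) = \<beta> x y"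
  unfolding pure_eq using lift_coset[OF e_closed] L_gen by simp

end

end

lemma tensor_map_eq_lift:
  "tensor_map R M M' N f = tensor_lift R M N (tensor_module R M' N) (\<lambda>x. pure_tensor R M' N (f x))"
  by (intro ext) (simp add: tensor_map_def tensor_lift_def)

lemma tensor_map_mhom:
  assumes "module R M" "module R M'" "module R N" "f \<in> mhom R M M'"
  shows "tensor_map R M M' N f \<in> mhom R (tensor_module R M N) (tensor_module R M' N)"
    and "x \<in> carrier M \<Longrightarrow> y \<in> carrier N \<Longrightarrow>
      tensor_map R M M' N f (pure_tensor R M N x y) = pure_tensor R M' N (f x) y"
proof -
  interpret A: tensor_product R M N by (intro tensor_product.intro assms)
  interpret B: tensor_product R M' N by (intro tensor_product.intro assms)
  note bl = bilinear_map_comp[OF B.pure_bilinear assms(4)]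
  show "tensor_map R M M' N f \<in> mhom R (tensor_module R M N) (tensor_module R M' N)"
    unfolding tensor_map_eq_lift by (rule A.tensor_lift_mhom[OF B.tensor_module bl])
  show "tensor_map R M M' N f (pure_tensor R M N x y) = pure_tensor R M' N (f x) y"
    if "x \<in> carrier M" "y \<in> carrier N"
    unfolding tensor_map_eq_lift by (rule A.tensor_lift_pure[OF B.tensor_module bl that])
qed

lemma tensor_map_sum:
  assumes "module R M" "module R M'" "module R N" "f \<in> mhom R M M'"
    and "z \<in> tuples q M" "x \<in> tuples q N"
  shows "tensor_map R M M' N f (\<Oplus>\<^bsub>tensor_module R M N\<^esub>j\<in>{..<q}. pure_tensor R M N (z j) (x j))
    = (\<Oplus>\<^bsub>tensor_module R M' N\<^esub>j\<in>{..<q}. pure_tensor R M' N (f (z j)) (x j))"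
proof -
  interpret A: tensor_product R M N by (intro tensor_product.intro assms)
  interpret B: tensor_product R M' N by (intro tensor_product.intro assms)
  interpret T: module R B.T by (rule B.tensor_module)
  note tm = tensor_map_mhom[OF assms(1-4)]
  have zx: "z j \<in> carrier M" "x j \<in> carrier N" if "j \<in> {..<q}" for j
    using assms(5,6) that by auto
  have "tensor_map R M M' N f (\<Oplus>\<^bsub>A.T\<^esub>j\<in>{..<q}. A.pure (z j) (x j))
      = (\<Oplus>\<^bsub>B.T\<^esub>j\<in>{..<q}. tensor_map R M M' N f (A.pure (z j) (x j)))"
    by (intro mhom_finsum[OF A.tensor_module B.tensor_module tm(1)] Pi_I A.pure_closed zx)
  also have "\<dots> = (\<Oplus>\<^bsub>B.T\<^esub>j\<in>{..<q}. B.pure (f (z j)) (x j))"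
    by (intro T.finsum_cong' refl Pi_I tm(2) B.pure_closed mhom_closed[OF assms(4)] zx)
  finally show ?thesis .
qed

section \<open>Vanishing of tensors and annihilation of Tor\<close>

lemma lincomb_lsum:
  assumes "module R M" "bij_betw h {..<m} B" "B \<subseteq> carrier M" "a \<in> B \<rightarrow> carrier R"
  shows "module.lincomb M a B = lsum M m (\<lambda>i. a (h i)) h"
proof -
  interpret M: module R M by fact
  have im: "h ` {..<m} = B" and inj: "inj_on h {..<m}"
    using assms(2) by (auto simp: bij_betw_def)
  have "(\<Oplus>\<^bsub>M\<^esub>v\<in>h ` {..<m}. a v \<odot>\<^bsub>M\<^esub> v) = lsum M m (\<lambda>i. a (h i)) h"
    unfolding lsum_def using assms(3,4) inj by (intro M.finsum_reindex) (auto simp: im)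
  then show ?thesis by (simp add: M.lincomb_def im)
qed

lemma span_lsum:
  assumes "module R M" "G \<subseteq> carrier M" "x \<in> module.span R M G"
  obtains n c g where "c \<in> tuples n R" "g \<in> {..<n} \<rightarrow> G" "x = lsum M n c g"
proof -
  interpret M: module R M by fact
  obtain a A where A: "finite A" "A \<subseteq> G" "a \<in> A \<rightarrow> carrier R" "x = M.lincomb a A"
    using assms(3) unfolding M.span_def by auto
  obtain h where h: "bij_betw h {..<card A} A"
    using ex_bij_betw_nat_finite[OF A(1)] by (auto simp: atLeast0LessThan)
  have AM: "A \<subseteq> carrier M" using A(2) assms(2) by blast
  have hA: "h j \<in> A" if "j < card A" for j using h that by (auto simp: bij_betw_def)
  have "x = lsum M (card A) (\<lambda>j. a (h j)) h"
    unfolding A(4) by (rule lincomb_lsum[OF assms(1) h AM A(3)])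
  then show ?thesis
    using A(2,3) hA by (intro that[of "\<lambda>j. a (h j)" "card A" h]) auto
qed

text \<open>Factorization through a surjection, expressed by a choice of preimages: as
  \<open>h\<close> kills the kernel of \<open>f\<close>, the value \<open>h (c x)\<close> does not
  depend on the preimage chosen, and so it is linear in \<open>x\<close> although \<open>c\<close>
  need not be.\<close>

lemma mhom_factor:
  assumes "module R P" "module R M" "module R Q" "f \<in> mhom R P M" "h \<in> mhom R P Q"
    and "\<And>z. z \<in> carrier P \<Longrightarrow> f z = \<zero>\<^bsub>M\<^esub> \<Longrightarrow> h z = \<zero>\<^bsub>Q\<^esub>"
    and "\<And>x. x \<in> carrier M \<Longrightarrow> c x \<in> carrier P \<and> f (c x) = x"
  shows "(\<lambda>x. h (c x)) \<in> mhom R M Q"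
    and "z \<in> carrier P \<Longrightarrow> h (c (f z)) = h z"
proof -
  interpret P: module R P by fact
  interpret M: module R M by fact
  interpret Q: module R Q by fact
  have eq: "h z = h z'" if "z \<in> carrier P" "z' \<in> carrier P" "f z = f z'" for z z'
  proof -
    have "f (z \<ominus>\<^bsub>P\<^esub> z') = \<zero>\<^bsub>M\<^esub>"
      using that mhom_closed[OF assms(4)] by (simp add: mhom_minus[OF assms(1,2,4)])
    then have "h (z \<ominus>\<^bsub>P\<^esub> z') = \<zero>\<^bsub>Q\<^esub>"
      using that by (intro assms(6) P.M.minus_closed)
    then show ?thesis
      using that mhom_closed[OF assms(5)] by (simp add: mhom_minus[OF assms(1,3,5)])
  qed
  note c = conjunct1[OF assms(7)] conjunct2[OF assms(7)]
  show "h (c (f z)) = h z" if "z \<in> carrier P" for z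
    using that c mhom_closed[OF assms(4)] by (intro eq) auto
  show "(\<lambda>x. h (c x)) \<in> mhom R M Q"
  proof (rule mhomI)
    fix x y assume xy: "x \<in> carrier M" "y \<in> carrier M"
    have "h (c (x \<oplus>\<^bsub>M\<^esub> y)) = h (c x \<oplus>\<^bsub>P\<^esub> c y)"
      using xy c by (intro eq) (simp_all add: mhom_add[OF assms(4)])
    then show "h (c (x \<oplus>\<^bsub>M\<^esub> y)) = h (c x) \<oplus>\<^bsub>Q\<^esub> h (c y)"
      using xy c by (simp add: mhom_add[OF assms(5)])
  next
    fix r x assume rx: "r \<in> carrier R" "x \<in> carrier M"
    have "h (c (r \<odot>\<^bsub>M\<^esub> x)) = h (r \<odot>\<^bsub>P\<^esub> c x)"
      using rx c by (intro eq) (simp_all add: mhom_smult[OF assms(4)])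
    then show "h (c (r \<odot>\<^bsub>M\<^esub> x)) = r \<odot>\<^bsub>Q\<^esub> h (c x)"
      using rx c by (simp add: mhom_smult[OF assms(5)])
  qed (use c mhom_closed[OF assms(5)] in simp)
qed

section \<open>Powers of a module and the standard basis\<close>

abbreviation power_module :: "nat \<Rightarrow> ('r, 'm) module \<Rightarrow> ('r, nat \<Rightarrow> 'm) module" where
  "power_module q N \<equiv> direct_product {..<q} (\<lambda>_. N)"

lemma power_module: "module R N \<Longrightarrow> module R (power_module q N)"
  by (rule direct_product_module) (auto simp: module_def)

lemma lsum_coeff_mhom:
  assumes "module R M" "a \<in> tuples q M"
  shows "(\<lambda>c. lsum M q c a) \<in> mhom R (power_module q (regular_module R)) M"
  unfolding lsum_def
proof (rule mhom_sum[OF assms(1)])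
  fix j assume j: "j \<in> {..<q}"
  then have "a j \<in> carrier M" using assms(2) by auto
  with mhom_comp[OF proj_mhom[OF j] bilinear_mapD(1)[OF bilinear_map_smult[OF assms(1)]]]
  show "(\<lambda>c. c j \<odot>\<^bsub>M\<^esub> a j) \<in> mhom R (power_module q (regular_module R)) M" .
qed

text \<open>On a finite index set the support condition of a free module is void, so
  \<open>free_gen R {..<q}\<close> gives the standard basis of the power of
  \<open>R\<close>.\<close>

lemma lsum_unit:
  assumes "module R M" "x \<in> tuples q M" "j < q"
  shows "free_gen R {..<q} j \<in> carrier (power_module q (regular_module R))"
    and "lsum M q (free_gen R {..<q} j) x = x j"
proof -
  show g: "free_gen R {..<q} j \<in> carrier (power_module q (regular_module R))"
    using free_gen_closed[of R j "{..<q}"] assms(1,3) by (simp add: module_def)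
  have "lsum M q (free_gen R {..<q} j) x = lsum M q (\<lambda>i. if i = j then \<one>\<^bsub>R\<^esub> else \<zero>\<^bsub>R\<^esub>) x"
    by (rule lsum_cong[OF assms(1) _ assms(2)]) (use g in \<open>auto simp: free_gen_def\<close>)
  also have "\<dots> = x j" by (rule lsum_delta[OF assms])
  finally show "lsum M q (free_gen R {..<q} j) x = x j" .
qed

lemma lsum_image_unit:
  assumes "module R M" "x \<in> tuples q M" "j < q"
  shows "x j \<in> (\<lambda>c. lsum M q c x) ` carrier (power_module q (regular_module R))"
  using lsum_unit(2)[OF assms, symmetric] lsum_unit(1)[OF assms] by (rule image_eqI)

text \<open>This is the map behind the identification of R^q tensor N with N^q, on which
  \<open>tensor_vanish\<close> is modelled.\<close>

lemma scale_bilinear: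
  assumes "module R N"
  shows "bilinear_map R (power_module q (regular_module R)) N (power_module q N)
    (\<lambda>c y. \<lambda>j\<in>{..<q}. c j \<odot>\<^bsub>N\<^esub> y)"
  unfolding bilinear_map_def
proof (intro conjI ballI tuple_mhom)
  fix y j assume y: "y \<in> carrier N" and j: "j \<in> {..<q}"
  show "(\<lambda>c. c j \<odot>\<^bsub>N\<^esub> y) \<in> mhom R (power_module q (regular_module R)) N"
    by (rule mhom_comp[OF proj_mhom[OF j] bilinear_mapD(1)[OF bilinear_map_smult[OF assms] y]])
next
  fix c j assume "c \<in> carrier (power_module q (regular_module R))" "j \<in> {..<q}"
  then have "c j \<in> carrier (regular_module R)" by (auto simp: PiE_iff)
  from bilinear_mapD(2)[OF bilinear_map_smult[OF assms] this]
  show "(\<lambda>y. c j \<odot>\<^bsub>N\<^esub> y) \<in> mhom R N N" .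
qed

lemma lsum_zero_coeff:
  assumes "module R M" "x \<in> tuples n M" "\<And>j. j < n \<Longrightarrow> c j = \<zero>\<^bsub>R\<^esub>"
  shows "lsum M n c x = \<zero>\<^bsub>M\<^esub>"
proof -
  interpret M: module R M by fact
  have "lsum M n c x = (\<Oplus>\<^bsub>M\<^esub>j\<in>{..<n}. \<zero>\<^bsub>M\<^esub>)"
    unfolding lsum_def using assms(2,3) by (intro M.finsum_cong') (auto simp: Pi_iff)
  then show ?thesis by simp
qed

text \<open>The map \<open>(z, y) \<mapsto> (c\<^sub>1 y, \<dots>, c\<^sub>q y)\<close>, where
  \<open>z = c\<^sub>1 a\<^sub>1 + \<dots> + c\<^sub>q a\<^sub>q\<close>, is well defined modulo the submodule of \<open>N\<^sup>q\<close> generated by the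
  vectors \<open>l y\<close>, where \<open>l\<close> is a relation between the \<open>a\<^sub>j\<close>, and it is bilinear.\<close>

lemma tensor_vanish:
  assumes M: "module R M" and N: "module R N"
    and a: "a \<in> tuples q M" and x: "x \<in> tuples q N"
    and gen: "\<And>z. z \<in> carrier M \<Longrightarrow> \<exists>c\<in>tuples q R. z = lsum M q c a"
    and zero: "(\<Oplus>\<^bsub>tensor_module R M N\<^esub>j\<in>{..<q}. pure_tensor R M N (a j) (x j))
      = \<zero>\<^bsub>tensor_module R M N\<^esub>"
  obtains n l y where "\<forall>v<n. l v \<in> tuples q R \<and> lsum M q (l v) a = \<zero>\<^bsub>M\<^esub>"
    and "y \<in> tuples n N" and "\<forall>j<q. x j = lsum N n (\<lambda>v. l v j) y"
proof -
  interpret M: module R M by (rule M)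
  interpret N: module R N by (rule N)
  interpret tensor_product R M N by (intro tensor_product.intro M N)
  have R: "cring R" by (rule M.is_cring)
  let ?Rq = "power_module q (regular_module R)"
  let ?Nq = "power_module q N"
  let ?\<tau> = "\<lambda>c y. \<lambda>j\<in>{..<q}. c j \<odot>\<^bsub>N\<^esub> y"
  let ?\<l> = "\<lambda>c. lsum M q c a"
  have Rq: "module R ?Rq" by (intro power_module regular_module R)
  have Nq: "module R ?Nq" by (intro power_module N)
  have \<l>: "?\<l> \<in> mhom R ?Rq M" by (rule lsum_coeff_mhom[OF M a])
  note \<tau> = scale_bilinear[OF N, of q]
  define G where "G = {?\<tau> l y | l y. l \<in> carrier ?Rq \<and> ?\<l> l = \<zero>\<^bsub>M\<^esub> \<and> y \<in> carrier N}"
  have \<tau>_closed: "?\<tau> l y \<in> carrier ?Nq" if "l \<in> carrier ?Rq" "y \<in> carrier N" for l y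
    by (rule mhom_closed[OF bilinear_mapD(2)[OF \<tau> that(1)] that(2)])
  have G: "G \<subseteq> carrier ?Nq"
    using \<tau>_closed unfolding G_def by blast
  define W where "W = module.span R ?Nq G"
  have W: "submod R W ?Nq" unfolding W_def by (rule span_submod[OF Nq G])
  let ?Q = "quot_module ?Nq W"
  have Q: "module R ?Q" by (rule quot_module[OF W])
  interpret Q: module R ?Q by (rule Q)
  interpret Nq: module R ?Nq by (rule Nq)
  have co: "coset_of ?Nq W \<in> mhom R ?Nq ?Q" by (rule coset_of_mhom[OF W])
  define h where "h y c = coset_of ?Nq W (?\<tau> c y)" for y c
  have h: "bilinear_map R ?Rq N ?Q (\<lambda>c y. h y c)"
    unfolding h_def by (rule bilinear_map_comp2[OF \<tau> co])
  have h_kernel: "h y l = \<zero>\<^bsub>?Q\<^esub>" if "y \<in> carrier N" "l \<in> carrier ?Rq" "?\<l> l = \<zero>\<^bsub>M\<^esub>" for y l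
  proof -
    have "?\<tau> l y \<in> G" using that unfolding G_def by blast
    then have "?\<tau> l y \<in> W" unfolding W_def by (rule span_gen[OF Nq G])
    then show ?thesis
      unfolding h_def using coset_of_zero_iff[OF W \<tau>_closed[OF that(2,1)]] by blast
  qed
  have "\<forall>z\<in>carrier M. \<exists>c. c \<in> carrier ?Rq \<and> ?\<l> c = z"
  proof
    fix z assume z: "z \<in> carrier M"
    obtain c where c: "c \<in> tuples q R" "z = lsum M q c a" using gen[OF z] by auto
    then have "lsum M q (restrict c {..<q}) a = z" by (simp only: lsum_restrict[OF M c(1) a])
    then show "\<exists>c. c \<in> carrier ?Rq \<and> ?\<l> c = z"
      using c(1) by (intro exI[of _ "restrict c {..<q}"]) auto
  qed
  from bchoice[OF this] obtain c where "\<forall>z\<in>carrier M. c z \<in> carrier ?Rq \<and> ?\<l> (c z) = z" ..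
  then have c: "c z \<in> carrier ?Rq \<and> ?\<l> (c z) = z" if "z \<in> carrier M" for z
    using that by (rule bspec)
  have \<beta>1: "(\<lambda>z. h y (c z)) \<in> mhom R M ?Q" if y: "y \<in> carrier N" for y
    by (rule mhom_factor(1)[OF Rq M Q \<l> bilinear_mapD(1)[OF h y] h_kernel[OF y] c])
  have \<beta>: "bilinear_map R M N ?Q (\<lambda>z y. h y (c z))"
    unfolding bilinear_map_def using \<beta>1 bilinear_mapD(2)[OF h] conjunct1[OF c] by blast
  let ?g = "free_gen R {..<q}"
  note g = lsum_unit(1)[OF M a] and \<l>_g = lsum_unit(2)[OF M a]
  have x': "x j \<in> carrier N" if "j < q" for j using x that by auto
  \<comment> \<open>Under the identification with N^q, the sum of the tensors of \<open>?g j\<close>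
    and \<open>x j\<close> is the vector \<open>x\<close> itself.\<close>
  have sum_x: "(\<Oplus>\<^bsub>?Nq\<^esub>j\<in>{..<q}. ?\<tau> (?g j) (x j)) = restrict x {..<q}"
  proof (rule PiE_ext[of _ "{..<q}" "\<lambda>_. carrier N"])
    have cl: "(\<lambda>j. ?\<tau> (?g j) (x j)) \<in> tuples q ?Nq"
      using \<tau>_closed[OF g x'] by auto
    show "(\<Oplus>\<^bsub>?Nq\<^esub>j\<in>{..<q}. ?\<tau> (?g j) (x j)) \<in> {..<q} \<rightarrow>\<^sub>E carrier N"
      using Nq.finsum_closed[OF cl] by simp
    fix i assume i: "i \<in> {..<q}"
    have "(\<Oplus>\<^bsub>?Nq\<^esub>j\<in>{..<q}. ?\<tau> (?g j) (x j)) i = (\<Oplus>\<^bsub>N\<^esub>j\<in>{..<q}. ?\<tau> (?g j) (x j) i)"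
      by (rule mhom_finsum[OF Nq N proj_mhom[OF i] cl])
    also have "\<dots> = (\<Oplus>\<^bsub>N\<^esub>j\<in>{..<q}. if i = j then x j else \<zero>\<^bsub>N\<^esub>)"
      using i x' by (intro N.finsum_cong') (auto simp: free_gen_def)
    also have "\<dots> = x i"
      using i x by (intro N.finsum_singleton) auto
    finally show "(\<Oplus>\<^bsub>?Nq\<^esub>j\<in>{..<q}. ?\<tau> (?g j) (x j)) i = restrict x {..<q} i"
      using i by simp
  qed (use x in auto)
  \<comment> \<open>The lift sends the given tensor, which is zero, to the class of the vector
    \<open>x\<close> modulo \<open>W\<close>.\<close>
  have "restrict x {..<q} \<in> W"
  proof -
    let ?L = "tensor_lift R M N ?Q (\<lambda>z y. h y (c z))"
    have L: "?L \<in> mhom R T ?Q" by (rule tensor_lift_mhom[OF Q \<beta>])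
    have a': "a j \<in> carrier M" if "j < q" for j using a that by auto
    have "\<zero>\<^bsub>?Q\<^esub> = ?L (\<Oplus>\<^bsub>T\<^esub>j\<in>{..<q}. pure (a j) (x j))"
      unfolding zero by (rule mhom_zero[OF tensor_module Q L, symmetric])
    also have "\<dots> = (\<Oplus>\<^bsub>?Q\<^esub>j\<in>{..<q}. ?L (pure (a j) (x j)))"
      using a' x' by (intro mhom_finsum[OF tensor_module Q L] Pi_I pure_closed) auto
    also have "\<dots> = (\<Oplus>\<^bsub>?Q\<^esub>j\<in>{..<q}. coset_of ?Nq W (?\<tau> (?g j) (x j)))"
    proof (rule Q.finsum_cong'[OF refl], rule Pi_I)
      fix j assume "j \<in> {..<q}"
      then have j: "j < q" by simp
      show "coset_of ?Nq W (?\<tau> (?g j) (x j)) \<in> carrier ?Q"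
        by (rule mhom_closed[OF co \<tau>_closed[OF g[OF j] x'[OF j]]])
      have "?L (pure (a j) (x j)) = h (x j) (c (a j))"
        by (rule tensor_lift_pure[OF Q \<beta> a'[OF j] x'[OF j]])
      \<comment> \<open>\<open>c (a j)\<close> need not be the basis vector \<open>?g j\<close>, but
        both represent \<open>a j\<close>, and \<open>h\<close> does not distinguish them.\<close>
      also have "\<dots> = h (x j) (c (?\<l> (?g j)))" by (simp add: \<l>_g[OF j])
      also have "\<dots> = h (x j) (?g j)"
        by (rule mhom_factor(2)[OF Rq M Q \<l> bilinear_mapD(1)[OF h x'[OF j]] h_kernel[OF x'[OF j]]
              c g[OF j]])
      finally show "?L (pure (a j) (x j)) = coset_of ?Nq W (?\<tau> (?g j) (x j))"
        by (simp only: h_def)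
    qed
    also have "\<dots> = coset_of ?Nq W (\<Oplus>\<^bsub>?Nq\<^esub>j\<in>{..<q}. ?\<tau> (?g j) (x j))"
      using \<tau>_closed[OF g x'] by (intro mhom_finsum[OF Nq Q co, symmetric] Pi_I) simp
    finally have "coset_of ?Nq W (restrict x {..<q}) = \<zero>\<^bsub>?Q\<^esub>"
      by (simp only: sum_x)
    then show ?thesis
      using x by (subst (asm) coset_of_zero_iff[OF W]) auto
  qed
  then obtain n d f where d: "d \<in> tuples n R" and f: "f \<in> {..<n} \<rightarrow> G"
      and xf: "restrict x {..<q} = lsum ?Nq n d f"
    unfolding W_def by (rule span_lsum[OF Nq G])
  have "\<forall>v\<in>{..<n}. \<exists>l y. f v = ?\<tau> l y \<and> l \<in> carrier ?Rq \<and> ?\<l> l = \<zero>\<^bsub>M\<^esub> \<and> y \<in> carrier N"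
    using f unfolding G_def by blast
  then obtain l y where ly: "f v = ?\<tau> (l v) (y v)" "l v \<in> carrier ?Rq" "?\<l> (l v) = \<zero>\<^bsub>M\<^esub>"
      "y v \<in> carrier N" if "v < n" for v
    unfolding Ball_def lessThan_iff by metis
  have l: "l v j \<in> carrier R" if "v < n" "j < q" for v j
    using ly(2)[OF that(1)] that(2) by (auto simp: PiE_iff)
  have d': "d v \<in> carrier R" if "v < n" for v using d that by auto
  \<comment> \<open>The coefficient \<open>d v\<close> is absorbed into the element of
    \<open>N\<close>, so that \<open>l v\<close> remains the relation it was.\<close>
  have xj: "x j = lsum N n (\<lambda>v. l v j) (\<lambda>v. d v \<odot>\<^bsub>N\<^esub> y v)" if j: "j < q" for j
  proof -
    have "x j = lsum ?Nq n d f j" using xf[symmetric] j by simp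
    also have "\<dots> = lsum N n d (\<lambda>v. f v j)"
      using j f G N by (intro lsum_direct_product[OF R _ _ d]) auto
    also have "\<dots> = (\<Oplus>\<^bsub>N\<^esub>v\<in>{..<n}. l v j \<odot>\<^bsub>N\<^esub> (d v \<odot>\<^bsub>N\<^esub> y v))"
      unfolding lsum_def
    proof (rule N.finsum_cong'[OF refl], rule Pi_I)
      fix v assume "v \<in> {..<n}"
      then have v: "v < n" by simp
      show "l v j \<odot>\<^bsub>N\<^esub> (d v \<odot>\<^bsub>N\<^esub> y v) \<in> carrier N"
        by (intro N.smult_closed l d' ly v j)
      show "d v \<odot>\<^bsub>N\<^esub> f v j = l v j \<odot>\<^bsub>N\<^esub> (d v \<odot>\<^bsub>N\<^esub> y v)"
        using j l[OF v j] d'[OF v] ly(4)[OF v]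
        by (simp add: ly(1)[OF v] N.smult_assoc1[symmetric] M.R.m_comm)
    qed
    finally show ?thesis by (simp add: lsum_def)
  qed
  show ?thesis
    by (rule that[of n l "\<lambda>v. d v \<odot>\<^bsub>N\<^esub> y v"]) (use xj l ly(3,4) d' in auto)
qed

text \<open>The abbreviations repeat the local bindings of \<open>Tor1\<close>, so that unfolding it
  gives literally the quotient of the cycles by \<open>boundaries\<close>.\<close>

locale tor_resolution =
  fixes R :: "('r, 'c) ring_scheme" and M :: "('r, 'm) module" and N :: "('r, 'n) module"
  assumes M_module: "module R M" and N_module: "module R N"
begin

abbreviation P0 where "P0 \<equiv> free_module R (carrier M)"
abbreviation d0 where "d0 \<equiv> free_lift R (carrier M) M (\<lambda>x. x)"
abbreviation Z0 where "Z0 \<equiv> a_kernel P0 M d0"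
abbreviation P1 where "P1 \<equiv> free_module R Z0"
abbreviation d1 where "d1 \<equiv> free_lift R Z0 P0 (\<lambda>x. x)"
abbreviation Z1 where "Z1 \<equiv> a_kernel P1 P0 d1"
abbreviation P2 where "P2 \<equiv> free_module R Z1"
abbreviation d2 where "d2 \<equiv> free_lift R Z1 P1 (\<lambda>x. x)"
abbreviation C0 where "C0 \<equiv> tensor_module R P0 N"
abbreviation C1 where "C1 \<equiv> tensor_module R P1 N"
abbreviation C2 where "C2 \<equiv> tensor_module R P2 N"
abbreviation \<delta>1 where "\<delta>1 \<equiv> tensor_map R P1 P0 N d1"
abbreviation \<delta>2 where "\<delta>2 \<equiv> tensor_map R P2 P1 N d2"
abbreviation e0 where "e0 \<equiv> free_gen R (carrier M)"
abbreviation e1 where "e1 \<equiv> free_gen R Z0"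
abbreviation e2 where "e2 \<equiv> free_gen R Z1"
abbreviation boundaries where "boundaries \<equiv> \<delta>2 ` carrier C2"

lemma R_cring: "cring R"
  by (rule module.axioms(1)[OF M_module])

lemma P0_module: "module R P0" by (rule free_module[OF R_cring])
lemma P1_module: "module R P1" by (rule free_module[OF R_cring])
lemma P2_module: "module R P2" by (rule free_module[OF R_cring])

lemma d0_mhom: "d0 \<in> mhom R P0 M"
  by (rule free_lift_mhom[OF M_module]) auto

lemma d1_mhom: "d1 \<in> mhom R P1 P0"
  by (rule free_lift_mhom[OF P0_module]) (auto simp: a_kernel_def')

lemma d2_mhom: "d2 \<in> mhom R P2 P1"
  by (rule free_lift_mhom[OF P1_module]) (auto simp: a_kernel_def')

lemma d0_gen: "x \<in> carrier M \<Longrightarrow> d0 (e0 x) = x"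
  by (rule free_lift_gen[OF M_module])

lemma d1_gen: "z \<in> Z0 \<Longrightarrow> d1 (e1 z) = z"
  by (rule free_lift_gen[OF P0_module]) (auto simp: a_kernel_def')

lemma d2_gen: "w \<in> Z1 \<Longrightarrow> d2 (e2 w) = w"
  by (rule free_lift_gen[OF P1_module]) (auto simp: a_kernel_def')

lemma d1_d2: "w \<in> carrier P2 \<Longrightarrow> d1 (d2 w) = \<zero>\<^bsub>P0\<^esub>"
proof (rule free_module_hom_ext[OF P0_module mhom_comp[OF d2_mhom d1_mhom]
      mhom_const_zero[OF P0_module]])
  fix w assume w: "w \<in> Z1"
  then show "d1 (d2 (e2 w)) = \<zero>\<^bsub>P0\<^esub>"
    unfolding d2_gen[OF w] by (simp add: a_kernel_def' del: free_module_simps)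
qed

sublocale T0: tensor_product R P0 N
  by (intro tensor_product.intro P0_module N_module)

sublocale T1: tensor_product R P1 N
  by (intro tensor_product.intro P1_module N_module)

sublocale T2: tensor_product R P2 N
  by (intro tensor_product.intro P2_module N_module)

lemma \<delta>1_mhom: "\<delta>1 \<in> mhom R C1 C0"
  by (rule tensor_map_mhom(1)[OF P1_module P0_module N_module d1_mhom])

lemma \<delta>2_mhom: "\<delta>2 \<in> mhom R C2 C1"
  by (rule tensor_map_mhom(1)[OF P2_module P1_module N_module d2_mhom])

lemma \<delta>1_pure: "w \<in> carrier P1 \<Longrightarrow> y \<in> carrier N \<Longrightarrow> \<delta>1 (T1.pure w y) = T0.pure (d1 w) y"
  by (rule tensor_map_mhom(2)[OF P1_module P0_module N_module d1_mhom])

lemma \<delta>2_pure: "w \<in> carrier P2 \<Longrightarrow> y \<in> carrier N \<Longrightarrow> \<delta>2 (T2.pure w y) = T1.pure (d2 w) y"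
  by (rule tensor_map_mhom(2)[OF P2_module P1_module N_module d2_mhom])

lemma boundaries_submod: "submod R boundaries C1"
  by (rule submod_image[OF T2.tensor_module T1.tensor_module \<delta>2_mhom])

text \<open>\<open>w\<close> is the image under \<open>d2\<close> of its own basis element of
  \<open>P2\<close>: exactness of the resolution at \<open>P1\<close> holds by construction.\<close>

lemma pure_boundary:
  assumes "w \<in> Z1" "y \<in> carrier N" shows "T1.pure w y \<in> boundaries"
proof -
  have "e2 w \<in> carrier P2" by (rule free_gen_closed[OF R_cring assms(1)])
  then show ?thesis
    using \<delta>2_pure[of "e2 w" y] assms T2.pure_closed[of "e2 w" y]
    by (auto simp: d2_gen simp del: free_module_simps)
qed

lemma \<delta>1_\<delta>2: "t \<in> carrier C2 \<Longrightarrow> \<delta>1 (\<delta>2 t) = \<zero>\<^bsub>C0\<^esub>"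
proof (rule T2.tensor_hom_ext[OF T0.tensor_module mhom_comp[OF \<delta>2_mhom \<delta>1_mhom]
      mhom_const_zero[OF T0.tensor_module]])
  fix w y assume w: "w \<in> carrier P2" and y: "y \<in> carrier N"
  have "\<delta>1 (\<delta>2 (T2.pure w y)) = T0.pure \<zero>\<^bsub>P0\<^esub> y"
    unfolding \<delta>2_pure[OF w y] \<delta>1_pure[OF mhom_closed[OF d2_mhom w] y] d1_d2[OF w] ..
  then show "\<delta>1 (\<delta>2 (T2.pure w y)) = \<zero>\<^bsub>C0\<^esub>"
    unfolding mhom_zero[OF P0_module T0.tensor_module T0.pure_left[OF y]] .
qed

text \<open>It trades the nested quotient for a condition on cycles in \<open>C1\<close>; no later
  step looks inside \<open>Tor1\<close>.\<close>

lemma Tor1_annihilated_iff: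
  assumes s: "s \<in> carrier R"
  shows "(\<forall>t\<in>carrier (Tor1 R M N). s \<odot>\<^bsub>Tor1 R M N\<^esub> t = \<zero>\<^bsub>Tor1 R M N\<^esub>) \<longleftrightarrow>
    (\<forall>t\<in>carrier C1. \<delta>1 t = \<zero>\<^bsub>C0\<^esub> \<longrightarrow> s \<odot>\<^bsub>C1\<^esub> t \<in> boundaries)"
proof -
  let ?Z = "a_kernel C1 C0 \<delta>1"
  let ?C = "C1\<lparr>carrier := ?Z\<rparr>"
  have Z: "submod R ?Z C1"
    by (rule submod_kernel[OF T1.tensor_module T0.tensor_module \<delta>1_mhom])
  interpret Z: LinearCombinations.submodule R ?Z C1 by (rule Z)
  interpret B: LinearCombinations.submodule R boundaries C1 by (rule boundaries_submod)
  have B: "submod R boundaries ?C"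
  proof (rule submodI)
    show "module R ?C" by (rule submod_module[OF Z])
    show "boundaries \<subseteq> carrier ?C"
      using \<delta>1_\<delta>2 mhom_closed[OF \<delta>2_mhom] by (auto simp: a_kernel_def')
  qed (use B.zero_closed B.m_closed B.smult_closed in simp_all)
  have Tor: "Tor1 R M N = quot_module ?C boundaries"
    unfolding Tor1_def Let_def ..
  have "(\<forall>t\<in>carrier (Tor1 R M N). s \<odot>\<^bsub>Tor1 R M N\<^esub> t = \<zero>\<^bsub>Tor1 R M N\<^esub>) \<longleftrightarrow>
      (\<forall>t\<in>?Z. coset_of ?C boundaries (s \<odot>\<^bsub>?C\<^esub> t) = \<zero>\<^bsub>quot_module ?C boundaries\<^esub>)"
    unfolding Tor quot_module_carrier using coset_of_smult[OF B s] by simp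
  also have "\<dots> \<longleftrightarrow> (\<forall>t\<in>?Z. s \<odot>\<^bsub>C1\<^esub> t \<in> boundaries)"
    using coset_of_zero_iff[OF B] Z.smult_closed[OF s] by simp
  finally show ?thesis by (auto simp: a_kernel_def')
qed

end

section \<open>The equational criterion for flatness\<close>

text \<open>Transport of structure along a map that is injective on the carrier. Test modules must
  have their elements in the universe \<open>'u\<close>; ideals, quotients and free modules are
  brought there in this way.\<close>

definition copy_module :: "('m \<Rightarrow> 'n) \<Rightarrow> ('r, 'm) module \<Rightarrow> ('r, 'n) module" where
  "copy_module f M =
    \<lparr>carrier = f ` carrier M, monoid.mult = undefined, monoid.one = undefined,
     ring.zero = f \<zero>\<^bsub>M\<^esub>,
     ring.add = (\<lambda>x y. f (inv_into (carrier M) f x \<oplus>\<^bsub>M\<^esub> inv_into (carrier M) f y)),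
     module.smult = (\<lambda>r x. f (r \<odot>\<^bsub>M\<^esub> inv_into (carrier M) f x))\<rparr>"

lemma copy_module_carrier [simp]: "carrier (copy_module f M) = f ` carrier M"
  by (simp add: copy_module_def)

lemma copy_module:
  assumes "module R M" "inj_on f (carrier M)"
  shows "module R (copy_module f M)"
    and "f \<in> mhom R M (copy_module f M)"
    and "inv_into (carrier M) f \<in> mhom R (copy_module f M) M"
proof -
  interpret M: module R M by fact
  note [simp] = inv_into_f_f[OF assms(2)]
  note [simp] = M.a_ac M.r_neg M.smult_assoc1 M.smult_l_distr M.smult_r_distr
  show "module R (copy_module f M)"
  proof (rule LinearCombinations.module_criteria[OF M.is_cring])
    show "\<forall>v\<in>carrier (copy_module f M). \<exists>neg_v\<in>carrier (copy_module f M).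
        v \<oplus>\<^bsub>copy_module f M\<^esub> neg_v = \<zero>\<^bsub>copy_module f M\<^esub>"
    proof
      fix v assume "v \<in> carrier (copy_module f M)"
      then obtain x where "x \<in> carrier M" "v = f x" by auto
      then show "\<exists>neg_v\<in>carrier (copy_module f M).
          v \<oplus>\<^bsub>copy_module f M\<^esub> neg_v = \<zero>\<^bsub>copy_module f M\<^esub>"
        by (intro bexI[of _ "f (\<ominus>\<^bsub>M\<^esub> x)"]) (simp_all add: copy_module_def)
    qed
  qed (auto simp: copy_module_def)
  show "f \<in> mhom R M (copy_module f M)"
    by (rule mhomI) (auto simp: copy_module_def)
  show "inv_into (carrier M) f \<in> mhom R (copy_module f M) M"
    by (rule mhomI) (auto simp: copy_module_def)
qed

text \<open>An element is determined by its graph over its finite support, hence by a finite set of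
  pairs from \<open>'u\<close>; for infinite \<open>'u\<close> there are no more such sets than
  elements of \<open>'u\<close>.\<close>

lemma free_module_lepoll:
  fixes X :: "'x set"
  assumes "infinite (UNIV :: 'u set)" "X \<lesssim> (UNIV :: 'u set)" "carrier R \<lesssim> (UNIV :: 'u set)"
  shows "carrier (free_module R X) \<lesssim> (UNIV :: 'u set)"
proof -
  obtain i :: "'x \<Rightarrow> 'u" where i: "inj_on i X" using assms(2) by (auto simp: lepoll_def)
  obtain k :: "_ \<Rightarrow> 'u" where k: "inj_on k (carrier R)" using assms(3) by (auto simp: lepoll_def)
  define G where "G \<phi> = (\<lambda>x. (i x, k (\<phi> x))) ` {x \<in> X. \<phi> x \<noteq> \<zero>\<^bsub>R\<^esub>}" for \<phi>
  have "carrier (free_module R X) \<lesssim> Fpow (UNIV :: ('u \<times> 'u) set)"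
    unfolding lepoll_def
  proof (intro exI conjI inj_onI)
    show "G ` carrier (free_module R X) \<subseteq> Fpow UNIV"
      by (auto simp: Fpow_def G_def)
    fix \<phi> \<psi> assume \<phi>: "\<phi> \<in> carrier (free_module R X)" and \<psi>: "\<psi> \<in> carrier (free_module R X)"
      and eq: "G \<phi> = G \<psi>"
    have *: "f x = g x"
      if "f \<in> carrier (free_module R X)" "g \<in> carrier (free_module R X)" "G f = G g"
        "x \<in> X" "f x \<noteq> \<zero>\<^bsub>R\<^esub>" for f g x
    proof -
      have "(i x, k (f x)) \<in> G g" using that(3-5) unfolding G_def by blast
      then obtain y where y: "y \<in> X" "i x = i y" "k (f x) = k (g y)" by (auto simp: G_def)
      then have "x = y" using inj_onD[OF i] that(4) by blast
      then show ?thesis using inj_onD[OF k y(3)] that(1,2,4) by (auto simp: PiE_iff)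
    qed
    show "\<phi> = \<psi>"
    proof (rule PiE_ext[of _ X "\<lambda>_. carrier R"])
      fix x assume "x \<in> X"
      then show "\<phi> x = \<psi> x" using *[OF \<phi> \<psi> eq, of x] *[OF \<psi> \<phi> eq[symmetric], of x] by metis
    qed (use \<phi> \<psi> in auto)
  qed
  also have "Fpow (UNIV :: ('u \<times> 'u) set) \<approx> (UNIV :: ('u \<times> 'u) set)"
    using assms(1) by (intro eqpoll_Fpow) (simp add: finite_prod)
  also have "(UNIV :: ('u \<times> 'u) set) \<approx> (UNIV :: 'u set)"
    using card_of_Times_same_infinite[OF assms(1)]
    by (simp add: eqpoll_iff_card_of_ordIso)
  finally show ?thesis .
qed

text \<open>The equational criterion for flatness. It refers to no test modules, hence to no
  universe, and is the common form in which flat modules, projective modules and \<open>R\<close>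
  enter the argument for products.\<close>

definition eq_flat :: "('r, 'c) ring_scheme \<Rightarrow> ('r, 'm) module \<Rightarrow> bool" where
  "eq_flat R F \<longleftrightarrow>
    (\<forall>q a x. a \<in> tuples q R \<and> x \<in> tuples q F \<and> lsum F q a x = \<zero>\<^bsub>F\<^esub> \<longrightarrow>
      (\<exists>n l y. (\<forall>v<n. l v \<in> tuples q R \<and> lsum (regular_module R) q (l v) a = \<zero>\<^bsub>R\<^esub>) \<and>
        y \<in> tuples n F \<and> (\<forall>j<q. x j = lsum F n (\<lambda>v. l v j) y)))"

text \<open>A solution in \<open>R\<close> is itself a relation, so a single term with coefficient
  one suffices.\<close>

lemma eq_flat_regular:
  assumes "cring R" shows "eq_flat R (regular_module R)"
  unfolding eq_flat_def
proof (intro allI impI, elim conjE)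
  fix q a x
  assume a: "a \<in> tuples q R" and x: "x \<in> tuples q (regular_module R)"
    and eq: "lsum (regular_module R) q a x = \<zero>\<^bsub>regular_module R\<^esub>"
  interpret cring R by fact
  have "lsum (regular_module R) q x a = \<zero>\<^bsub>R\<^esub>"
    using lsum_regular_comm[OF assms a] x eq by simp
  moreover have "x j = lsum (regular_module R) 1 (\<lambda>v. x j) (\<lambda>_. \<one>\<^bsub>R\<^esub>)" if "j < q" for j
    using x that by (simp add: lsum_def finsum_regular Pi_iff lessThan_Suc)
  ultimately show "\<exists>n l y. (\<forall>v<n. l v \<in> tuples q R \<and>
        lsum (regular_module R) q (l v) a = \<zero>\<^bsub>R\<^esub>) \<and>
      y \<in> tuples n (regular_module R) \<and>
      (\<forall>j<q. x j = lsum (regular_module R) n (\<lambda>v. l v j) y)"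
    using x by (intro exI[of _ 1] exI[of _ "\<lambda>_. x"] exI[of _ "\<lambda>_. \<one>\<^bsub>R\<^esub>"]) simp
qed

text \<open>In R tensor F the tensor becomes one tensor the sum of the products of
  \<open>a j\<close> and \<open>x j\<close>, which is zero; flatness, applied to the inclusion of
  \<open>J\<close> in \<open>R\<close>, carries this back to J tensor F.\<close>

lemma tensor_sum_zero_of_flat:
  fixes F :: "('r, 'm) module"
  assumes "cring R" and flat: "flat TYPE('u) R F" and i: "inj_on (i :: 'r \<Rightarrow> 'u) (carrier R)"
    and J: "submod R J (regular_module R)"
    and a: "a \<in> {..<q} \<rightarrow> J" and x: "x \<in> tuples q F" and eq: "lsum F q a x = \<zero>\<^bsub>F\<^esub>"
  defines "A \<equiv> copy_module i ((regular_module R)\<lparr>carrier := J\<rparr>)"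
  shows "(\<Oplus>\<^bsub>tensor_module R A F\<^esub>j\<in>{..<q}. pure_tensor R A F (i (a j)) (x j))
    = \<zero>\<^bsub>tensor_module R A F\<^esub>"
proof -
  let ?RJ = "(regular_module R)\<lparr>carrier := J\<rparr>"
  let ?R = "regular_module R"
  let ?B = "copy_module i ?R"
  have F: "module R F" using flat by (simp add: flat_def)
  have J_sub: "J \<subseteq> carrier R" using submod_subset[OF J] by auto
  have iJ: "inj_on i (carrier ?RJ)" using inj_on_subset[OF i J_sub] by simp
  have iR: "inj_on i (carrier ?R)" using i by simp
  note cA = copy_module[OF submod_module[OF J] iJ, folded A_def]
  note cB = copy_module[OF regular_module[OF assms(1)] iR]
  let ?f = "\<lambda>z. i (inv_into (carrier ?RJ) i z)"
  from mhom_comp[OF cA(3) mhom_comp[OF submod_incl[OF J] cB(2)]]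
  have f: "?f \<in> mhom R A ?B" .
  \<comment> \<open>Both modules are copied by the same \<open>i\<close>, so the inclusion becomes
    the identity on elements.\<close>
  have f_id: "?f z = z" if "z \<in> carrier A" for z
    using that unfolding A_def copy_module_carrier by (rule f_inv_into_f)
  have inj_f: "inj_on ?f (carrier A)"
    by (rule inj_onI) (simp only: f_id)
  have inj: "inj_on (tensor_map R A ?B F ?f) (carrier (tensor_module R A F))"
    using flat cA(1) cB(1) f inj_f unfolding flat_def by blast
  interpret TA: tensor_product R A F by (intro tensor_product.intro cA F)
  interpret TB: tensor_product R ?B F by (intro tensor_product.intro cB F)
  interpret F: module R F by (rule F)
  interpret TTA: module R TA.T by (rule TA.tensor_module)
  note tm = tensor_map_mhom[OF cA(1) cB(1) F f]
  have aA: "i (a j) \<in> carrier A" and aR: "a j \<in> carrier R" and x': "x j \<in> carrier F"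
    if "j < q" for j
    using a x that J_sub by (auto simp: A_def)
  have one: "i \<one>\<^bsub>R\<^esub> \<in> carrier ?B" using F.one_closed by simp
  let ?t = "\<Oplus>\<^bsub>TA.T\<^esub>j\<in>{..<q}. TA.pure (i (a j)) (x j)"
  have t: "?t \<in> carrier TA.T"
    by (intro TTA.finsum_closed Pi_I TA.pure_closed aA x') simp_all
  have "tensor_map R A ?B F ?f ?t = (\<Oplus>\<^bsub>TB.T\<^esub>j\<in>{..<q}. TB.pure (?f (i (a j))) (x j))"
    using aA by (intro tensor_map_sum[OF cA(1) cB(1) F f _ x]) simp
  also have "\<dots> = (\<Oplus>\<^bsub>TB.T\<^esub>j\<in>{..<q}. TB.pure (a j \<odot>\<^bsub>?B\<^esub> i \<one>\<^bsub>R\<^esub>) (x j))"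
  proof -
    interpret B: module R ?B by (rule cB)
    interpret TTB: module R TB.T by (rule TB.tensor_module)
    show ?thesis
    proof (rule TTB.finsum_cong'[OF refl], rule Pi_I)
      fix j assume "j \<in> {..<q}"
      then have j: "j < q" by simp
      show "TB.pure (a j \<odot>\<^bsub>?B\<^esub> i \<one>\<^bsub>R\<^esub>) (x j) \<in> carrier TB.T"
        by (intro TB.pure_closed B.smult_closed aR one x' j)
      have "i (a j) = a j \<odot>\<^bsub>?B\<^esub> i \<one>\<^bsub>R\<^esub>"
        using mhom_smult[OF cB(2) aR[OF j], of "\<one>\<^bsub>R\<^esub>"] aR[OF j] F.one_closed F.r_one by simp
      with f_id[OF aA[OF j]] show "TB.pure (?f (i (a j))) (x j) = TB.pure (a j \<odot>\<^bsub>?B\<^esub> i \<one>\<^bsub>R\<^esub>) (x j)"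
        by (simp only:)
    qed
  qed
  also have "\<dots> = TB.pure (i \<one>\<^bsub>R\<^esub>) (lsum F q a x)"
    using aR by (intro TB.pure_lsum[OF one _ x]) simp
  also have "\<dots> = \<zero>\<^bsub>TB.T\<^esub>"
    unfolding eq by (rule mhom_zero[OF F TB.tensor_module TB.pure_right[OF one]])
  also have "\<dots> = tensor_map R A ?B F ?f \<zero>\<^bsub>TA.T\<^esub>"
    by (rule mhom_zero[OF TA.tensor_module TB.tensor_module tm(1), symmetric])
  finally show ?thesis
    by (rule inj_onD[OF inj _ t TTA.zero_closed])
qed

text \<open>With \<open>J\<close> the ideal generated by the \<open>a j\<close>, flatness makes the
  tensor attached to \<open>x\<close> vanish in J tensor F, and \<open>tensor_vanish\<close> reads
  off the relations.\<close>

lemma eq_flat_of_flat: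
  fixes F :: "('r, 'm) module"
  assumes "cring R" "carrier R \<lesssim> (UNIV :: 'u set)" and flat: "flat TYPE('u) R F"
  shows "eq_flat R F"
  unfolding eq_flat_def
proof (intro allI impI, elim conjE)
  fix q a x
  assume a: "a \<in> tuples q R" and x: "x \<in> tuples q F"
    and eq: "lsum F q a x = \<zero>\<^bsub>F\<^esub>"
  let ?R = "regular_module R"
  obtain i :: "'r \<Rightarrow> 'u" where i: "inj_on i (carrier R)" using assms(2) by (auto simp: lepoll_def)
  have F: "module R F" using flat by (simp add: flat_def)
  have RM: "module R ?R" by (rule regular_module[OF assms(1)])
  have aR: "a \<in> tuples q ?R" using a by simp
  define J where "J = (\<lambda>c. lsum ?R q c a) ` carrier (power_module q ?R)"
  have J: "submod R J ?R"
    unfolding J_def by (rule submod_image[OF power_module[OF RM] RM lsum_coeff_mhom[OF RM aR]])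
  have J_sub: "J \<subseteq> carrier R" using submod_subset[OF J] by auto
  let ?RJ = "?R\<lparr>carrier := J\<rparr>"
  let ?A = "copy_module i ?RJ"
  have RJ: "module R ?RJ" by (rule submod_module[OF J])
  have "inj_on i (carrier ?RJ)" using inj_on_subset[OF i J_sub] by simp
  note cA = copy_module[OF RJ this]
  have aJ: "a j \<in> J" if "j < q" for j
    unfolding J_def by (rule lsum_image_unit[OF RM aR that])
  have zero: "(\<Oplus>\<^bsub>tensor_module R ?A F\<^esub>j\<in>{..<q}. pure_tensor R ?A F (i (a j)) (x j))
      = \<zero>\<^bsub>tensor_module R ?A F\<^esub>"
    using aJ by (intro tensor_sum_zero_of_flat[OF assms(1) flat i J _ x eq]) auto
  have ia: "(\<lambda>j. i (a j)) \<in> tuples q ?A" using aJ by auto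
  have aRJ: "a \<in> tuples q ?RJ" using aJ by auto
  have gen: "\<exists>c\<in>tuples q R. z = lsum ?A q c (\<lambda>j. i (a j))" if z: "z \<in> carrier ?A" for z
  proof -
    obtain c where c: "c \<in> {..<q} \<rightarrow>\<^sub>E carrier R" "z = i (lsum ?R q c a)"
      using z by (auto simp: J_def)
    then have cR: "c \<in> tuples q R" by auto
    have "lsum ?R q c a = lsum ?RJ q c a"
      using aJ by (intro lsum_submod[OF J cR, symmetric]) simp
    then have "z = lsum ?A q c (\<lambda>j. i (a j))"
      using mhom_lsum[OF RJ cA(1,2) cR aRJ] c(2) by simp
    with cR show ?thesis by blast
  qed
  obtain n l y where "\<forall>v<n. l v \<in> tuples q R \<and> lsum ?A q (l v) (\<lambda>j. i (a j)) = \<zero>\<^bsub>?A\<^esub>"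
    and y: "y \<in> tuples n F" and xy: "\<forall>j<q. x j = lsum F n (\<lambda>v. l v j) y"
    by (rule tensor_vanish[OF cA(1) F ia x gen zero])
  then have l: "l v \<in> tuples q R"
    and rel: "lsum ?A q (l v) (\<lambda>j. i (a j)) = \<zero>\<^bsub>?A\<^esub>" if "v < n" for v
    using that by simp_all
  \<comment> \<open>The relations obtained hold in the copy of \<open>J\<close>; the inverse of
    \<open>i\<close> and the inclusion return them to \<open>R\<close>.\<close>
  have "lsum ?R q (l v) a = \<zero>\<^bsub>R\<^esub>" if v: "v < n" for v
  proof -
    let ?k = "inv_into (carrier ?RJ) i"
    have k: "?k (i (a j)) = a j" if "j < q" for j
      using aJ[OF that] inj_on_subset[OF i J_sub] by (simp add: inv_into_f_f)
    have "\<zero>\<^bsub>?RJ\<^esub> = ?k (lsum ?A q (l v) (\<lambda>j. i (a j)))"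
      unfolding rel[OF v] by (rule mhom_zero[OF cA(1) RJ cA(3), symmetric])
    also have "\<dots> = lsum ?RJ q (l v) (\<lambda>j. ?k (i (a j)))"
      by (rule mhom_lsum[OF cA(1) RJ cA(3) l[OF v] ia])
    also have "\<dots> = lsum ?RJ q (l v) a"
      using l[OF v] aJ k by (intro lsum_cong[OF RJ]) auto
    also have "\<dots> = lsum ?R q (l v) a"
      using aJ by (intro lsum_submod[OF J l[OF v]]) simp
    finally show ?thesis by simp
  qed
  with l y xy show "\<exists>n l y. (\<forall>v<n. l v \<in> tuples q R \<and> lsum ?R q (l v) a = \<zero>\<^bsub>R\<^esub>) \<and>
      y \<in> tuples n F \<and> (\<forall>j<q. x j = lsum F n (\<lambda>v. l v j) y)"
    by blast
qed

text \<open>Projectivity makes \<open>P\<close> a retract of the free module on its own elements.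
  The section carries a solution in \<open>P\<close> to one in the free module, whose coordinates
  are solutions in \<open>R\<close>; mapping back to \<open>P\<close> expresses the original
  solution by these.\<close>

lemma eq_flat_of_projective:
  fixes P :: "('r, 'u) module"
  assumes "infinite (UNIV :: 'u set)" "carrier R \<lesssim> (UNIV :: 'u set)" and proj: "projective TYPE('u) R P"
  shows "eq_flat R P"
  unfolding eq_flat_def
proof (intro allI impI, elim conjE)
  fix q a x
  assume a: "a \<in> tuples q R" and x: "x \<in> tuples q P"
    and eq: "lsum P q a x = \<zero>\<^bsub>P\<^esub>"
  let ?R = "regular_module R"
  let ?F = "free_module R (carrier P)"
  have P: "module R P" using proj by (simp add: projective_def)
  interpret P: module R P by (rule P)
  have R: "cring R" by (rule P.is_cring)
  have F: "module R ?F" by (rule free_module[OF R])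
  have RM: "module R ?R" by (rule regular_module[OF R])
  obtain i :: "_ \<Rightarrow> 'u" where i: "inj_on i (carrier ?F)"
    using free_module_lepoll[OF assms(1) subset_imp_lepoll[OF subset_UNIV] assms(2), of "carrier P"]
    by (auto simp: lepoll_def simp del: free_module_simps)
  let ?A = "copy_module i ?F"
  note cA = copy_module[OF F i]
  let ?d = "free_lift R (carrier P) P (\<lambda>x. x)"
  let ?k = "inv_into (carrier ?F) i"
  have d: "?d \<in> mhom R ?F P" by (rule free_lift_mhom[OF P]) auto
  have g: "(\<lambda>z. ?d (?k z)) \<in> mhom R ?A P" by (rule mhom_comp[OF cA(3) d])
  have surj: "(\<lambda>z. ?d (?k z)) ` carrier ?A = carrier P"
  proof
    show "(\<lambda>z. ?d (?k z)) ` carrier ?A \<subseteq> carrier P" using mhom_closed[OF g] by blast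
    show "carrier P \<subseteq> (\<lambda>z. ?d (?k z)) ` carrier ?A"
    proof
      fix p assume p: "p \<in> carrier P"
      have e: "free_gen R (carrier P) p \<in> carrier ?F" by (rule free_gen_closed[OF R p])
      have "?d (?k (i (free_gen R (carrier P) p))) = p"
        unfolding inv_into_f_f[OF i e] by (rule free_lift_gen[OF P p]) (rule p)
      then show "p \<in> (\<lambda>z. ?d (?k z)) ` carrier ?A"
        using e by (intro image_eqI[of _ _ "i (free_gen R (carrier P) p)"]) (simp_all del: free_module_simps)
    qed
  qed
  obtain h where h: "h \<in> mhom R P ?A" and hd: "\<forall>p\<in>carrier P. ?d (?k (h p)) = p"
    using proj cA(1) P g surj mhom_id[of R P] unfolding projective_def by blast
  define \<phi> where "\<phi> j = ?k (h (x j))" for j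
  have kh: "(\<lambda>p. ?k (h p)) \<in> mhom R P ?F" by (rule mhom_comp[OF h cA(3)])
  have \<phi>: "\<phi> j \<in> carrier ?F" if "j < q" for j
    unfolding \<phi>_def using mhom_closed[OF kh, of "x j"] x that by (auto simp del: free_module_simps)
  have \<phi>_sum: "lsum ?F q a \<phi> = \<zero>\<^bsub>?F\<^esub>"
    using mhom_lsum[OF P F kh a x] mhom_zero[OF P F kh] unfolding eq \<phi>_def by (simp only:)
  \<comment> \<open>Finitely many coordinates suffice, since each of the \<open>q\<close> lifts has
    finite support.\<close>
  define Y where "Y = (\<Union>j\<in>{..<q}. {p \<in> carrier P. \<phi> j p \<noteq> \<zero>\<^bsub>R\<^esub>})"
  have Y: "finite Y" "Y \<subseteq> carrier P" using \<phi> unfolding Y_def by auto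
  obtain e where e: "bij_betw e {..<card Y} Y"
    using ex_bij_betw_nat_finite[OF Y(1)] by (auto simp: atLeast0LessThan)
  then have eY: "e v \<in> carrier P" if "v < card Y" for v using Y(2) that by (auto simp: bij_betw_def)
  have \<phi>R: "\<phi> j p \<in> carrier R" if "j < q" "p \<in> carrier P" for j p
    using \<phi>[OF that(1)] that(2) by (simp add: PiE_iff)
  have rel: "lsum ?R q (\<lambda>j. \<phi> j (e v)) a = \<zero>\<^bsub>R\<^esub>" if v: "v < card Y" for v
  proof -
    have "lsum ?R q (\<lambda>j. \<phi> j (e v)) a = lsum ?R q a (\<lambda>j. \<phi> j (e v))"
      using a \<phi>R eY[OF v] by (intro lsum_regular_comm[OF R]) auto
    also have "\<dots> = lsum ?F q a \<phi> (e v)"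
      using \<phi> by (intro mhom_lsum[OF F RM coeff_mhom[OF eY[OF v]] a, symmetric] Pi_I) (simp del: free_module_simps)
    finally show ?thesis using eY[OF v] unfolding \<phi>_sum by simp
  qed
  have "x j = lsum P (card Y) (\<lambda>v. \<phi> j (e v)) e" if j: "j < q" for j
  proof -
    have xj: "x j \<in> carrier P" using x j by auto
    have "x j = ?d (\<phi> j)" using hd xj by (simp add: \<phi>_def)
    also have "\<dots> = (\<Oplus>\<^bsub>P\<^esub>p\<in>Y. \<phi> j p \<odot>\<^bsub>P\<^esub> p)"
      using j by (intro free_lift_superset[OF P _ \<phi>[OF j] Y(1) _ Y(2)]) (auto simp: Y_def)
    also have "\<dots> = lsum P (card Y) (\<lambda>v. \<phi> j (e v)) e"
      using \<phi>R[OF j] Y(2)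
      by (intro lincomb_lsum[OF P e Y(2), unfolded P.lincomb_def]) blast
    finally show ?thesis .
  qed
  with rel eY \<phi>R show "\<exists>n l y. (\<forall>v<n. l v \<in> tuples q R \<and> lsum ?R q (l v) a = \<zero>\<^bsub>R\<^esub>) \<and>
      y \<in> tuples n P \<and> (\<forall>j<q. x j = lsum P n (\<lambda>v. l v j) y)"
    by (intro exI[of _ "card Y"] exI[of _ "\<lambda>v j. \<phi> j (e v)"] exI[of _ e]) auto
qed

section \<open>Finite presentations and linear systems\<close>

lemma finitely_generatedE:
  assumes "module R M" "finitely_generated R M"
  obtains n g where "g \<in> tuples n M"
    "\<forall>x\<in>carrier M. \<exists>c\<in>tuples n R. x = lsum M n c g"
proof -
  interpret M: module R M by fact
  obtain A where A: "finite A" "A \<subseteq> carrier M" "M.span A = carrier M"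
    using assms(2) by (auto simp: finitely_generated_def)
  obtain h where h: "bij_betw h {..<card A} A"
    using ex_bij_betw_nat_finite[OF A(1)] by (auto simp: atLeast0LessThan)
  have hA: "h i \<in> A" if "i < card A" for i using h that by (auto simp: bij_betw_def)
  show ?thesis
  proof (rule that[of h "card A"])
    show "h \<in> {..<card A} \<rightarrow> carrier M" using hA A(2) by auto
    show "\<forall>x\<in>carrier M. \<exists>c\<in>{..<card A} \<rightarrow> carrier R. x = lsum M (card A) c h"
    proof
      fix x assume "x \<in> carrier M"
      then obtain a where a: "a \<in> A \<rightarrow> carrier R" "x = M.lincomb a A"
        using M.finite_in_span[OF A(1,2)] A(3) by metis
      then have "x = lsum M (card A) (\<lambda>i. a (h i)) h"
        using lincomb_lsum[OF assms(1) h A(2) a(1)] by (simp only:)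
      moreover have "(\<lambda>i. a (h i)) \<in> {..<card A} \<rightarrow> carrier R" using a(1) hA by auto
      ultimately show "\<exists>c\<in>{..<card A} \<rightarrow> carrier R. x = lsum M (card A) c h" by (rule bexI)
    qed
  qed
qed

lemma finitely_generatedI:
  assumes "module R M" "g \<in> tuples n M"
    and "\<And>x. x \<in> carrier M \<Longrightarrow> \<exists>c\<in>tuples n R. x = lsum M n c g"
  shows "finitely_generated R M"
  unfolding finitely_generated_def
proof (intro exI conjI)
  let ?A = "g ` {..<n}"
  show A: "?A \<subseteq> carrier M" using assms(2) by auto
  show "module.span R M ?A = carrier M"
  proof
    show "module.span R M ?A \<subseteq> carrier M"
      using submod_subset[OF span_submod[OF assms(1) A]] by auto
    show "carrier M \<subseteq> module.span R M ?A"
    proof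
      fix x assume "x \<in> carrier M"
      then obtain c where c: "c \<in> tuples n R" "x = lsum M n c g" using assms(3) by blast
      show "x \<in> module.span R M ?A"
        unfolding c(2) using span_gen[OF assms(1) A]
        by (intro submod_lsum[OF span_submod[OF assms(1) A] c(1)]) auto
    qed
  qed
qed simp

text \<open>Independence makes the coefficients of an element unique, so choosing them is linear by
  \<open>mhom_factor\<close>. Later proofs use a given free module through these coordinates
  alone.\<close>

lemma fg_free_coordinates:
  assumes "fg_free R F"
  obtains m b \<kappa> where "b \<in> tuples m F"
    and "\<forall>i<m. (\<lambda>f. \<kappa> f i) \<in> mhom R F (regular_module R)"
    and "\<forall>f\<in>carrier F. f = lsum F m (\<kappa> f) b"
proof -
  have F: "module R F" using assms by (simp add: fg_free_def)
  interpret F: module R F by (rule F)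
  obtain B where B: "finite B" "B \<subseteq> carrier F" "F.span B = carrier F" "\<not> F.lin_dep B"
    using assms by (auto simp: fg_free_def)
  have RM: "module R (regular_module R)" by (rule regular_module[OF F.is_cring])
  define m where "m = card B"
  obtain h where h: "bij_betw h {..<m} B"
    using ex_bij_betw_nat_finite[OF B(1)] by (auto simp: atLeast0LessThan m_def)
  have hB: "h i \<in> B" if "i < m" for i using h that by (auto simp: bij_betw_def)
  have hF: "h \<in> tuples m F" using hB B(2) by auto
  let ?Rm = "power_module m (regular_module R)"
  let ?\<l> = "\<lambda>c. lsum F m c h"
  have Rm: "module R ?Rm" by (rule power_module[OF RM])
  have \<l>: "?\<l> \<in> mhom R ?Rm F" by (rule lsum_coeff_mhom[OF F hF])
  have inj: "c i = \<zero>\<^bsub>R\<^esub>" if c: "c \<in> carrier ?Rm" "?\<l> c = \<zero>\<^bsub>F\<^esub>" and i: "i < m" for c i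
  proof (rule ccontr)
    assume ne: "c i \<noteq> \<zero>\<^bsub>R\<^esub>"
    let ?a = "\<lambda>v. c (inv_into {..<m} h v)"
    have inv: "inv_into {..<m} h (h j) = j" if "j < m" for j
      using h that by (simp add: bij_betw_def inv_into_f_f)
    have invB: "inv_into {..<m} h v \<in> {..<m}" if "v \<in> B" for v
      using bij_betwE[OF bij_betw_inv_into[OF h]] that by blast
    have cR: "c j \<in> carrier R" if "j < m" for j using c(1) that by (auto simp: PiE_iff)
    have aR: "?a \<in> B \<rightarrow> carrier R" using invB cR by (intro Pi_I) blast
    have "F.lincomb ?a B = lsum F m (\<lambda>j. ?a (h j)) h"
      by (rule lincomb_lsum[OF F h B(2) aR])
    also have "\<dots> = lsum F m c h"
      by (rule lsum_cong[OF F _ hF]) (use cR inv in auto)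
    finally have "F.lincomb ?a B = \<zero>\<^bsub>F\<^esub>" by (simp only: c(2))
    moreover have "?a (h i) \<noteq> \<zero>\<^bsub>R\<^esub>" using ne inv[OF i] by simp
    ultimately have "F.lin_dep B"
      using F.lin_dep_crit[OF B(1) subset_refl aR hB[OF i]] by blast
    with B(4) show False ..
  qed
  have "\<forall>f\<in>carrier F. \<exists>c. c \<in> carrier ?Rm \<and> ?\<l> c = f"
  proof
    fix f assume "f \<in> carrier F"
    then obtain a where a: "a \<in> B \<rightarrow> carrier R" "F.lincomb a B = f"
      using F.finite_in_span[OF B(1,2)] B(3) by metis
    let ?c = "\<lambda>i\<in>{..<m}. a (h i)"
    have cm: "?c \<in> carrier ?Rm" using a(1) hB by auto
    have "(\<lambda>i. a (h i)) \<in> tuples m R" using a(1) hB by auto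
    then have "?\<l> ?c = f"
      using lincomb_lsum[OF F h B(2) a(1)] a(2) by (simp only: lsum_restrict[OF F _ hF])
    with cm show "\<exists>c. c \<in> carrier ?Rm \<and> ?\<l> c = f" by blast
  qed
  from bchoice[OF this] obtain \<kappa> where \<kappa>: "\<forall>f\<in>carrier F. \<kappa> f \<in> carrier ?Rm \<and> ?\<l> (\<kappa> f) = f" ..
  show ?thesis
  proof (rule that[OF hF])
    show "\<forall>f\<in>carrier F. f = lsum F m (\<kappa> f) h" using \<kappa> by simp
    show "\<forall>i<m. (\<lambda>f. \<kappa> f i) \<in> mhom R F (regular_module R)"
    proof (intro allI impI)
      fix i assume i: "i < m"
      show "(\<lambda>f. \<kappa> f i) \<in> mhom R F (regular_module R)"
        by (rule mhom_factor(1)[OF Rm F RM \<l> proj_mhom _ bspec[OF \<kappa>]])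
          (use i inj in simp_all)
    qed
  qed
qed

section \<open>Ideals as submodules of the ring\<close>

lemma submod_regular_imp_ideal:
  assumes "cring R" "submod R J (regular_module R)"
  shows "ideal J R"
proof -
  interpret cring R by fact
  interpret J: LinearCombinations.submodule R J "regular_module R" by fact
  have JR: "z \<in> carrier R" if "z \<in> J" for z
    using submod_subset[OF assms(2) that] by simp
  have "subgroup J (add_monoid R)"
  proof (rule add.subgroupI)
    show "J \<subseteq> carrier R" using JR by blast
    show "J \<noteq> {}" using J.zero_closed by blast
    show "\<ominus>\<^bsub>R\<^esub> z \<in> J" if "z \<in> J" for z
      using J.smult_closed[of "\<ominus>\<^bsub>R\<^esub> \<one>\<^bsub>R\<^esub>" z] that JR[OF that] by (simp add: l_minus)
    show "z \<oplus>\<^bsub>R\<^esub> z' \<in> J" if "z \<in> J" "z' \<in> J" for z z'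
      using J.m_closed[OF that] by simp
  qed
  moreover have "x \<otimes>\<^bsub>R\<^esub> z \<in> J" "z \<otimes>\<^bsub>R\<^esub> x \<in> J" if "x \<in> carrier R" "z \<in> J" for x z
    using J.smult_closed[OF that] m_comm[OF that(1) JR[OF that(2)]] by simp_all
  ultimately show ?thesis by (intro idealI ring_axioms)
qed

lemma ideal_imp_submod_regular:
  assumes "cring R" "ideal J R"
  shows "submod R J (regular_module R)"
proof -
  interpret ideal J R by fact
  show ?thesis
    using regular_module[OF assms(1)] a_subset I_l_closed
    by (intro submodI) auto
qed

lemma Idl_eq_lsum:
  assumes "cring R" "a \<in> tuples q R"
  shows "Idl\<^bsub>R\<^esub> (a ` {..<q}) =
    (\<lambda>c. lsum (regular_module R) q c a) ` carrier (power_module q (regular_module R))"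
    (is "_ = ?f ` carrier ?Rq")
proof
  interpret cring R by fact
  have A: "a ` {..<q} \<subseteq> carrier R" using assms(2) by auto
  have RM: "module R (regular_module R)" by (rule regular_module[OF assms(1)])
  have aR: "a \<in> tuples q (regular_module R)" using assms(2) by simp
  have J: "submod R (?f ` carrier ?Rq) (regular_module R)"
    by (rule submod_image[OF power_module[OF RM] RM lsum_coeff_mhom[OF RM aR]])
  have "a j \<in> ?f ` carrier ?Rq" if "j < q" for j
    by (rule lsum_image_unit[OF RM aR that])
  then show "Idl\<^bsub>R\<^esub> (a ` {..<q}) \<subseteq> ?f ` carrier ?Rq"
    by (intro genideal_minimal submod_regular_imp_ideal assms(1) J) auto
  show "?f ` carrier ?Rq \<subseteq> Idl\<^bsub>R\<^esub> (a ` {..<q})"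
  proof
    fix z assume "z \<in> ?f ` carrier ?Rq"
    then obtain c where c: "c \<in> carrier ?Rq" "z = ?f c" by blast
    show "z \<in> Idl\<^bsub>R\<^esub> (a ` {..<q})"
      unfolding c(2) using c(1) genideal_self[OF A]
      by (intro submod_lsum[OF ideal_imp_submod_regular[OF assms(1) genideal_ideal[OF A]]]) auto
  qed
qed

lemma lsum_Suc:
  assumes "module R M" "c \<in> tuples (Suc n) R" "x \<in> tuples (Suc n) M"
  shows "lsum M (Suc n) c x = lsum M n c x \<oplus>\<^bsub>M\<^esub> c n \<odot>\<^bsub>M\<^esub> x n"
proof -
  interpret M: module R M by fact
  have "lsum M (Suc n) c x = c n \<odot>\<^bsub>M\<^esub> x n \<oplus>\<^bsub>M\<^esub> lsum M n c x"
    unfolding lsum_def lessThan_Suc using assms(2,3)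
    by (subst M.finsum_insert) (auto simp: Pi_iff less_Suc_eq)
  moreover have "lsum M n c x \<in> carrier M"
    using assms by (intro lsum_closed) auto
  moreover have "c n \<in> carrier R" "x n \<in> carrier M" using assms(2,3) by auto
  ultimately show ?thesis by (simp add: M.M.a_comm)
qed

lemma lsum_append:
  assumes "module R M" "c \<in> tuples (n + m) R" "x \<in> tuples (n + m) M"
  shows "lsum M (n + m) c x = lsum M n c x \<oplus>\<^bsub>M\<^esub> lsum M m (\<lambda>j. c (n + j)) (\<lambda>j. x (n + j))"
proof -
  interpret M: module R M by fact
  show ?thesis using assms(2,3)
  proof (induct m)
    case 0
    then have "lsum M n c x \<in> carrier M" by (intro lsum_closed[OF assms(1)]) auto
    then show ?case by (simp add: lsum_def)
  next
    case (Suc m)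
    have cl: "lsum M n c x \<in> carrier M"
      using Suc.prems by (intro lsum_closed[OF assms(1)]) auto
    have cl': "lsum M m (\<lambda>j. c (n + j)) (\<lambda>j. x (n + j)) \<in> carrier M"
      using Suc.prems by (intro lsum_closed[OF assms(1)]) auto
    have cl'': "c (n + m) \<odot>\<^bsub>M\<^esub> x (n + m) \<in> carrier M"
      using Suc.prems by (intro M.smult_closed) auto
    have "lsum M (n + Suc m) c x = lsum M (n + m) c x \<oplus>\<^bsub>M\<^esub> c (n + m) \<odot>\<^bsub>M\<^esub> x (n + m)"
      using lsum_Suc[OF assms(1), of c "n + m" x] Suc.prems by simp
    also have "\<dots> = lsum M n c x \<oplus>\<^bsub>M\<^esub> (lsum M m (\<lambda>j. c (n + j)) (\<lambda>j. x (n + j)) \<oplus>\<^bsub>M\<^esub> c (n + m) \<odot>\<^bsub>M\<^esub> x (n + m))"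
      unfolding M.M.a_assoc[OF cl cl' cl'', symmetric] using Suc.prems
      by (subst Suc.hyps) (auto simp: Pi_iff)
    also have "lsum M m (\<lambda>j. c (n + j)) (\<lambda>j. x (n + j)) \<oplus>\<^bsub>M\<^esub> c (n + m) \<odot>\<^bsub>M\<^esub> x (n + m)
        = lsum M (Suc m) (\<lambda>j. c (n + j)) (\<lambda>j. x (n + j))"
      using Suc.prems by (intro lsum_Suc[OF assms(1), symmetric]) auto
    finally show ?case .
  qed
qed

text \<open>The elements of \<open>A\<close> are the rows of a homogeneous linear system in \<open>q\<close> unknowns.\<close>

definition S_solvable ::
    "('r, 'c) ring_scheme \<Rightarrow> 'r set \<Rightarrow> ('r, 'm) module \<Rightarrow> nat \<Rightarrow> (nat \<Rightarrow> 'r) set \<Rightarrow> bool" where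
  "S_solvable R S N q A \<longleftrightarrow>
    (\<exists>s\<in>S. \<exists>n l.
      (\<forall>v<n. l v \<in> tuples q R \<and> (\<forall>a\<in>A. lsum (regular_module R) q (l v) a = \<zero>\<^bsub>R\<^esub>)) \<and>
      (\<forall>x\<in>tuples q N. (\<forall>a\<in>A. lsum N q a x = \<zero>\<^bsub>N\<^esub>) \<longrightarrow>
        (\<exists>g\<in>tuples n N. \<forall>j<q. s \<odot>\<^bsub>N\<^esub> x j = lsum N n (\<lambda>v. l v j) g)))"

text \<open>The same \<open>n\<close> and \<open>l\<close> serve every factor:
  \<open>eq_flat\<close> writes the component of \<open>x\<close> by solutions in \<open>R\<close>,
  and \<open>s\<close> times each of these is a combination of the \<open>l v\<close>. As their
  number is the same everywhere, the coefficients found in the factors combine to \<open>n\<close>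
  elements of the product.\<close>

lemma S_solvable_direct_product:
  assumes R: "cring R" and S: "S \<subseteq> carrier R" and M: "\<And>i. i \<in> I \<Longrightarrow> module R (M i)"
    and eq: "\<And>i. i \<in> I \<Longrightarrow> eq_flat R (M i)"
    and a: "a \<in> tuples q R" and sol: "S_solvable R S (regular_module R) q {a}"
  shows "S_solvable R S (direct_product I M) q {a}"
proof -
  let ?R = "regular_module R"
  let ?N = "direct_product I M"
  obtain s n l where s: "s \<in> S"
    and l: "\<forall>v<n. l v \<in> tuples q R \<and> lsum ?R q (l v) a = \<zero>\<^bsub>R\<^esub>"
    and gen: "\<forall>x\<in>tuples q R. lsum ?R q a x = \<zero>\<^bsub>R\<^esub> \<longrightarrow>
      (\<exists>g\<in>tuples n R. \<forall>j<q. s \<otimes>\<^bsub>R\<^esub> x j = lsum ?R n (\<lambda>v. l v j) g)"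
    using sol unfolding S_solvable_def regular_module_simps by auto
  have sR: "s \<in> carrier R" using s S by blast
  have "\<exists>g\<in>tuples n ?N. \<forall>j<q. s \<odot>\<^bsub>?N\<^esub> x j = lsum ?N n (\<lambda>v. l v j) g"
    if x: "x \<in> tuples q ?N" and ax: "lsum ?N q a x = \<zero>\<^bsub>?N\<^esub>" for x
  proof -
    have "\<forall>i\<in>I. \<exists>g. g \<in> tuples n (M i) \<and>
        (\<forall>j<q. s \<odot>\<^bsub>M i\<^esub> x j i = lsum (M i) n (\<lambda>v. l v j) g)"
    proof
      fix i assume i: "i \<in> I"
      have xi: "(\<lambda>j. x j i) \<in> tuples q (M i)" using x i by auto
      have "lsum (M i) q a (\<lambda>j. x j i) = lsum ?N q a x i"
        by (rule lsum_direct_product[OF R M i a x, symmetric])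
      also have "\<dots> = \<zero>\<^bsub>M i\<^esub>" unfolding ax using i by simp
      finally have axi: "lsum (M i) q a (\<lambda>j. x j i) = \<zero>\<^bsub>M i\<^esub>" .
      obtain m l' y where l': "\<forall>v<m. l' v \<in> tuples q R \<and> lsum ?R q (l' v) a = \<zero>\<^bsub>R\<^esub>"
        and y: "y \<in> tuples m (M i)" and xy: "\<forall>j<q. x j i = lsum (M i) m (\<lambda>v. l' v j) y"
        using eq[OF i] a xi axi unfolding eq_flat_def by blast
      have "\<forall>v\<in>{..<m}. \<exists>g. g \<in> tuples n R \<and>
          (\<forall>j<q. s \<otimes>\<^bsub>R\<^esub> l' v j = lsum ?R n (\<lambda>w. l w j) g)"
      proof
        fix v assume "v \<in> {..<m}"
        then have v: "l' v \<in> tuples q R" "lsum ?R q (l' v) a = \<zero>\<^bsub>R\<^esub>" using l' by auto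
        then have "lsum ?R q a (l' v) = \<zero>\<^bsub>R\<^esub>" using lsum_regular_comm[OF R v(1) a] by simp
        then show "\<exists>g. g \<in> tuples n R \<and>
            (\<forall>j<q. s \<otimes>\<^bsub>R\<^esub> l' v j = lsum ?R n (\<lambda>w. l w j) g)"
          using gen v(1) by blast
      qed
      from bchoice[OF this] obtain r where r: "\<forall>v\<in>{..<m}. r v \<in> tuples n R \<and>
          (\<forall>j<q. s \<otimes>\<^bsub>R\<^esub> l' v j = lsum ?R n (\<lambda>w. l w j) (r v))" ..
      have rR: "(\<lambda>v. r v w) \<in> tuples m R" if "w < n" for w using r that by auto
      have "s \<odot>\<^bsub>M i\<^esub> x j i = lsum (M i) n (\<lambda>w. l w j) (\<lambda>w. lsum (M i) m (\<lambda>v. r v w) y)"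
        if j: "j < q" for j
      proof -
        have lj: "(\<lambda>w. l w j) \<in> tuples n R" using l j by auto
        have l'j: "(\<lambda>v. l' v j) \<in> tuples m R" using l' j by auto
        have "s \<odot>\<^bsub>M i\<^esub> x j i = lsum (M i) m (\<lambda>v. s \<otimes>\<^bsub>R\<^esub> l' v j) y"
          using xy j lsum_scale_coeff[OF M[OF i] l'j y sR] by simp
        also have "\<dots> = lsum (M i) m (\<lambda>v. lsum ?R n (\<lambda>w. l w j) (\<lambda>w. r v w)) y"
        proof (rule lsum_cong[OF M[OF i] _ y])
          show "(\<lambda>v. s \<otimes>\<^bsub>R\<^esub> l' v j) \<in> tuples m R"
            using l'j sR cring.cring_simprules(5)[OF R] by auto
        qed (use r j in auto)
        also have "\<dots> = lsum (M i) n (\<lambda>w. l w j) (\<lambda>w. lsum (M i) m (\<lambda>v. r v w) y)"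
          by (rule lsum_assoc[OF M[OF i] lj rR y, symmetric])
        finally show ?thesis .
      qed
      moreover have "(\<lambda>w. lsum (M i) m (\<lambda>v. r v w) y) \<in> tuples n (M i)"
        using rR by (intro Pi_I lsum_closed[OF M[OF i] rR y]) simp
      ultimately show "\<exists>g. g \<in> tuples n (M i) \<and>
          (\<forall>j<q. s \<odot>\<^bsub>M i\<^esub> x j i = lsum (M i) n (\<lambda>v. l v j) g)" by blast
    qed
    from bchoice[OF this] obtain g where g: "\<forall>i\<in>I. g i \<in> tuples n (M i) \<and>
        (\<forall>j<q. s \<odot>\<^bsub>M i\<^esub> x j i = lsum (M i) n (\<lambda>v. l v j) (g i))" ..
    define G where "G v = (\<lambda>i\<in>I. g i v)" for v
    have G: "G \<in> tuples n ?N" using g by (auto simp: G_def Pi_iff)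
    have N: "module R ?N" by (rule direct_product_module[OF R M])
    have "s \<odot>\<^bsub>?N\<^esub> x j = lsum ?N n (\<lambda>v. l v j) G" if j: "j < q" for j
    proof (rule PiE_ext[of _ I "\<lambda>i. carrier (M i)"])
      have lj: "(\<lambda>w. l w j) \<in> tuples n R" using l j by auto
      show "lsum ?N n (\<lambda>v. l v j) G \<in> (\<Pi>\<^sub>E i\<in>I. carrier (M i))"
        using lsum_closed[OF N lj G] by simp
      show "s \<odot>\<^bsub>?N\<^esub> x j \<in> (\<Pi>\<^sub>E i\<in>I. carrier (M i))"
        using module.smult_closed[OF N sR, of "x j"] x j by auto
      fix i assume i: "i \<in> I"
      have "lsum ?N n (\<lambda>v. l v j) G i = lsum (M i) n (\<lambda>v. l v j) (\<lambda>v. G v i)"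
        by (rule lsum_direct_product[OF R M i lj G])
      also have "\<dots> = s \<odot>\<^bsub>M i\<^esub> x j i" using g i j by (simp add: G_def)
      finally show "(s \<odot>\<^bsub>?N\<^esub> x j) i = lsum ?N n (\<lambda>v. l v j) G i" using i by simp
    qed
    with G show ?thesis by blast
  qed
  with s l show ?thesis
    unfolding S_solvable_def by (intro bexI[OF _ s] exI[of _ n] exI[of _ l]) auto
qed

text \<open>Inserting the general solution of the rows in \<open>A\<close> turns one further row
  into a single equation for the \<open>n\<close> coefficients, which \<open>single\<close> solves
  with a second multiplier; the two multipliers are multiplied.\<close>

lemma S_solvable_system:
  assumes R: "cring R" and S: "submonoid S R" and N: "module R N"
    and single: "\<And>q a. a \<in> tuples q R \<Longrightarrow> S_solvable R S N q {a}"
    and "finite A" "A \<subseteq> tuples q R"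
  shows "S_solvable R S N q A"
  using assms(5,6)
proof (induct A rule: finite_induct)
  case empty
  \<comment> \<open>The empty system has the same solutions as the equation with zero
    coefficients.\<close>
  have "S_solvable R S N q {\<lambda>_. \<zero>\<^bsub>R\<^esub>}"
    by (rule single) (simp add: cring.cring_simprules(2)[OF R])
  moreover have "lsum N q (\<lambda>_. \<zero>\<^bsub>R\<^esub>) x = \<zero>\<^bsub>N\<^esub>" if "x \<in> tuples q N" for x
    by (rule lsum_zero_coeff[OF N that]) simp
  ultimately show ?case unfolding S_solvable_def by simp blast
next
  case (insert a A)
  let ?R = "regular_module R"
  interpret N: module R N by (rule N)
  have RM: "module R ?R" by (rule regular_module[OF R])
  have a: "a \<in> tuples q R" and A: "A \<subseteq> tuples q R" using insert.prems by auto
  obtain s n l where s: "s \<in> S"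
    and l: "\<forall>v<n. l v \<in> tuples q R \<and> (\<forall>a\<in>A. lsum ?R q (l v) a = \<zero>\<^bsub>R\<^esub>)"
    and gen: "\<forall>x\<in>tuples q N. (\<forall>a\<in>A. lsum N q a x = \<zero>\<^bsub>N\<^esub>) \<longrightarrow>
        (\<exists>g\<in>tuples n N. \<forall>j<q. s \<odot>\<^bsub>N\<^esub> x j = lsum N n (\<lambda>v. l v j) g)"
    using insert.hyps(3)[OF A] unfolding S_solvable_def by blast
  \<comment> \<open>\<open>d v\<close> is the value of the new row on the solution
    \<open>l v\<close>, so \<open>d\<close> is the new row as an equation for the coefficients of
    the \<open>l v\<close>.\<close>
  define d where "d v = lsum ?R q (l v) a" for v
  have lR: "l v \<in> tuples q R" if "v < n" for v using l that by blast
  have d: "d \<in> tuples n R"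
  proof
    fix v assume "v \<in> {..<n}"
    then have "lsum ?R q (l v) a \<in> carrier ?R"
      using a by (intro lsum_closed[OF RM lR]) auto
    then show "d v \<in> carrier R" by (simp add: d_def)
  qed
  obtain s' m l' where s': "s' \<in> S"
    and l': "\<forall>w<m. l' w \<in> tuples n R \<and> lsum ?R n (l' w) d = \<zero>\<^bsub>R\<^esub>"
    and gen': "\<forall>x\<in>tuples n N. lsum N n d x = \<zero>\<^bsub>N\<^esub> \<longrightarrow>
        (\<exists>g\<in>tuples m N. \<forall>v<n. s' \<odot>\<^bsub>N\<^esub> x v = lsum N m (\<lambda>w. l' w v) g)"
    using single[OF d] unfolding S_solvable_def by auto
  have sR: "s \<in> carrier R" "s' \<in> carrier R" using s s' submonoid.subset[OF S] by auto
  \<comment> \<open>The old solutions, combined with coefficients that solve \<open>d\<close>, solve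
    the enlarged system.\<close>
  define L where "L w j = lsum ?R n (l' w) (\<lambda>v. l v j)" for w j
  have l'R: "l' w \<in> tuples n R" if "w < m" for w using l' that by blast
  have lj: "(\<lambda>v. l v j) \<in> tuples n R" if "j < q" for j using lR that by auto
  have L: "L w \<in> tuples q R" if w: "w < m" for w
  proof
    fix j assume "j \<in> {..<q}"
    then have "lsum ?R n (l' w) (\<lambda>v. l v j) \<in> carrier ?R"
      using lj by (intro lsum_closed[OF RM l'R[OF w]]) auto
    then show "L w j \<in> carrier R" by (simp add: L_def)
  qed
  have L_sum: "lsum ?R q (L w) a' = lsum ?R n (l' w) (\<lambda>v. lsum ?R q (l v) a')"
    if w: "w < m" and a': "a' \<in> tuples q R" for w a'
    unfolding L_def using a' by (intro lsum_assoc[OF RM l'R[OF w] lR, symmetric]) simp_all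
  have rel: "lsum ?R q (L w) a' = \<zero>\<^bsub>R\<^esub>" if w: "w < m" and a': "a' \<in> insert a A" for w a'
  proof -
    have a'R: "a' \<in> tuples q R" using a' a A by blast
    show ?thesis
    proof (cases "a' = a")
      case True
      then show ?thesis unfolding L_sum[OF w a'R] using l' w by (simp add: d_def[abs_def])
    next
      case False
      then have "a' \<in> A" using a' by blast
      then have 0: "lsum ?R q (l v) a' = \<zero>\<^bsub>R\<^esub>" if "v < n" for v using l that by blast
      have "lsum ?R n (l' w) (\<lambda>v. lsum ?R q (l v) a') = lsum ?R n (l' w) (\<lambda>_. \<zero>\<^bsub>R\<^esub>)"
        by (rule lsum_cong[OF RM l'R[OF w]]) (use 0 in auto)
      also have "\<dots> = lsum ?R n (\<lambda>_. \<zero>\<^bsub>R\<^esub>) (l' w)"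
        by (rule lsum_regular_comm[OF R l'R[OF w]]) simp
      also have "\<dots> = \<zero>\<^bsub>R\<^esub>" using lsum_zero_coeff[OF RM, of "l' w" n] l'R[OF w] by simp
      finally show ?thesis unfolding L_sum[OF w a'R] .
    qed
  qed
  have "\<exists>h\<in>tuples m N. \<forall>j<q. (s' \<otimes>\<^bsub>R\<^esub> s) \<odot>\<^bsub>N\<^esub> x j = lsum N m (\<lambda>w. L w j) h"
    if x: "x \<in> tuples q N" and ax: "\<forall>a\<in>insert a A. lsum N q a x = \<zero>\<^bsub>N\<^esub>" for x
  proof -
    obtain g where g: "g \<in> tuples n N"
      and sx: "\<forall>j<q. s \<odot>\<^bsub>N\<^esub> x j = lsum N n (\<lambda>v. l v j) g"
      using gen x ax by blast
    \<comment> \<open>\<open>g\<close> solves \<open>d\<close> because \<open>s\<close> times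
      \<open>x\<close> solves the new row.\<close>
    have "lsum N n d g = lsum N n (\<lambda>v. lsum ?R q a (l v)) g"
      by (rule lsum_cong[OF N d g]) (use lsum_regular_comm[OF R lR a] in \<open>auto simp: d_def\<close>)
    also have "\<dots> = lsum N q a (\<lambda>j. lsum N n (\<lambda>v. l v j) g)"
      by (rule lsum_assoc[OF N a lj g, symmetric])
    also have "\<dots> = lsum N q a (\<lambda>j. s \<odot>\<^bsub>N\<^esub> x j)"
      by (rule lsum_cong[OF N a]) (use sx lsum_closed[OF N lj g] in auto)
    also have "\<dots> = s \<odot>\<^bsub>N\<^esub> lsum N q a x" by (rule lsum_scale[OF N a x sR(1)])
    also have "\<dots> = \<zero>\<^bsub>N\<^esub>" using ax sR(1) by simp
    finally have "lsum N n d g = \<zero>\<^bsub>N\<^esub>" .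
    then obtain h where h: "h \<in> tuples m N"
      and sg: "\<forall>v<n. s' \<odot>\<^bsub>N\<^esub> g v = lsum N m (\<lambda>w. l' w v) h"
      using gen' g by blast
    have l'v: "(\<lambda>w. l' w v) \<in> tuples m R" if "v < n" for v using l'R that by auto
    have "(s' \<otimes>\<^bsub>R\<^esub> s) \<odot>\<^bsub>N\<^esub> x j = lsum N m (\<lambda>w. L w j) h" if j: "j < q" for j
    proof -
      have xj: "x j \<in> carrier N" using x j by auto
      have "(s' \<otimes>\<^bsub>R\<^esub> s) \<odot>\<^bsub>N\<^esub> x j = s' \<odot>\<^bsub>N\<^esub> lsum N n (\<lambda>v. l v j) g"
        using sx j sR xj by (simp add: N.smult_assoc1)
      also have "\<dots> = lsum N n (\<lambda>v. l v j) (\<lambda>v. s' \<odot>\<^bsub>N\<^esub> g v)"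
        by (rule lsum_scale[OF N lj[OF j] g sR(2), symmetric])
      also have "\<dots> = lsum N n (\<lambda>v. l v j) (\<lambda>v. lsum N m (\<lambda>w. l' w v) h)"
        by (rule lsum_cong[OF N lj[OF j]]) (use sg g sR lsum_closed[OF N l'v h] in auto)
      also have "\<dots> = lsum N m (\<lambda>w. lsum ?R n (\<lambda>v. l v j) (\<lambda>v. l' w v)) h"
        by (rule lsum_assoc[OF N lj[OF j] l'v h])
      also have "\<dots> = lsum N m (\<lambda>w. L w j) h"
      proof (rule lsum_cong[OF N _ h])
        have eq: "lsum ?R n (\<lambda>v. l v j) (l' w) = L w j" if "w < m" for w
          unfolding L_def by (rule lsum_regular_comm[OF R lj[OF j] l'R[OF that]])
        then show "\<And>w. w < m \<Longrightarrow> lsum ?R n (\<lambda>v. l v j) (\<lambda>v. l' w v) = L w j" by simp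
        show "(\<lambda>w. lsum ?R n (\<lambda>v. l v j) (\<lambda>v. l' w v)) \<in> tuples m R"
          using eq L j by (auto simp: Pi_iff)
      qed simp
      finally show ?thesis .
    qed
    with h show ?thesis by blast
  qed
  moreover have "s' \<otimes>\<^bsub>R\<^esub> s \<in> S" using submonoid.m_closed[OF S s' s] .
  ultimately show ?case
    unfolding S_solvable_def using L rel
    by (intro bexI[of _ "s' \<otimes>\<^bsub>R\<^esub> s"] exI[of _ m] exI[of _ L]) auto
qed

section \<open>Comparison of resolutions\<close>

context tor_resolution
begin

lemma d0_d1: "w \<in> carrier P1 \<Longrightarrow> d0 (d1 w) = \<zero>\<^bsub>M\<^esub>"
proof (rule free_module_hom_ext[OF M_module mhom_comp[OF d1_mhom d0_mhom]
      mhom_const_zero[OF M_module]])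
  fix z assume z: "z \<in> Z0"
  then show "d0 (d1 (e1 z)) = \<zero>\<^bsub>M\<^esub>"
    unfolding d1_gen[OF z] by (simp add: a_kernel_def' del: free_module_simps)
qed

lemma Z0_iff: "z \<in> Z0 \<longleftrightarrow> z \<in> carrier P0 \<and> d0 z = \<zero>\<^bsub>M\<^esub>"
  by (simp add: a_kernel_def' del: free_module_simps)

lemma Z1_iff: "w \<in> Z1 \<longleftrightarrow> w \<in> carrier P1 \<and> d1 w = \<zero>\<^bsub>P0\<^esub>"
  by (simp add: a_kernel_def' del: free_module_simps)

lemma e0_closed: "x \<in> carrier M \<Longrightarrow> e0 x \<in> carrier P0"
  by (rule free_gen_closed[OF R_cring])

lemma e1_closed: "z \<in> Z0 \<Longrightarrow> e1 z \<in> carrier P1"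
  by (rule free_gen_closed[OF R_cring])

text \<open>Exchanging the sums leaves, for each \<open>v\<close>, the element
  \<open>lsum P1 q (l v) E\<close> of \<open>Z1\<close> tensored with \<open>g v\<close>, and this
  is a boundary by \<open>pure_boundary\<close>.\<close>

lemma boundary_of_relations:
  assumes E: "E \<in> tuples q P1" and l: "\<And>v. v < n \<Longrightarrow> l v \<in> tuples q R"
    and rel: "\<And>v. v < n \<Longrightarrow> lsum P1 q (l v) E \<in> Z1"
    and g: "g \<in> tuples n N"
  shows "(\<Oplus>\<^bsub>C1\<^esub>j\<in>{..<q}. T1.pure (E j) (lsum N n (\<lambda>v. l v j) g)) \<in> boundaries"
proof -
  interpret C1: module R C1 by (rule T1.tensor_module)
  have E': "E j \<in> carrier P1" if "j < q" for j using E that by auto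
  have g': "g v \<in> carrier N" if "v < n" for v using g that by auto
  have l': "l v j \<in> carrier R" if "v < n" "j < q" for v j using l[OF that(1)] that(2) by auto
  have cl: "l v j \<odot>\<^bsub>C1\<^esub> T1.pure (E j) (g v) \<in> carrier C1" if "v < n" "j < q" for v j
    by (intro C1.smult_closed T1.pure_closed E' g' l' that)
  have "(\<Oplus>\<^bsub>C1\<^esub>j\<in>{..<q}. T1.pure (E j) (lsum N n (\<lambda>v. l v j) g))
      = (\<Oplus>\<^bsub>C1\<^esub>j\<in>{..<q}. \<Oplus>\<^bsub>C1\<^esub>v\<in>{..<n}. l v j \<odot>\<^bsub>C1\<^esub> T1.pure (E j) (g v))"
  proof (rule C1.finsum_cong'[OF refl], rule Pi_I)
    fix j assume "j \<in> {..<q}"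
    then have j: "j < q" by simp
    show "(\<Oplus>\<^bsub>C1\<^esub>v\<in>{..<n}. l v j \<odot>\<^bsub>C1\<^esub> T1.pure (E j) (g v)) \<in> carrier C1"
      using cl j by (intro C1.finsum_closed Pi_I) simp
    have "(\<lambda>v. l v j) \<in> tuples n R" using l' j by simp
    from mhom_lsum[OF N_module T1.tensor_module T1.pure_right[OF E'[OF j]] this g]
    show "T1.pure (E j) (lsum N n (\<lambda>v. l v j) g) = (\<Oplus>\<^bsub>C1\<^esub>v\<in>{..<n}. l v j \<odot>\<^bsub>C1\<^esub> T1.pure (E j) (g v))"
      by (simp only: lsum_def)
  qed
  also have "\<dots> = (\<Oplus>\<^bsub>C1\<^esub>v\<in>{..<n}. \<Oplus>\<^bsub>C1\<^esub>j\<in>{..<q}. l v j \<odot>\<^bsub>C1\<^esub> T1.pure (E j) (g v))"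
    using cl by (intro finsum_swap[OF T1.tensor_module]) simp_all
  also have "\<dots> \<in> boundaries"
  proof (rule submod_finsum[OF boundaries_submod], rule Pi_I)
    fix v assume "v \<in> {..<n}"
    then have v: "v < n" by simp
    have "T1.pure (lsum P1 q (l v) E) (g v) = (\<Oplus>\<^bsub>C1\<^esub>j\<in>{..<q}. l v j \<odot>\<^bsub>C1\<^esub> T1.pure (E j) (g v))"
      using mhom_lsum[OF P1_module T1.tensor_module T1.pure_left[OF g'[OF v]] l[OF v] E]
      by (simp only: lsum_def)
    then show "(\<Oplus>\<^bsub>C1\<^esub>j\<in>{..<q}. l v j \<odot>\<^bsub>C1\<^esub> T1.pure (E j) (g v)) \<in> boundaries"
      using pure_boundary[OF rel[OF v] g'[OF v]] by (simp only:)
  qed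
  finally show ?thesis .
qed

text \<open>The resolution is compared with a finite presentation \<open>p : F \<rightarrow> M\<close> through chain maps \<open>\<psi>\<close>,
  \<open>\<theta>\<close> and the homotopy \<open>H\<close>, which satisfies \<open>d1 H = 1 - \<theta> \<psi>\<close>. Modulo boundaries, every cycle of
  \<open>P1 \<otimes> N\<close> thus becomes a combination of the finitely many cycles \<open>\<theta> (k j)\<close>, where the \<open>k j\<close>
  generate the kernel of \<open>p\<close>.\<close>

lemma Tor1_annihilated:
  assumes S: "submonoid S R" and fp: "finitely_presented R M"
    and solvable: "\<And>q A. finite A \<Longrightarrow> A \<subseteq> tuples q R \<Longrightarrow> S_solvable R S N q A"
  shows "\<exists>s\<in>S. \<forall>t\<in>carrier (Tor1 R M N). s \<odot>\<^bsub>Tor1 R M N\<^esub> t = \<zero>\<^bsub>Tor1 R M N\<^esub>"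
proof -
  obtain K F :: "('r, nat \<Rightarrow> 'r) module" and i p where se: "short_exact R K F M i p"
    and fgK: "finitely_generated R K" and free: "fg_free R F"
    using fp unfolding finitely_presented_def by blast
  have K: "module R K" and F: "module R F" and i: "i \<in> mhom R K F" and p: "p \<in> mhom R F M"
    and ker: "i ` carrier K = a_kernel F M p" and surj: "p ` carrier F = carrier M"
    using se by (simp_all add: short_exact_def)
  let ?R = "regular_module R"
  have RM: "module R ?R" by (rule regular_module[OF R_cring])
  interpret M: module R M by (rule M_module)
  interpret F: module R F by (rule F)
  interpret P0: module R P0 by (rule P0_module)
  interpret P1: module R P1 by (rule P1_module)
  interpret N: module R N by (rule N_module)
  interpret C1: module R C1 by (rule T1.tensor_module)
  obtain q k0 where k0: "k0 \<in> tuples q K"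
    and k0_gen: "\<forall>x\<in>carrier K. \<exists>c\<in>tuples q R. x = lsum K q c k0"
    by (rule finitely_generatedE[OF K fgK])
  obtain m b \<kappa> where b: "b \<in> tuples m F" and \<kappa>: "\<forall>i<m. (\<lambda>f. \<kappa> f i) \<in> mhom R F ?R"
    and \<kappa>_exp: "\<forall>f\<in>carrier F. f = lsum F m (\<kappa> f) b"
    by (rule fg_free_coordinates[OF free])
  have \<kappa>R: "\<kappa> f \<in> tuples m R" if "f \<in> carrier F" for f
    using mhom_closed[OF \<kappa>[rule_format] that] by auto
  define k where "k j = i (k0 j)" for j
  have k: "k \<in> tuples q F"
    using k0 mhom_closed[OF i] by (auto simp: k_def Pi_iff)
  have k': "k j \<in> carrier F" if "j < q" for j using k that by auto
  have pk: "p (k j) = \<zero>\<^bsub>M\<^esub>" if "j < q" for j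
  proof -
    have "k j \<in> i ` carrier K" using k0 that by (auto simp: k_def)
    then show ?thesis unfolding ker by (simp add: a_kernel_def')
  qed
  have k_gen: "\<exists>c\<in>tuples q R. f = lsum F q c k" if f: "f \<in> carrier F" "p f = \<zero>\<^bsub>M\<^esub>" for f
  proof -
    have "f \<in> i ` carrier K" unfolding ker using f by (simp add: a_kernel_def')
    then obtain x where x: "x \<in> carrier K" "f = i x" by blast
    obtain c where c: "c \<in> tuples q R" "x = lsum K q c k0" using k0_gen x(1) by blast
    have "f = lsum F q c k"
      unfolding x(2) c(2) k_def by (rule mhom_lsum[OF K F i c(1) k0])
    with c(1) show ?thesis by blast
  qed
  define sec where "sec = inv_into (carrier F) p"
  have sec: "sec x \<in> carrier F" "p (sec x) = x" if "x \<in> carrier M" for x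
    using that unfolding sec_def surj[symmetric] by (rule inv_into_into, rule f_inv_into_f)
  \<comment> \<open>\<open>\<psi>\<close> lifts \<open>d0\<close> through \<open>p\<close>, and
    \<open>\<theta>\<close> below lifts \<open>p\<close> through \<open>d0\<close>; the former is
    prescribed on the free generators, the latter by coordinates.\<close>
  define \<psi> where "\<psi> = free_lift R (carrier M) F sec"
  have \<psi>: "\<psi> \<in> mhom R P0 F" unfolding \<psi>_def using sec(1) by (intro free_lift_mhom[OF F] Pi_I)
  have \<psi>_gen: "\<psi> (e0 x) = sec x" if "x \<in> carrier M" for x
    unfolding \<psi>_def by (rule free_lift_gen[OF F that]) (rule sec(1)[OF that])
  have p\<psi>: "p (\<psi> \<phi>) = d0 \<phi>" if "\<phi> \<in> carrier P0" for \<phi>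
    by (rule free_module_hom_ext[OF M_module mhom_comp[OF \<psi> p] d0_mhom _ that])
      (simp add: \<psi>_gen sec(2) d0_gen)
  define \<theta> where "\<theta> f = lsum P0 m (\<kappa> f) (\<lambda>v. e0 (p (b v)))" for f
  have pb: "p (b v) \<in> carrier M" if "v < m" for v using mhom_closed[OF p] b that by auto
  have e0pb: "(\<lambda>v. e0 (p (b v))) \<in> tuples m P0"
    using e0_closed[OF pb] by (intro Pi_I) simp
  have \<theta>: "\<theta> \<in> mhom R F P0"
    unfolding \<theta>_def lsum_def
  proof (rule mhom_sum[OF P0_module])
    fix v assume "v \<in> {..<m}"
    then have v: "v < m" by simp
    show "(\<lambda>f. \<kappa> f v \<odot>\<^bsub>P0\<^esub> e0 (p (b v))) \<in> mhom R F P0"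
      using mhom_comp[OF \<kappa>[rule_format, OF v]
          bilinear_mapD(1)[OF bilinear_map_smult[OF P0_module] e0_closed[OF pb[OF v]]]] .
  qed
  have d0\<theta>: "d0 (\<theta> f) = p f" if f: "f \<in> carrier F" for f
  proof -
    have "d0 (\<theta> f) = lsum M m (\<kappa> f) (\<lambda>v. d0 (e0 (p (b v))))"
      unfolding \<theta>_def by (rule mhom_lsum[OF P0_module M_module d0_mhom \<kappa>R[OF f] e0pb])
    also have "\<dots> = lsum M m (\<kappa> f) (\<lambda>v. p (b v))"
      by (rule lsum_cong[OF M_module \<kappa>R[OF f]]) (use pb in \<open>auto simp: d0_gen\<close>)
    also have "\<dots> = p (lsum F m (\<kappa> f) b)" by (rule mhom_lsum[OF F M_module p \<kappa>R[OF f] b, symmetric])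
    also have "\<dots> = p f" using \<kappa>_exp f by simp
    finally show ?thesis .
  qed
  \<comment> \<open>\<open>h x\<close> is the deviation of \<open>\<theta> \<psi>\<close> from the
    identity on a generator. It lies in \<open>Z0\<close>, so its own basis element of
    \<open>P1\<close> is a preimage under \<open>d1\<close>; this provides the homotopy.\<close>
  define h where "h x = e0 x \<ominus>\<^bsub>P0\<^esub> \<theta> (sec x)" for x
  have \<theta>sec: "\<theta> (sec x) \<in> carrier P0" if "x \<in> carrier M" for x
    by (rule mhom_closed[OF \<theta> sec(1)[OF that]])
  have h: "h x \<in> Z0" if x: "x \<in> carrier M" for x
    unfolding Z0_iff h_def mhom_minus[OF P0_module M_module d0_mhom e0_closed[OF x] \<theta>sec[OF x]]
      d0\<theta>[OF sec(1)[OF x]] sec(2)[OF x] d0_gen[OF x]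
    using x P0.M.minus_closed[OF e0_closed[OF x] \<theta>sec[OF x]] by (simp del: free_module_simps)
  define H where "H = free_lift R (carrier M) P1 (\<lambda>x. e1 (h x))"
  have H: "H \<in> mhom R P0 P1"
    unfolding H_def using e1_closed[OF h] by (intro free_lift_mhom[OF P1_module] Pi_I)
  have H_gen: "H (e0 x) = e1 (h x)" if "x \<in> carrier M" for x
    unfolding H_def by (rule free_lift_gen[OF P1_module that]) (rule e1_closed[OF h[OF that]])
  have d1H: "d1 (H \<phi>) = \<phi> \<ominus>\<^bsub>P0\<^esub> \<theta> (\<psi> \<phi>)" if "\<phi> \<in> carrier P0" for \<phi>
  proof (rule free_module_hom_ext[OF P0_module mhom_comp[OF H d1_mhom]
        mhom_diff[OF P0_module mhom_id mhom_comp[OF \<psi> \<theta>]] _ that])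
    fix x assume x: "x \<in> carrier M"
    show "d1 (H (e0 x)) = e0 x \<ominus>\<^bsub>P0\<^esub> \<theta> (\<psi> (e0 x))"
      unfolding H_gen[OF x] d1_gen[OF h[OF x]] \<psi>_gen[OF x] by (rule h_def)
  qed
  have "\<forall>z\<in>Z0. \<exists>c. c \<in> tuples q R \<and> \<psi> z = lsum F q c k"
  proof
    fix z assume "z \<in> Z0"
    then have z: "z \<in> carrier P0" "d0 z = \<zero>\<^bsub>M\<^esub>" unfolding Z0_iff by simp_all
    have "p (\<psi> z) = \<zero>\<^bsub>M\<^esub>" unfolding p\<psi>[OF z(1)] by (rule z(2))
    then show "\<exists>c. c \<in> tuples q R \<and> \<psi> z = lsum F q c k"
      using k_gen[OF mhom_closed[OF \<psi> z(1)]] by blast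
  qed
  from bchoice[OF this] obtain c
    where c: "\<forall>z\<in>Z0. c z \<in> tuples q R \<and> \<psi> z = lsum F q (c z) k" ..
  \<comment> \<open>The coefficients are chosen on basis elements only and then extended linearly,
    so that \<open>C\<close> is a linear lift of \<open>\<psi> d1\<close> along the generators
    \<open>k j\<close> of the kernel of \<open>p\<close>.\<close>
  define C where "C w j = free_lift R Z0 ?R (\<lambda>z. c z j) w" for w j
  have cR: "(\<lambda>z. c z j) \<in> Z0 \<rightarrow> carrier ?R" if "j < q" for j
    using c that by (auto simp: Pi_iff)
  have C: "(\<lambda>w. C w j) \<in> mhom R P1 ?R" if "j < q" for j
    unfolding C_def by (rule free_lift_mhom[OF RM cR[OF that]])
  have CR: "C w \<in> tuples q R" if "w \<in> carrier P1" for w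
    using mhom_closed[OF C that] by (auto simp: Pi_iff)
  have C_gen: "C (e1 z) j = c z j" if "z \<in> Z0" "j < q" for z j
    unfolding C_def using cR[OF that(2)] that(1) by (intro free_lift_gen[OF RM that(1)]) auto
  have C_sum: "lsum F q (C w) k = \<psi> (d1 w)" if "w \<in> carrier P1" for w
  proof (rule free_module_hom_ext[OF F _ mhom_comp[OF d1_mhom \<psi>] _ that])
    show "(\<lambda>w. lsum F q (C w) k) \<in> mhom R P1 F"
      unfolding lsum_def
    proof (rule mhom_sum[OF F])
      fix j assume "j \<in> {..<q}"
      then have j: "j < q" by simp
      show "(\<lambda>w. C w j \<odot>\<^bsub>F\<^esub> k j) \<in> mhom R P1 F"
        using mhom_comp[OF C[OF j] bilinear_mapD(1)[OF bilinear_map_smult[OF F] k'[OF j]]] .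
    qed
    fix z assume z: "z \<in> Z0"
    have "lsum F q (C (e1 z)) k = lsum F q (c z) k"
      by (rule lsum_cong[OF F CR[OF e1_closed[OF z]] k]) (simp_all add: C_gen[OF z])
    then show "lsum F q (C (e1 z)) k = \<psi> (d1 (e1 z))"
      unfolding d1_gen[OF z] using c z by simp
  qed
  \<comment> \<open>Sending the unit vectors of R^q to the \<open>E j\<close> continues
    \<open>\<theta>\<close> to degree one, as \<open>C\<close> continues
    \<open>\<psi>\<close>.\<close>
  define E where "E j = e1 (\<theta> (k j))" for j
  have \<theta>k: "\<theta> (k j) \<in> Z0" if "j < q" for j
    unfolding Z0_iff d0\<theta>[OF k'[OF that]] pk[OF that] using mhom_closed[OF \<theta> k'[OF that]] by simp
  have E: "E \<in> tuples q P1"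
    using e1_closed[OF \<theta>k] unfolding E_def by (intro Pi_I) simp
  have E': "E j \<in> carrier P1" if "j < q" for j using E that by auto
  have d1E: "d1 (lsum P1 q r E) = \<theta> (lsum F q r k)" if r: "r \<in> tuples q R" for r
  proof -
    have "d1 (lsum P1 q r E) = lsum P0 q r (\<lambda>j. d1 (E j))"
      by (rule mhom_lsum[OF P1_module P0_module d1_mhom r E])
    also have "\<dots> = lsum P0 q r (\<lambda>j. \<theta> (k j))"
    proof (rule lsum_cong[OF P0_module r])
      show "(\<lambda>j. d1 (E j)) \<in> tuples q P0"
        using mhom_closed[OF d1_mhom E'] by (intro Pi_I) simp
      show "d1 (E j) = \<theta> (k j)" if "j < q" for j
        unfolding E_def by (rule d1_gen[OF \<theta>k[OF that]])
    qed simp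
    also have "\<dots> = \<theta> (lsum F q r k)" by (rule mhom_lsum[OF F P0_module \<theta> r k, symmetric])
    finally show ?thesis .
  qed
  \<comment> \<open>\<open>\<Lambda> w\<close> is what the homotopy leaves over in degree one;
    \<open>d1\<close> kills it, so tensoring it with an element of \<open>N\<close> gives a
    boundary.\<close>
  define \<Lambda> where "\<Lambda> w = w \<ominus>\<^bsub>P1\<^esub> lsum P1 q (C w) E \<ominus>\<^bsub>P1\<^esub> H (d1 w)" for w
  have \<Lambda>: "\<Lambda> w \<in> Z1" if w: "w \<in> carrier P1" for w
  proof -
    have 1: "lsum P1 q (C w) E \<in> carrier P1" by (rule lsum_closed[OF P1_module CR[OF w] E])
    have 2: "w \<ominus>\<^bsub>P1\<^esub> lsum P1 q (C w) E \<in> carrier P1" by (rule P1.M.minus_closed[OF w 1])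
    have 3: "d1 w \<in> carrier P0" by (rule mhom_closed[OF d1_mhom w])
    have 4: "H (d1 w) \<in> carrier P1" by (rule mhom_closed[OF H 3])
    have 5: "\<theta> (\<psi> (d1 w)) \<in> carrier P0" by (rule mhom_closed[OF \<theta> mhom_closed[OF \<psi> 3]])
    have "d1 (\<Lambda> w) = d1 w \<ominus>\<^bsub>P0\<^esub> \<theta> (\<psi> (d1 w)) \<ominus>\<^bsub>P0\<^esub> (d1 w \<ominus>\<^bsub>P0\<^esub> \<theta> (\<psi> (d1 w)))"
      unfolding \<Lambda>_def mhom_minus[OF P1_module P0_module d1_mhom 2 4]
        mhom_minus[OF P1_module P0_module d1_mhom w 1] d1H[OF 3] d1E[OF CR[OF w]] C_sum[OF w] ..
    also have "\<dots> = \<zero>\<^bsub>P0\<^esub>"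
      unfolding a_minus_def[of P0 "d1 w \<ominus>\<^bsub>P0\<^esub> \<theta> (\<psi> (d1 w))"] by (rule P0.M.r_neg[OF P0.M.minus_closed[OF 3 5]])
    finally show ?thesis unfolding Z1_iff \<Lambda>_def using P1.M.minus_closed[OF 2 4] by simp
  qed
  let ?\<beta> = "\<lambda>j w y. C w j \<odot>\<^bsub>N\<^esub> y"
  have \<beta>: "bilinear_map R P1 N N (?\<beta> j)" if "j < q" for j
    by (rule bilinear_map_comp[OF bilinear_map_smult[OF N_module] C[OF that]])
  \<comment> \<open>The map induced by the coordinate \<open>j\<close> of \<open>C\<close>. The
    tuple of the \<open>U j t\<close> is the solution in \<open>N\<close> attached to
    \<open>t\<close>.\<close>
  define U where "U j = tensor_lift R P1 N N (?\<beta> j)" for j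
  have U: "U j \<in> mhom R C1 N" if "j < q" for j
    unfolding U_def by (rule T1.tensor_lift_mhom[OF N_module \<beta>[OF that]])
  have U_pure: "U j (T1.pure w y) = C w j \<odot>\<^bsub>N\<^esub> y"
    if "j < q" "w \<in> carrier P1" "y \<in> carrier N" for j w y
    unfolding U_def by (rule T1.tensor_lift_pure[OF N_module \<beta>[OF that(1)] that(2,3)])
  let ?H = "tensor_map R P0 P1 N H"
  note HN = tensor_map_mhom[OF P0_module P1_module N_module H]
  define \<Phi> where "\<Phi> t = (\<Oplus>\<^bsub>C1\<^esub>j\<in>{..<q}. T1.pure (E j) (U j t))" for t
  have \<Phi>: "\<Phi> \<in> mhom R C1 C1"
    unfolding \<Phi>_def
  proof (rule mhom_sum[OF T1.tensor_module])
    fix j assume "j \<in> {..<q}"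
    then have j: "j < q" by simp
    show "(\<lambda>t. T1.pure (E j) (U j t)) \<in> mhom R C1 C1"
      by (rule mhom_comp[OF U[OF j] T1.pure_right[OF E'[OF j]]])
  qed
  \<comment> \<open>On a pure tensor of \<open>w\<close> and \<open>y\<close> the expression is
    \<open>\<Lambda> w\<close> tensored with \<open>y\<close>.\<close>
  have \<Psi>: "t \<ominus>\<^bsub>C1\<^esub> \<Phi> t \<ominus>\<^bsub>C1\<^esub> ?H (\<delta>1 t) \<in> boundaries" if t: "t \<in> carrier C1" for t
  proof (rule T1.tensor_map_to_submod[OF T1.tensor_module mhom_diff[OF T1.tensor_module
          mhom_diff[OF T1.tensor_module mhom_id \<Phi>] mhom_comp[OF \<delta>1_mhom HN(1)]]
        boundaries_submod _ t])
    fix w y assume w: "w \<in> carrier P1" and y: "y \<in> carrier N"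
    have 1: "lsum P1 q (C w) E \<in> carrier P1" by (rule lsum_closed[OF P1_module CR[OF w] E])
    have 2: "w \<ominus>\<^bsub>P1\<^esub> lsum P1 q (C w) E \<in> carrier P1" by (rule P1.M.minus_closed[OF w 1])
    have 3: "d1 w \<in> carrier P0" by (rule mhom_closed[OF d1_mhom w])
    have 4: "H (d1 w) \<in> carrier P1" by (rule mhom_closed[OF H 3])
    note L = T1.pure_left[OF y]
    have "\<Phi> (T1.pure w y) = (\<Oplus>\<^bsub>C1\<^esub>j\<in>{..<q}. C w j \<odot>\<^bsub>C1\<^esub> T1.pure (E j) y)"
      unfolding \<Phi>_def
    proof (rule C1.finsum_cong'[OF refl], rule Pi_I)
      fix j assume "j \<in> {..<q}"
      then have j: "j < q" by simp
      have Cw: "C w j \<in> carrier R" using CR[OF w] j by auto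
      show "C w j \<odot>\<^bsub>C1\<^esub> T1.pure (E j) y \<in> carrier C1"
        by (rule C1.smult_closed[OF Cw T1.pure_closed[OF E'[OF j] y]])
      show "T1.pure (E j) (U j (T1.pure w y)) = C w j \<odot>\<^bsub>C1\<^esub> T1.pure (E j) y"
        unfolding U_pure[OF j w y] by (rule mhom_smult[OF T1.pure_right[OF E'[OF j]] Cw y])
    qed
    also have "\<dots> = T1.pure (lsum P1 q (C w) E) y"
      using mhom_lsum[OF P1_module T1.tensor_module L CR[OF w] E] by (simp only: lsum_def)
    finally have \<Phi>_pure: "\<Phi> (T1.pure w y) = T1.pure (lsum P1 q (C w) E) y" .
    have "T1.pure w y \<ominus>\<^bsub>C1\<^esub> \<Phi> (T1.pure w y) \<ominus>\<^bsub>C1\<^esub> ?H (\<delta>1 (T1.pure w y)) = T1.pure (\<Lambda> w) y"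
      unfolding \<Lambda>_def \<Phi>_pure \<delta>1_pure[OF w y] HN(2)[OF 3 y]
        mhom_minus[OF P1_module T1.tensor_module L 2 4]
        mhom_minus[OF P1_module T1.tensor_module L w 1] ..
    then show "T1.pure w y \<ominus>\<^bsub>C1\<^esub> \<Phi> (T1.pure w y) \<ominus>\<^bsub>C1\<^esub> ?H (\<delta>1 (T1.pure w y)) \<in> boundaries"
      using pure_boundary[OF \<Lambda>[OF w] y] by (simp only:)
  qed
  \<comment> \<open>The rows express the \<open>k j\<close> in the coordinates of \<open>F\<close>.
    They come from the presentation of \<open>M\<close> alone, so the \<open>s\<close> obtained for
    them serves all cycles \<open>t\<close>.\<close>
  define row where "row v j = \<kappa> (k j) v" for v j
  have row: "row v \<in> tuples q R" if "v < m" for v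
    using \<kappa>R[OF k'] that by (auto simp: row_def Pi_iff)
  \<comment> \<open>Since \<open>C\<close> lifts \<open>\<psi> d1\<close>, the left side depends on
    \<open>\<delta>1 t\<close> only; hence cycles give solutions.\<close>
  have equations: "lsum N q (row v) (\<lambda>j. U j t) = \<zero>\<^bsub>N\<^esub>"
    if v: "v < m" and t: "t \<in> carrier C1" "\<delta>1 t = \<zero>\<^bsub>C0\<^esub>" for v t
  proof -
    note \<kappa>v = \<kappa>[rule_format, OF v]
    have \<xi>: "bilinear_map R P0 N N (\<lambda>\<phi> y. \<kappa> (\<psi> \<phi>) v \<odot>\<^bsub>N\<^esub> y)"
      by (rule bilinear_map_comp[OF bilinear_map_smult[OF N_module] mhom_comp[OF \<psi> \<kappa>v]])
    let ?X = "tensor_lift R P0 N N (\<lambda>\<phi> y. \<kappa> (\<psi> \<phi>) v \<odot>\<^bsub>N\<^esub> y)"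
    have X: "?X \<in> mhom R C0 N" by (rule T0.tensor_lift_mhom[OF N_module \<xi>])
    have Y: "(\<lambda>t. lsum N q (row v) (\<lambda>j. U j t)) \<in> mhom R C1 N"
      unfolding lsum_def
    proof (rule mhom_sum[OF N_module])
      fix j assume "j \<in> {..<q}"
      then show "(\<lambda>t. row v j \<odot>\<^bsub>N\<^esub> U j t) \<in> mhom R C1 N"
        using row[OF v] by (intro mhom_scale[OF N_module U]) auto
    qed
    have "lsum N q (row v) (\<lambda>j. U j t) = ?X (\<delta>1 t)"
    proof (rule T1.tensor_hom_ext[OF N_module Y mhom_comp[OF \<delta>1_mhom X] _ t(1)])
      fix w y assume w: "w \<in> carrier P1" and y: "y \<in> carrier N"
      have Cw: "C w \<in> tuples q ?R" using CR[OF w] by simp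
      note sy = bilinear_mapD(1)[OF bilinear_map_smult[OF N_module] y]
      have "lsum N q (row v) (\<lambda>j. U j (T1.pure w y)) = lsum N q (row v) (\<lambda>j. C w j \<odot>\<^bsub>N\<^esub> y)"
        using mhom_closed[OF U T1.pure_closed[OF w y]]
        by (intro lsum_cong[OF N_module row[OF v]] Pi_I) (simp_all add: U_pure[OF _ w y])
      also have "\<dots> = lsum ?R q (row v) (C w) \<odot>\<^bsub>N\<^esub> y"
        by (rule mhom_lsum[OF RM N_module sy row[OF v] Cw, symmetric])
      also have "lsum ?R q (row v) (C w) = lsum ?R q (C w) (\<lambda>j. \<kappa> (k j) v)"
        unfolding lsum_regular_comm[OF R_cring row[OF v] CR[OF w]] by (simp add: row_def[abs_def])
      also have "\<dots> = \<kappa> (lsum F q (C w) k) v"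
        by (rule mhom_lsum[OF F RM \<kappa>v CR[OF w] k, symmetric])
      also have "\<dots> \<odot>\<^bsub>N\<^esub> y = ?X (\<delta>1 (T1.pure w y))"
        unfolding C_sum[OF w] \<delta>1_pure[OF w y]
        by (rule T0.tensor_lift_pure[OF N_module \<xi> mhom_closed[OF d1_mhom w] y, symmetric])
      finally show "lsum N q (row v) (\<lambda>j. U j (T1.pure w y)) = ?X (\<delta>1 (T1.pure w y))" .
    qed
    also have "\<dots> = \<zero>\<^bsub>N\<^esub>"
      unfolding t(2) by (rule mhom_zero[OF T0.tensor_module N_module X])
    finally show ?thesis .
  qed
  have "S_solvable R S N q (row ` {..<m})" using row by (intro solvable) auto
  then obtain s n l where s: "s \<in> S"
    and l: "\<forall>v<n. l v \<in> tuples q R \<and> (\<forall>a\<in>row ` {..<m}. lsum ?R q (l v) a = \<zero>\<^bsub>R\<^esub>)"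
    and gen: "\<forall>x\<in>tuples q N. (\<forall>a\<in>row ` {..<m}. lsum N q a x = \<zero>\<^bsub>N\<^esub>) \<longrightarrow>
        (\<exists>g\<in>tuples n N. \<forall>j<q. s \<odot>\<^bsub>N\<^esub> x j = lsum N n (\<lambda>v. l v j) g)"
    unfolding S_solvable_def by blast
  have sR: "s \<in> carrier R" using s submonoid.subset[OF S] by blast
  have lR: "l v \<in> tuples q R" if "v < n" for v using l that by blast
  \<comment> \<open>If \<open>l v\<close> solves all rows, the combination of the \<open>k j\<close>
    with these coefficients has zero coordinates and vanishes in \<open>F\<close>; applying
    \<open>\<theta>\<close> shows that \<open>d1\<close> kills the same combination of the
    \<open>E j\<close>.\<close>
  have rel: "lsum P1 q (l v) E \<in> Z1" if v: "v < n" for v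
  proof -
    have lk: "lsum F q (l v) k \<in> carrier F" by (rule lsum_closed[OF F lR[OF v] k])
    have "\<kappa> (lsum F q (l v) k) u = \<zero>\<^bsub>R\<^esub>" if u: "u < m" for u
    proof -
      have "\<kappa> (lsum F q (l v) k) u = lsum ?R q (l v) (\<lambda>j. \<kappa> (k j) u)"
        by (rule mhom_lsum[OF F RM \<kappa>[rule_format, OF u] lR[OF v] k])
      also have "\<dots> = lsum ?R q (l v) (row u)" by (simp add: row_def[abs_def])
      also have "\<dots> = \<zero>\<^bsub>R\<^esub>" using l v u by blast
      finally show ?thesis .
    qed
    then have "lsum F m (\<kappa> (lsum F q (l v) k)) b = \<zero>\<^bsub>F\<^esub>" by (rule lsum_zero_coeff[OF F b])
    then have "lsum F q (l v) k = \<zero>\<^bsub>F\<^esub>" using \<kappa>_exp lk by metis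
    then have "d1 (lsum P1 q (l v) E) = \<zero>\<^bsub>P0\<^esub>"
      unfolding d1E[OF lR[OF v]] using mhom_zero[OF F P0_module \<theta>] by (simp only:)
    then show ?thesis
      unfolding Z1_iff using lsum_closed[OF P1_module lR[OF v] E] by blast
  qed
  have "s \<odot>\<^bsub>C1\<^esub> t \<in> boundaries" if t: "t \<in> carrier C1" "\<delta>1 t = \<zero>\<^bsub>C0\<^esub>" for t
  proof -
    have Ut: "U j t \<in> carrier N" if "j < q" for j by (rule mhom_closed[OF U[OF that] t(1)])
    have "\<forall>a\<in>row ` {..<m}. lsum N q a (\<lambda>j. U j t) = \<zero>\<^bsub>N\<^esub>" using equations[OF _ t] by blast
    moreover have "(\<lambda>j. U j t) \<in> tuples q N" using Ut by simp
    ultimately obtain g where g: "g \<in> tuples n N"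
      and sU: "\<forall>j<q. s \<odot>\<^bsub>N\<^esub> U j t = lsum N n (\<lambda>v. l v j) g"
      using gen by blast
    have \<Phi>t: "\<Phi> t \<in> carrier C1" by (rule mhom_closed[OF \<Phi> t(1)])
    have "s \<odot>\<^bsub>C1\<^esub> \<Phi> t = (\<Oplus>\<^bsub>C1\<^esub>j\<in>{..<q}. s \<odot>\<^bsub>C1\<^esub> T1.pure (E j) (U j t))"
      unfolding \<Phi>_def using T1.pure_closed[OF E' Ut] by (intro C1.finsum_smult[OF sR] Pi_I) simp
    also have "\<dots> = (\<Oplus>\<^bsub>C1\<^esub>j\<in>{..<q}. T1.pure (E j) (lsum N n (\<lambda>v. l v j) g))"
    proof (rule C1.finsum_cong'[OF refl], rule Pi_I)
      fix j assume "j \<in> {..<q}"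
      then have j: "j < q" by simp
      have sUj: "lsum N n (\<lambda>v. l v j) g = s \<odot>\<^bsub>N\<^esub> U j t" using sU j by simp
      show "T1.pure (E j) (lsum N n (\<lambda>v. l v j) g) \<in> carrier C1"
        unfolding sUj by (rule T1.pure_closed[OF E'[OF j] N.smult_closed[OF sR Ut[OF j]]])
      show "s \<odot>\<^bsub>C1\<^esub> T1.pure (E j) (U j t) = T1.pure (E j) (lsum N n (\<lambda>v. l v j) g)"
        unfolding sUj by (rule mhom_smult[OF T1.pure_right[OF E'[OF j]] sR Ut[OF j], symmetric])
    qed
    also have "\<dots> \<in> boundaries" by (rule boundary_of_relations[OF E lR rel g])
    finally have s\<Phi>: "s \<odot>\<^bsub>C1\<^esub> \<Phi> t \<in> boundaries" .
    have H0: "?H (\<delta>1 t) = \<zero>\<^bsub>C1\<^esub>"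
      unfolding t(2) by (rule mhom_zero[OF T0.tensor_module T1.tensor_module HN(1)])
    have neg0: "\<ominus>\<^bsub>C1\<^esub> \<zero>\<^bsub>C1\<^esub> = \<zero>\<^bsub>C1\<^esub>"
      using C1.M.r_neg[OF C1.M.zero_closed] C1.M.l_zero[OF C1.M.a_inv_closed[OF C1.M.zero_closed]]
      by (simp only:)
    \<comment> \<open>On a cycle the homotopy term is zero, so \<open>t\<close> and
      \<open>\<Phi> t\<close> differ by a boundary.\<close>
    have "t \<ominus>\<^bsub>C1\<^esub> \<Phi> t \<ominus>\<^bsub>C1\<^esub> ?H (\<delta>1 t) = t \<ominus>\<^bsub>C1\<^esub> \<Phi> t"
      unfolding H0 a_minus_def[of C1 "t \<ominus>\<^bsub>C1\<^esub> \<Phi> t"] neg0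
      by (rule C1.M.r_zero[OF C1.M.minus_closed[OF t(1) \<Phi>t]])
    with \<Psi>[OF t(1)] have "t \<ominus>\<^bsub>C1\<^esub> \<Phi> t \<in> boundaries" by (simp only:)
    then have "s \<odot>\<^bsub>C1\<^esub> (t \<ominus>\<^bsub>C1\<^esub> \<Phi> t) \<oplus>\<^bsub>C1\<^esub> s \<odot>\<^bsub>C1\<^esub> \<Phi> t \<in> boundaries"
      by (intro LinearCombinations.submodule.m_closed[OF boundaries_submod] s\<Phi>
          LinearCombinations.submodule.smult_closed[OF boundaries_submod sR])
    moreover have "s \<odot>\<^bsub>C1\<^esub> (t \<ominus>\<^bsub>C1\<^esub> \<Phi> t) \<oplus>\<^bsub>C1\<^esub> s \<odot>\<^bsub>C1\<^esub> \<Phi> t = s \<odot>\<^bsub>C1\<^esub> t"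
    proof -
      have "t \<ominus>\<^bsub>C1\<^esub> \<Phi> t \<oplus>\<^bsub>C1\<^esub> \<Phi> t = t"
        unfolding a_minus_def C1.M.a_assoc[OF t(1) C1.M.a_inv_closed[OF \<Phi>t] \<Phi>t] C1.M.l_neg[OF \<Phi>t]
        by (rule C1.M.r_zero[OF t(1)])
      then show ?thesis
        by (simp only: C1.smult_r_distr[OF sR C1.M.minus_closed[OF t(1) \<Phi>t] \<Phi>t, symmetric])
    qed
    ultimately show ?thesis by (simp only:)
  qed
  with s show ?thesis using Tor1_annihilated_iff[OF sR] by blast
qed

text \<open>The relation \<open>\<Sum> a\<^sub>j x\<^sub>j = 0\<close> gives the cycle
  \<open>\<Sum> a\<^sub>j e \<otimes> x\<^sub>j\<close>, where \<open>e\<close> is the basis element of \<open>P0\<close> at the generator of \<open>M\<close>. A lift of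
  \<open>P0 \<rightarrow> M\<close> to \<open>R\<close> maps \<open>P1 \<otimes> N\<close> to \<open>J \<otimes> N\<close>, killing the boundaries.\<close>

lemma relation_of_annihilated:
  assumes p: "p \<in> mhom R (regular_module R) M" and surj: "p ` carrier R = carrier M"
    and a: "a \<in> tuples q R"
    and ker: "\<And>r. r \<in> carrier R \<Longrightarrow> p r = \<zero>\<^bsub>M\<^esub> \<longleftrightarrow> r \<in> Idl\<^bsub>R\<^esub> (a ` {..<q})"
    and s: "s \<in> carrier R"
    and ann: "\<forall>t\<in>carrier (Tor1 R M N). s \<odot>\<^bsub>Tor1 R M N\<^esub> t = \<zero>\<^bsub>Tor1 R M N\<^esub>"
    and x: "x \<in> tuples q N" and ax: "lsum N q a x = \<zero>\<^bsub>N\<^esub>"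
  obtains n l y where "\<forall>v<n. l v \<in> tuples q R \<and> lsum (regular_module R) q (l v) a = \<zero>\<^bsub>R\<^esub>"
    and "y \<in> tuples n N" and "\<forall>j<q. s \<odot>\<^bsub>N\<^esub> x j = lsum N n (\<lambda>v. l v j) y"
proof -
  let ?R = "regular_module R"
  define J where "J = Idl\<^bsub>R\<^esub> (a ` {..<q})"
  let ?J = "?R\<lparr>carrier := J\<rparr>"
  have RM: "module R ?R" by (rule regular_module[OF R_cring])
  interpret M: module R M by (rule M_module)
  interpret N: module R N by (rule N_module)
  interpret C1: module R C1 by (rule T1.tensor_module)
  interpret P0: module R P0 by (rule P0_module)
  have aR: "a j \<in> carrier R" if "j < q" for j using a that by auto
  have AR: "a ` {..<q} \<subseteq> carrier R" using aR by auto
  have J: "submod R J ?R"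
    unfolding J_def
    by (rule ideal_imp_submod_regular[OF R_cring ring.genideal_ideal[OF cring.axioms(1)[OF R_cring] AR]])
  have aJ: "a j \<in> J" if "j < q" for j
    using ring.genideal_self[OF cring.axioms(1)[OF R_cring] AR] that by (auto simp: J_def)
  have J_sub: "J \<subseteq> carrier R" using submod_subset[OF J] by auto
  have JM: "module R ?J" by (rule submod_module[OF J])
  interpret TJ: tensor_product R ?J N by (intro tensor_product.intro JM N_module)
  interpret CJ: module R TJ.T by (rule TJ.tensor_module)
  define g where "g = p \<one>\<^bsub>R\<^esub>"
  have g: "g \<in> carrier M" unfolding g_def using mhom_closed[OF p, of "\<one>\<^bsub>R\<^esub>"] by simp
  \<comment> \<open>At the generator \<open>g\<close> the preimage is prescribed to be one, so that
    \<open>\<psi>\<close> sends \<open>e0 g\<close> to one; elsewhere any preimage will do.\<close>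
  define \<sigma> where "\<sigma> x = (if x = g then \<one>\<^bsub>R\<^esub> else inv_into (carrier R) p x)" for x
  have \<sigma>: "\<sigma> x \<in> carrier ?R" "p (\<sigma> x) = x" if "x \<in> carrier M" for x
    using that inv_into_into[of x p "carrier R"] f_inv_into_f[of x p "carrier R"]
    unfolding surj by (auto simp: \<sigma>_def g_def)
  define \<psi> where "\<psi> = free_lift R (carrier M) ?R \<sigma>"
  have \<psi>: "\<psi> \<in> mhom R P0 ?R" unfolding \<psi>_def using \<sigma>(1) by (intro free_lift_mhom[OF RM] Pi_I)
  have \<psi>_gen: "\<psi> (e0 x) = \<sigma> x" if "x \<in> carrier M" for x
    unfolding \<psi>_def by (rule free_lift_gen[OF RM that]) (rule \<sigma>(1)[OF that])
  have p\<psi>: "p (\<psi> \<phi>) = d0 \<phi>" if "\<phi> \<in> carrier P0" for \<phi>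
    by (rule free_module_hom_ext[OF M_module mhom_comp[OF \<psi> p] d0_mhom _ that])
      (simp add: \<psi>_gen \<sigma>(2) d0_gen)
  \<comment> \<open>\<open>p\<close> sends \<open>\<psi> (d1 w)\<close> to \<open>d0 (d1 w)\<close>,
    which is zero, so the value lies in the kernel \<open>J\<close> of \<open>p\<close>.\<close>
  have \<epsilon>: "(\<lambda>w. \<psi> (d1 w)) \<in> mhom R P1 ?J"
  proof (rule mhom_restrict[OF mhom_comp[OF d1_mhom \<psi>]])
    show "J \<subseteq> carrier ?R" using J_sub by simp
    fix w assume w: "w \<in> carrier P1"
    have d1w: "d1 w \<in> carrier P0" by (rule mhom_closed[OF d1_mhom w])
    have "p (\<psi> (d1 w)) = \<zero>\<^bsub>M\<^esub>" unfolding p\<psi>[OF d1w] by (rule d0_d1[OF w])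
    moreover have "\<psi> (d1 w) \<in> carrier R" using mhom_closed[OF \<psi> d1w] by simp
    ultimately show "\<psi> (d1 w) \<in> J" unfolding J_def using ker by blast
  qed
  note \<epsilon>N = tensor_map_mhom[OF P1_module JM N_module \<epsilon>]
  let ?\<epsilon> = "tensor_map R P1 ?J N (\<lambda>w. \<psi> (d1 w))"
  have \<epsilon>\<delta>2: "?\<epsilon> (\<delta>2 t) = \<zero>\<^bsub>TJ.T\<^esub>" if "t \<in> carrier C2" for t
  proof (rule T2.tensor_hom_ext[OF TJ.tensor_module mhom_comp[OF \<delta>2_mhom \<epsilon>N(1)]
        mhom_const_zero[OF TJ.tensor_module] _ that])
    fix w y assume w: "w \<in> carrier P2" and y: "y \<in> carrier N"
    have "?\<epsilon> (\<delta>2 (T2.pure w y)) = TJ.pure \<zero>\<^bsub>?J\<^esub> y"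
      unfolding \<delta>2_pure[OF w y] \<epsilon>N(2)[OF mhom_closed[OF d2_mhom w] y] d1_d2[OF w]
        mhom_zero[OF P0_module RM \<psi>] by simp
    also have "\<dots> = \<zero>\<^bsub>TJ.T\<^esub>" by (rule mhom_zero[OF JM TJ.tensor_module TJ.pure_left[OF y]])
    finally show "?\<epsilon> (\<delta>2 (T2.pure w y)) = \<zero>\<^bsub>TJ.T\<^esub>" .
  qed
  \<comment> \<open>\<open>d0\<close> sends \<open>z j\<close> to \<open>a j\<close> times
    \<open>g\<close>, which is zero in \<open>M\<close>, while \<open>\<psi>\<close> recovers
    \<open>a j\<close> from it.\<close>
  define z where "z j = a j \<odot>\<^bsub>P0\<^esub> e0 g" for j
  have z: "z j \<in> Z0" if j: "j < q" for j
  proof -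
    have "d0 (z j) = a j \<odot>\<^bsub>M\<^esub> g"
      unfolding z_def mhom_smult[OF d0_mhom aR[OF j] e0_closed[OF g]] d0_gen[OF g] ..
    also have "\<dots> = p (a j \<otimes>\<^bsub>R\<^esub> \<one>\<^bsub>R\<^esub>)"
      unfolding g_def using mhom_smult[OF p aR[OF j], of "\<one>\<^bsub>R\<^esub>"] by simp
    also have "\<dots> = \<zero>\<^bsub>M\<^esub>" using ker[OF aR[OF j]] aJ[OF j] aR[OF j] by (simp add: J_def)
    finally show ?thesis
      unfolding Z0_iff using P0.smult_closed[OF aR[OF j] e0_closed[OF g]] by (simp only: z_def)
  qed
  have \<psi>z: "\<psi> (z j) = a j" if j: "j < q" for j
    unfolding z_def mhom_smult[OF \<psi> aR[OF j] e0_closed[OF g]] \<psi>_gen[OF g]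
    using aR[OF j] by (simp add: \<sigma>_def)
  have x': "x j \<in> carrier N" if "j < q" for j using x that by auto
  have pe: "T1.pure (e1 (z j)) (x j) \<in> carrier C1" if "j < q" for j
    by (rule T1.pure_closed[OF e1_closed[OF z[OF that]] x'[OF that]])
  define t where "t = (\<Oplus>\<^bsub>C1\<^esub>j\<in>{..<q}. T1.pure (e1 (z j)) (x j))"
  have t: "t \<in> carrier C1" unfolding t_def using pe by (intro C1.finsum_closed Pi_I) simp
  have e1z: "(\<lambda>j. e1 (z j)) \<in> tuples q P1" using e1_closed[OF z] by (intro Pi_I) simp
  have "\<delta>1 t = (\<Oplus>\<^bsub>C0\<^esub>j\<in>{..<q}. T0.pure (d1 (e1 (z j))) (x j))"
    unfolding t_def by (rule tensor_map_sum[OF P1_module P0_module N_module d1_mhom e1z x])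
  also have "\<dots> = (\<Oplus>\<^bsub>C0\<^esub>j\<in>{..<q}. T0.pure (a j \<odot>\<^bsub>P0\<^esub> e0 g) (x j))"
  proof -
    interpret C0: module R C0 by (rule T0.tensor_module)
    show ?thesis
      by (intro C0.finsum_cong' refl Pi_I T0.pure_closed P0.smult_closed e0_closed[OF g] aR x')
        (simp_all only: lessThan_iff trans[OF d1_gen[OF z] z_def])
  qed
  also have "\<dots> = T0.pure (e0 g) (lsum N q a x)" by (rule T0.pure_lsum[OF e0_closed[OF g] a x])
  also have "\<dots> = \<zero>\<^bsub>C0\<^esub>"
    unfolding ax by (rule mhom_zero[OF N_module T0.tensor_module T0.pure_right[OF e0_closed[OF g]]])
  finally have "s \<odot>\<^bsub>C1\<^esub> t \<in> boundaries" using Tor1_annihilated_iff[OF s] ann t by blast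
  \<comment> \<open>The map to J tensor N kills the boundary \<open>s\<close> times
    \<open>t\<close>; computing its value term by term gives the vanishing tensor to which
    \<open>tensor_vanish\<close> applies.\<close>
  then have "\<zero>\<^bsub>TJ.T\<^esub> = ?\<epsilon> (s \<odot>\<^bsub>C1\<^esub> t)" using \<epsilon>\<delta>2 by auto
  also have "\<dots> = s \<odot>\<^bsub>TJ.T\<^esub> ?\<epsilon> t" by (rule mhom_smult[OF \<epsilon>N(1) s t])
  also have "?\<epsilon> t = (\<Oplus>\<^bsub>TJ.T\<^esub>j\<in>{..<q}. TJ.pure (\<psi> (d1 (e1 (z j)))) (x j))"
    unfolding t_def by (rule tensor_map_sum[OF P1_module JM N_module \<epsilon> e1z x])
  also have "\<dots> = (\<Oplus>\<^bsub>TJ.T\<^esub>j\<in>{..<q}. TJ.pure (a j) (x j))"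
    using aJ by (intro CJ.finsum_cong' refl Pi_I TJ.pure_closed x') (simp_all add: d1_gen[OF z] \<psi>z)
  also have "s \<odot>\<^bsub>TJ.T\<^esub> \<dots> = (\<Oplus>\<^bsub>TJ.T\<^esub>j\<in>{..<q}. s \<odot>\<^bsub>TJ.T\<^esub> TJ.pure (a j) (x j))"
    using aJ x' by (intro CJ.finsum_smult[OF s] Pi_I TJ.pure_closed) simp_all
  also have "\<dots> = (\<Oplus>\<^bsub>TJ.T\<^esub>j\<in>{..<q}. TJ.pure (a j) (s \<odot>\<^bsub>N\<^esub> x j))"
  proof (rule CJ.finsum_cong'[OF refl], rule Pi_I)
    fix j assume "j \<in> {..<q}"
    then have j: "j < q" by simp
    have aj: "a j \<in> carrier ?J" using aJ[OF j] by simp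
    show "TJ.pure (a j) (s \<odot>\<^bsub>N\<^esub> x j) \<in> carrier TJ.T"
      by (rule TJ.pure_closed[OF aj N.smult_closed[OF s x'[OF j]]])
    show "s \<odot>\<^bsub>TJ.T\<^esub> TJ.pure (a j) (x j) = TJ.pure (a j) (s \<odot>\<^bsub>N\<^esub> x j)"
      by (rule mhom_smult[OF TJ.pure_right[OF aj] s x'[OF j], symmetric])
  qed
  finally have zero: "(\<Oplus>\<^bsub>TJ.T\<^esub>j\<in>{..<q}. TJ.pure (a j) (s \<odot>\<^bsub>N\<^esub> x j)) = \<zero>\<^bsub>TJ.T\<^esub>" by (rule sym)
  have aJ': "a \<in> tuples q ?J" using aJ by simp
  have incl_sum: "lsum ?J q c a = lsum ?R q c a" if "c \<in> tuples q R" for c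
    using aJ by (intro lsum_submod[OF J that]) simp
  have sx: "(\<lambda>j. s \<odot>\<^bsub>N\<^esub> x j) \<in> tuples q N" using x' s by simp
  have gen: "\<exists>c\<in>tuples q R. r = lsum ?J q c a" if "r \<in> carrier ?J" for r
  proof -
    have "r \<in> J" using that by simp
    then obtain c where c: "c \<in> carrier (power_module q ?R)" "r = lsum ?R q c a"
      unfolding J_def Idl_eq_lsum[OF R_cring a] by blast
    then have "c \<in> tuples q R" by auto
    then show ?thesis using c(2) incl_sum by auto
  qed
  obtain n l y where l: "\<forall>v<n. l v \<in> tuples q R \<and> lsum ?J q (l v) a = \<zero>\<^bsub>?J\<^esub>"
    and y: "y \<in> tuples n N" and xy: "\<forall>j<q. s \<odot>\<^bsub>N\<^esub> x j = lsum N n (\<lambda>v. l v j) y"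
    by (rule tensor_vanish[OF JM N_module aJ' sx gen zero])
  have "\<forall>v<n. l v \<in> tuples q R \<and> lsum ?R q (l v) a = \<zero>\<^bsub>R\<^esub>"
    using l incl_sum[symmetric] by auto
  then show ?thesis using y xy by (rule that)
qed

end

section \<open>S-coherence and single linear equations\<close>

text \<open>Schanuel's argument: the relations between the \<open>a\<^sub>j\<close> are generated by the kernel of the given
  presentation together with the vectors comparing the standard basis with a lift of the \<open>a\<^sub>j\<close>.\<close>

lemma S_solvable_of_S_coherent:
  assumes R: "cring R" and S: "submonoid S R" and coh: "S_coherent R S"
    and a: "a \<in> tuples q R"
  shows "S_solvable R S (regular_module R) q {a}"
proof -
  interpret cring R by (rule R)
  let ?R = "regular_module R"
  let ?I = "Idl\<^bsub>R\<^esub> (a ` {..<q})"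
  let ?A = "?R\<lparr>carrier := ?I\<rparr>"
  have A: "a ` {..<q} \<subseteq> carrier R" using a by auto
  have RM: "module R ?R" by (rule regular_module[OF R])
  have I: "submod R ?I ?R" by (rule ideal_imp_submod_regular[OF R genideal_ideal[OF A]])
  have "S_finitely_presented R S ?A" using coh A unfolding S_coherent_def by blast
  then obtain K F :: "('a, nat \<Rightarrow> 'a) module" and i p where se: "short_exact R K F ?A i p"
    and finK: "S_finite R S K" and free: "fg_free R F"
    unfolding S_finitely_presented_def by blast
  have K: "module R K" and F: "module R F" and i: "i \<in> mhom R K F" and p: "p \<in> mhom R F ?A"
    and ker: "i ` carrier K = a_kernel F ?A p" and surj: "p ` carrier F = ?I"
    using se by (simp_all add: short_exact_def)
  interpret F: module R F by (rule F)
  interpret K: module R K by (rule K)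
  have pR: "p \<in> mhom R F ?R" using mhom_comp[OF p submod_incl[OF I]] .
  obtain K' s where s: "s \<in> S" and K': "submod R K' K"
    and fg: "finitely_generated R (K\<lparr>carrier := K'\<rparr>)" and sK: "\<forall>x\<in>carrier K. s \<odot>\<^bsub>K\<^esub> x \<in> K'"
    using finK unfolding S_finite_def by blast
  have sR: "s \<in> carrier R" using s submonoid.subset[OF S] by blast
  have K'M: "module R (K\<lparr>carrier := K'\<rparr>)" by (rule submod_module[OF K'])
  have iK: "i \<in> mhom R (K\<lparr>carrier := K'\<rparr>) F" using mhom_comp[OF submod_incl[OF K'] i] .
  obtain n k where k: "k \<in> tuples n (K\<lparr>carrier := K'\<rparr>)"
    and k_gen: "\<forall>x\<in>carrier (K\<lparr>carrier := K'\<rparr>). \<exists>c\<in>tuples n R. x = lsum (K\<lparr>carrier := K'\<rparr>) n c k"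
    by (rule finitely_generatedE[OF K'M fg])
  have ik: "i (k v) \<in> carrier F" if "v < n" for v
    using mhom_closed[OF iK] k that by auto
  have pik: "p (i (k v)) = \<zero>\<^bsub>R\<^esub>" if "v < n" for v
  proof -
    have "k v \<in> carrier K" using k that submod_subset[OF K'] by auto
    then have "i (k v) \<in> a_kernel F ?A p" unfolding ker[symmetric] by blast
    then show ?thesis by (simp add: a_kernel_def')
  qed
  obtain m b \<kappa> where b: "b \<in> tuples m F" and \<kappa>: "\<forall>i<m. (\<lambda>f. \<kappa> f i) \<in> mhom R F ?R"
    and \<kappa>_exp: "\<forall>f\<in>carrier F. f = lsum F m (\<kappa> f) b"
    by (rule fg_free_coordinates[OF free])
  have \<kappa>R: "\<kappa> f \<in> tuples m R" if "f \<in> carrier F" for f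
    using mhom_closed[OF \<kappa>[rule_format] that] by auto
  have "\<forall>v\<in>{..<m}. \<exists>c. c \<in> tuples q R \<and> p (b v) = lsum ?R q c a"
  proof
    fix v assume "v \<in> {..<m}"
    then have "p (b v) \<in> ?I" using b surj by blast
    then show "\<exists>c. c \<in> tuples q R \<and> p (b v) = lsum ?R q c a"
      unfolding Idl_eq_lsum[OF R a] by auto
  qed
  from bchoice[OF this] obtain \<gamma>
    where \<gamma>: "\<forall>v\<in>{..<m}. \<gamma> v \<in> tuples q R \<and> p (b v) = lsum ?R q (\<gamma> v) a" ..
  have \<gamma>R: "\<gamma> v \<in> tuples q R" if "v < m" for v using \<gamma> that by auto
  \<comment> \<open>\<open>\<Gamma>\<close> lifts \<open>p\<close> through the map from R^q onto the
    ideal given by \<open>a\<close>; the elements \<open>f j\<close> of \<open>F\<close> chosen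
    below provide the lift in the other direction.\<close>
  define \<Gamma> where "\<Gamma> f j = lsum ?R m (\<kappa> f) (\<lambda>v. \<gamma> v j)" for f j
  have \<Gamma>: "(\<lambda>f. \<Gamma> f j) \<in> mhom R F ?R" if j: "j < q" for j
    unfolding \<Gamma>_def lsum_def
  proof (rule mhom_sum[OF RM])
    fix v assume "v \<in> {..<m}"
    then have v: "v < m" by simp
    have "\<gamma> v j \<in> carrier ?R" using \<gamma>R[OF v] j by auto
    then show "(\<lambda>f. \<kappa> f v \<odot>\<^bsub>?R\<^esub> \<gamma> v j) \<in> mhom R F ?R"
      using mhom_comp[OF \<kappa>[rule_format, OF v] bilinear_mapD(1)[OF bilinear_map_smult[OF RM]]]
      by blast
  qed
  have \<Gamma>R: "\<Gamma> f \<in> tuples q R" if "f \<in> carrier F" for f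
    using mhom_closed[OF \<Gamma> that] by auto
  have \<Gamma>_sum: "lsum ?R q (\<Gamma> f) a = p f" if f: "f \<in> carrier F" for f
  proof -
    have "lsum ?R q (\<Gamma> f) a = lsum ?R m (\<kappa> f) (\<lambda>v. lsum ?R q (\<gamma> v) a)"
      unfolding \<Gamma>_def using a by (intro lsum_assoc[OF RM \<kappa>R[OF f] \<gamma>R, symmetric]) simp_all
    also have "\<dots> = lsum ?R m (\<kappa> f) (\<lambda>v. p (b v))"
    proof (rule lsum_cong[OF RM \<kappa>R[OF f], symmetric])
      show "(\<lambda>v. p (b v)) \<in> tuples m ?R"
        using mhom_closed[OF pR] b by (auto simp: Pi_iff)
    qed (use \<gamma> in auto)
    also have "\<dots> = p (lsum F m (\<kappa> f) b)" by (rule mhom_lsum[OF F RM pR \<kappa>R[OF f] b, symmetric])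
    also have "\<dots> = p f" using \<kappa>_exp f by simp
    finally show ?thesis .
  qed
  have aI: "a j \<in> ?I" if "j < q" for j using genideal_self[OF A] that by auto
  have "\<forall>j\<in>{..<q}. \<exists>f. f \<in> carrier F \<and> p f = a j"
    using aI unfolding surj[symmetric] by (metis imageE lessThan_iff)
  from bchoice[OF this] obtain f where f: "\<forall>j\<in>{..<q}. f j \<in> carrier F \<and> p (f j) = a j" ..
  have fF: "f \<in> tuples q F" using f by auto
  define e where "e u j = (if j = u then \<one>\<^bsub>R\<^esub> else \<zero>\<^bsub>R\<^esub>)" for u j :: nat
  have e: "e u \<in> tuples q R" for u by (auto simp: e_def)
  \<comment> \<open>The first \<open>q\<close> vectors measure how far passing to \<open>F\<close>
    by the \<open>f v\<close> and back by \<open>\<Gamma>\<close> is from the identity; the other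
    \<open>n\<close> are the images of the generators of \<open>K'\<close>.\<close>
  define l where "l v = (if v < q then (\<lambda>j. e v j \<ominus>\<^bsub>R\<^esub> \<Gamma> (f v) j) else \<Gamma> (i (k (v - q))))" for v
  have l1: "l v = (\<lambda>j. e v j \<ominus>\<^bsub>R\<^esub> \<Gamma> (f v) j)" if "v < q" for v using that by (simp add: l_def)
  have l2: "l (q + v) = \<Gamma> (i (k v))" for v by (simp add: l_def)
  have lR: "l v \<in> tuples q R" if v: "v < q + n" for v
  proof (cases "v < q")
    case True
    then show ?thesis
      unfolding l1[OF True] using e \<Gamma>R[of "f v"] f by (auto simp: Pi_iff)
  next
    case False
    then have "l v = \<Gamma> (i (k (v - q)))" "v - q < n" using v by (auto simp: l_def)
    then show ?thesis using \<Gamma>R[OF ik] by simp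
  qed
  have rel: "lsum ?R q (l v) a = \<zero>\<^bsub>R\<^esub>" if v: "v < q + n" for v
  proof (cases "v < q")
    case True
    have fv: "f v \<in> carrier F" "p (f v) = a v" using f True by auto
    have aR: "a \<in> tuples q ?R" using a by simp
    note hom = lsum_coeff_mhom[OF RM aR]
    let ?P = "power_module q ?R"
    have P: "module R ?P" by (rule power_module[OF RM])
    interpret P: module R ?P by (rule P)
    have eP: "restrict (e v) {..<q} \<in> carrier ?P" using e by simp
    have \<Gamma>P: "restrict (\<Gamma> (f v)) {..<q} \<in> carrier ?P" using \<Gamma>R[OF fv(1)] by simp
    note sum = lsum_restrict[OF RM _ aR]
    have "lsum ?R q (l v) a = lsum ?R q (restrict (e v) {..<q} \<ominus>\<^bsub>?P\<^esub> restrict (\<Gamma> (f v)) {..<q}) a"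
    proof (rule lsum_cong[OF RM lR[OF v] aR])
      fix j assume j: "j < q"
      have "(restrict (e v) {..<q} \<ominus>\<^bsub>?P\<^esub> restrict (\<Gamma> (f v)) {..<q}) j
          = restrict (e v) {..<q} j \<ominus>\<^bsub>?R\<^esub> restrict (\<Gamma> (f v)) {..<q} j"
        using j by (intro mhom_minus[OF P RM proj_mhom eP \<Gamma>P]) simp
      also have "\<dots> = e v j \<ominus>\<^bsub>R\<^esub> \<Gamma> (f v) j"
        using j by (simp add: a_minus_def a_inv_def m_inv_def regular_module_def)
      finally show "l v j = (restrict (e v) {..<q} \<ominus>\<^bsub>?P\<^esub> restrict (\<Gamma> (f v)) {..<q}) j"
        unfolding l1[OF True] by (rule sym)
    qed simp
    also have "\<dots> = lsum ?R q (e v) a \<ominus>\<^bsub>?R\<^esub> lsum ?R q (\<Gamma> (f v)) a"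
      unfolding mhom_minus[OF P RM hom eP \<Gamma>P] sum[OF e] sum[OF \<Gamma>R[OF fv(1)]] ..
    also have "lsum ?R q (e v) a = a v"
      unfolding e_def[abs_def] by (rule lsum_delta[OF RM aR True])
    also have "lsum ?R q (\<Gamma> (f v)) a = a v" unfolding \<Gamma>_sum[OF fv(1)] by (rule fv(2))
    also have "a v \<ominus>\<^bsub>?R\<^esub> a v = \<zero>\<^bsub>R\<^esub>"
    proof -
      interpret RM: module R ?R by (rule RM)
      show ?thesis using RM.M.r_neg[of "a v"] a True by (simp add: a_minus_def Pi_iff)
    qed
    finally show ?thesis .
  next
    case False
    then have "l v = \<Gamma> (i (k (v - q)))" "v - q < n" using v by (auto simp: l_def)
    then show ?thesis using \<Gamma>_sum[OF ik] pik by simp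
  qed
  have "\<exists>g\<in>tuples (q + n) R. \<forall>j<q. s \<otimes>\<^bsub>R\<^esub> x j = lsum ?R (q + n) (\<lambda>v. l v j) g"
    if x: "x \<in> tuples q R" and ax: "lsum ?R q a x = \<zero>\<^bsub>R\<^esub>" for x
  proof -
    let ?f = "lsum F q x f"
    have fc: "?f \<in> carrier F" by (rule lsum_closed[OF F x fF])
    have "p ?f = lsum ?R q x (\<lambda>j. p (f j))" by (rule mhom_lsum[OF F RM pR x fF])
    also have "\<dots> = lsum ?R q x a"
    proof (rule lsum_cong[OF RM x])
      show "(\<lambda>j. p (f j)) \<in> tuples q ?R" using f a by (auto simp: Pi_iff)
    qed (use f in auto)
    also have "\<dots> = \<zero>\<^bsub>R\<^esub>" using lsum_regular_comm[OF R x a] ax by simp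
    finally have "?f \<in> a_kernel F ?A p" using fc by (simp add: a_kernel_def')
    then obtain x0 where x0: "x0 \<in> carrier K" "?f = i x0" unfolding ker[symmetric] by blast
    have "s \<odot>\<^bsub>K\<^esub> x0 \<in> K'" using sK x0(1) by blast
    then obtain r where r: "r \<in> tuples n R" "s \<odot>\<^bsub>K\<^esub> x0 = lsum (K\<lparr>carrier := K'\<rparr>) n r k"
      using k_gen by auto
    have sf: "s \<odot>\<^bsub>F\<^esub> ?f = lsum F n r (\<lambda>v. i (k v))"
      unfolding x0(2) mhom_smult[OF i sR x0(1), symmetric] r(2)
      by (rule mhom_lsum[OF K'M F iK r(1) k])
    \<comment> \<open>\<open>x\<close> is the combination of the vectors \<open>e v\<close> minus
      \<open>\<Gamma> (f v)\<close> with coefficients \<open>x v\<close>, plus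
      \<open>\<Gamma>\<close> of the combination \<open>?f\<close>. As \<open>?f\<close> comes from
      \<open>K\<close>, multiplying by \<open>s\<close> moves it into \<open>K'\<close>, where its
      coefficients are given by \<open>r\<close>.\<close>
    define g where "g v = (if v < q then s \<otimes>\<^bsub>R\<^esub> x v else r (v - q))" for v
    have g: "g \<in> tuples (q + n) R"
      using x r(1) sR by (auto simp: g_def Pi_iff)
    have "s \<otimes>\<^bsub>R\<^esub> x j = lsum ?R (q + n) (\<lambda>v. l v j) g" if j: "j < q" for j
    proof -
      have lj: "(\<lambda>v. l v j) \<in> tuples (q + n) R" using lR j by auto
      have gR: "g \<in> tuples (q + n) ?R" using g by simp
      have xj: "x j \<in> carrier R" using x j by auto
      have ikF: "(\<lambda>v. i (k v)) \<in> tuples n F" using ik by simp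
      have \<Gamma>f: "\<Gamma> (f v) j \<in> carrier R" if "v < q" for v
        using \<Gamma>R[of "f v"] f that j by auto
      have ej: "(\<lambda>v. e v j) \<in> tuples q R" by (auto simp: e_def)
      have \<Gamma>fc: "\<Gamma> ?f j \<in> carrier R" using \<Gamma>R[OF fc] j by auto
      have 1: "lsum ?R q x (\<lambda>v. l v j) = x j \<ominus>\<^bsub>R\<^esub> \<Gamma> ?f j"
      proof -
        have "lsum ?R q x (\<lambda>v. l v j) = lsum ?R q x (\<lambda>v. e v j \<oplus>\<^bsub>R\<^esub> (\<ominus>\<^bsub>R\<^esub> \<one>\<^bsub>R\<^esub>) \<otimes>\<^bsub>R\<^esub> \<Gamma> (f v) j)"
        proof (rule lsum_cong[OF RM x])
          show "(\<lambda>v. l v j) \<in> tuples q ?R" using lj by (auto simp: Pi_iff)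
          show "l v j = e v j \<oplus>\<^bsub>R\<^esub> (\<ominus>\<^bsub>R\<^esub> \<one>\<^bsub>R\<^esub>) \<otimes>\<^bsub>R\<^esub> \<Gamma> (f v) j" if "v < q" for v
            using \<Gamma>f[OF that] by (simp add: l1[OF that] a_minus_def l_minus)
        qed simp
        also have "\<dots> = (\<Oplus>\<^bsub>R\<^esub>v\<in>{..<q}. x v \<otimes>\<^bsub>R\<^esub> e v j \<oplus>\<^bsub>R\<^esub> (\<ominus>\<^bsub>R\<^esub> \<one>\<^bsub>R\<^esub>) \<otimes>\<^bsub>R\<^esub> (x v \<otimes>\<^bsub>R\<^esub> \<Gamma> (f v) j))"
          unfolding lsum_def finsum_regular using x ej \<Gamma>f
          by (intro finsum_cong') (auto simp: r_distr m_lcomm Pi_iff)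
        also have "\<dots> = lsum ?R q x (\<lambda>v. e v j) \<oplus>\<^bsub>R\<^esub> (\<Oplus>\<^bsub>R\<^esub>v\<in>{..<q}. (\<ominus>\<^bsub>R\<^esub> \<one>\<^bsub>R\<^esub>) \<otimes>\<^bsub>R\<^esub> (x v \<otimes>\<^bsub>R\<^esub> \<Gamma> (f v) j))"
          unfolding lsum_def finsum_regular using x ej \<Gamma>f
          by (simp add: finsum_addf Pi_iff)
        also have "(\<Oplus>\<^bsub>R\<^esub>v\<in>{..<q}. (\<ominus>\<^bsub>R\<^esub> \<one>\<^bsub>R\<^esub>) \<otimes>\<^bsub>R\<^esub> (x v \<otimes>\<^bsub>R\<^esub> \<Gamma> (f v) j))
            = (\<ominus>\<^bsub>R\<^esub> \<one>\<^bsub>R\<^esub>) \<otimes>\<^bsub>R\<^esub> lsum ?R q x (\<lambda>v. \<Gamma> (f v) j)"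
          unfolding lsum_def finsum_regular using x \<Gamma>f
          by (simp add: finsum_rdistr Pi_iff)
        also have "lsum ?R q x (\<lambda>v. \<Gamma> (f v) j) = \<Gamma> ?f j"
          by (rule mhom_lsum[OF F RM \<Gamma>[OF j] x fF, symmetric])
        also have "lsum ?R q x (\<lambda>v. e v j) = lsum ?R q (\<lambda>v. if v = j then \<one>\<^bsub>R\<^esub> else \<zero>\<^bsub>R\<^esub>) x"
          by (subst lsum_regular_comm[OF R x ej]) (simp add: e_def eq_commute[of j])
        also have "\<dots> = x j" using x j by (intro lsum_delta[OF RM]) simp_all
        finally show ?thesis using \<Gamma>fc by (simp add: a_minus_def l_minus)
      qed
      have "lsum ?R (q + n) (\<lambda>v. l v j) g = lsum ?R q (\<lambda>v. l v j) g \<oplus>\<^bsub>R\<^esub>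
          lsum ?R n (\<lambda>v. l (q + v) j) (\<lambda>v. g (q + v))"
        using lsum_append[OF RM lj gR] by simp
      also have "lsum ?R q (\<lambda>v. l v j) g = lsum ?R q g (\<lambda>v. l v j)"
        using lj g by (intro lsum_regular_comm[OF R]) (auto simp: Pi_iff)
      also have "\<dots> = lsum ?R q (\<lambda>v. s \<otimes>\<^bsub>R\<^esub> x v) (\<lambda>v. l v j)"
      proof (rule lsum_cong[OF RM])
        show "g \<in> tuples q R" using g by auto
        show "(\<lambda>v. l v j) \<in> tuples q ?R" using lj by auto
      qed (simp_all add: g_def)
      also have "\<dots> = s \<otimes>\<^bsub>R\<^esub> (x j \<ominus>\<^bsub>R\<^esub> \<Gamma> ?f j)"
        unfolding 1[symmetric] using lsum_scale_coeff[OF RM x _ sR] lj by (simp add: Pi_iff)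
      also have "lsum ?R n (\<lambda>v. l (q + v) j) (\<lambda>v. g (q + v)) = lsum ?R n (\<lambda>v. \<Gamma> (i (k v)) j) r"
        by (simp add: l2 g_def)
      also have "\<dots> = lsum ?R n r (\<lambda>v. \<Gamma> (i (k v)) j)"
        using \<Gamma>R[OF ik] j r(1) by (intro lsum_regular_comm[OF R]) auto
      also have "\<dots> = \<Gamma> (s \<odot>\<^bsub>F\<^esub> ?f) j"
        unfolding sf by (rule mhom_lsum[OF F RM \<Gamma>[OF j] r(1) ikF, symmetric])
      also have "\<dots> = s \<otimes>\<^bsub>R\<^esub> \<Gamma> ?f j" using mhom_smult[OF \<Gamma>[OF j] sR fc] by simp
      also have "s \<otimes>\<^bsub>R\<^esub> (x j \<ominus>\<^bsub>R\<^esub> \<Gamma> ?f j) \<oplus>\<^bsub>R\<^esub> s \<otimes>\<^bsub>R\<^esub> \<Gamma> ?f j = s \<otimes>\<^bsub>R\<^esub> x j"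
        using sR xj \<Gamma>fc by (simp add: a_minus_def r_distr[symmetric] a_assoc l_neg)
      finally show ?thesis by (rule sym)
    qed
    with g show ?thesis by blast
  qed
  then show ?thesis
    unfolding S_solvable_def using s lR rel
    by (intro bexI[OF _ s] exI[of _ "q + n"] exI[of _ l]) auto
qed

section \<open>The presentation of an ideal by its generators\<close>

lemma lsum_free_gen:
  assumes "cring R" "c \<in> carrier (power_module q (regular_module R))"
  shows "lsum (power_module q (regular_module R)) q c (free_gen R {..<q}) = c"
proof -
  let ?R = "regular_module R"
  let ?F = "power_module q ?R"
  have RM: "module R ?R" by (rule regular_module[OF assms(1)])
  have F: "module R ?F" by (rule power_module[OF RM])
  have c: "c \<in> tuples q R" using assms(2) by auto
  have g: "free_gen R {..<q} \<in> tuples q ?F"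
    using free_gen_closed[OF assms(1), of _ "{..<q}"] by (intro Pi_I) simp
  show ?thesis
  proof (rule PiE_ext[of _ "{..<q}" "\<lambda>_. carrier R"])
    show "lsum ?F q c (free_gen R {..<q}) \<in> {..<q} \<rightarrow>\<^sub>E carrier R"
      using lsum_closed[OF F c g] by simp
    show "c \<in> {..<q} \<rightarrow>\<^sub>E carrier R" using assms(2) by simp
    fix j assume j: "j \<in> {..<q}"
    have gj: "(\<lambda>v. free_gen R {..<q} v j) \<in> tuples q R"
      using g j by (auto simp: Pi_iff)
    have "lsum ?F q c (free_gen R {..<q}) j = lsum ?R q c (\<lambda>v. free_gen R {..<q} v j)"
      by (rule lsum_direct_product[OF assms(1) RM j c g])
    also have "\<dots> = lsum ?R q (\<lambda>v. free_gen R {..<q} v j) c"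
      by (rule lsum_regular_comm[OF assms(1) c gj])
    also have "\<dots> = lsum ?R q (\<lambda>v. if v = j then \<one>\<^bsub>R\<^esub> else \<zero>\<^bsub>R\<^esub>) c"
      using gj c j by (intro lsum_cong[OF RM]) (auto simp: free_gen_def)
    also have "\<dots> = c j" using c j by (intro lsum_delta[OF RM]) auto
    finally show "lsum ?F q c (free_gen R {..<q}) j = c j" .
  qed
qed

lemma fg_free_power_module:
  assumes "cring R" shows "fg_free R (power_module q (regular_module R))"
proof -
  let ?R = "regular_module R"
  let ?F = "power_module q ?R"
  let ?e = "free_gen R {..<q}"
  let ?B = "?e ` {..<q}"
  have RM: "module R ?R" by (rule regular_module[OF assms(1)])
  have F: "module R ?F" by (rule power_module[OF RM])
  interpret F: module R ?F by (rule F)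
  have e: "?e \<in> tuples q ?F"
    using free_gen_closed[OF assms, of _ "{..<q}"] by (intro Pi_I) simp
  then have B: "?B \<subseteq> carrier ?F" by auto
  have "F.span ?B = carrier ?F"
  proof
    show "F.span ?B \<subseteq> carrier ?F" using submod_subset[OF span_submod[OF F B]] by auto
    show "carrier ?F \<subseteq> F.span ?B"
    proof
      fix c assume c: "c \<in> carrier ?F"
      have "lsum ?F q c ?e \<in> F.span ?B"
        using c span_gen[OF F B] by (intro submod_lsum[OF span_submod[OF F B]]) auto
      then show "c \<in> F.span ?B" unfolding lsum_free_gen[OF assms c] .
    qed
  qed
  moreover have "\<not> F.lin_dep ?B"
  proof (rule F.finite_lin_indpt2[OF finite_imageI[OF finite_lessThan] B], rule ballI)
    fix a v assume a: "a \<in> ?B \<rightarrow> carrier R" and zero: "F.lincomb a ?B = \<zero>\<^bsub>?F\<^esub>" and v: "v \<in> ?B"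
    have av: "a v \<in> carrier R" using a v by auto
    show "a v = \<zero>\<^bsub>R\<^esub>"
    proof (cases "\<one>\<^bsub>R\<^esub> = \<zero>\<^bsub>R\<^esub>")
      \<comment> \<open>Over the zero ring the basis vectors coincide and cannot be indexed
        injectively, but then every coefficient is zero.\<close>
      case True
      have "a v = \<one>\<^bsub>R\<^esub> \<otimes>\<^bsub>R\<^esub> a v" using F.R.l_one[OF av] by (rule sym)
      also have "\<dots> = \<zero>\<^bsub>R\<^esub>" unfolding True by (rule F.R.l_null[OF av])
      finally show ?thesis .
    next
      case False
      obtain j where j: "j < q" "v = ?e j" using v by auto
      have "inj_on ?e {..<q}"
      proof (rule inj_onI)
        fix i j assume ij: "i \<in> {..<q}" "j \<in> {..<q}" "?e i = ?e j"
        have "?e i i = ?e j i" using ij(3) by simp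
        then show "i = j" using ij(1,2) False by (auto simp: free_gen_def split: if_splits)
      qed
      then have bij: "bij_betw ?e {..<q} ?B" by (simp add: bij_betw_def)
      let ?c = "\<lambda>i\<in>{..<q}. a (?e i)"
      have c: "?c \<in> carrier ?F" using a by auto
      have ae: "(\<lambda>i. a (?e i)) \<in> tuples q R" using a by auto
      have "\<zero>\<^bsub>?F\<^esub> = lsum ?F q (\<lambda>i. a (?e i)) ?e"
        unfolding zero[symmetric] by (rule lincomb_lsum[OF F bij B a])
      also have "\<dots> = lsum ?F q ?c ?e" by (rule lsum_restrict[OF F ae e, symmetric])
      also have "\<dots> = ?c" by (rule lsum_free_gen[OF assms c])
      finally have "?c j = \<zero>\<^bsub>?F\<^esub> j" by (rule arg_cong[OF sym])
      then show ?thesis using j by simp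
    qed
  qed
  ultimately show ?thesis
    unfolding fg_free_def using F B by blast
qed

text \<open>The kernel of the map from R^q onto the ideal is the module of solutions; the finitely
  many \<open>l v\<close> generate a submodule that contains \<open>s\<close> times this
  kernel.\<close>

lemma S_coherent_of_S_solvable:
  assumes R: "cring R" and S: "submonoid S R"
    and sol: "\<And>q a. a \<in> tuples q R \<Longrightarrow> S_solvable R S (regular_module R) q {a}"
  shows "S_coherent R S"
  unfolding S_coherent_def
proof (intro allI impI, elim conjE)
  fix A assume A: "finite A" "A \<subseteq> carrier R"
  let ?R = "regular_module R"
  define q where "q = card A"
  obtain a where "bij_betw a {..<q} A"
    using ex_bij_betw_nat_finite[OF A(1)] by (auto simp: atLeast0LessThan q_def)
  then have im: "a ` {..<q} = A" by (simp add: bij_betw_def)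
  then have a: "a \<in> tuples q R" using A(2) by auto
  let ?I = "Idl\<^bsub>R\<^esub> A"
  let ?A = "?R\<lparr>carrier := ?I\<rparr>"
  let ?F = "power_module q ?R"
  let ?p = "\<lambda>c. lsum ?R q c a"
  have RM: "module R ?R" by (rule regular_module[OF R])
  have F: "module R ?F" by (rule power_module[OF RM])
  have I: "submod R ?I ?R"
    by (rule ideal_imp_submod_regular[OF R ring.genideal_ideal[OF cring.axioms(1)[OF R] A(2)]])
  have AM: "module R ?A" by (rule submod_module[OF I])
  have I_eq: "?I = ?p ` carrier ?F" using Idl_eq_lsum[OF R a] unfolding im .
  have aR: "a \<in> tuples q ?R" using a by simp
  have p: "?p \<in> mhom R ?F ?A"
    using submod_subset[OF I] I_eq by (intro mhom_restrict[OF lsum_coeff_mhom[OF RM aR]]) auto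
  let ?ker = "a_kernel ?F ?A ?p"
  have ker: "submod R ?ker ?F" by (rule submod_kernel[OF F AM p])
  let ?K = "?F\<lparr>carrier := ?ker\<rparr>"
  have K: "module R ?K" by (rule submod_module[OF ker])
  have se: "short_exact R ?K ?F ?A (\<lambda>x. x) ?p"
    unfolding short_exact_def
  proof (intro conjI K F AM p)
    show "(\<lambda>x. x) \<in> mhom R ?K ?F" by (rule submod_incl[OF ker])
    show "?p ` carrier ?F = carrier ?A" using I_eq by simp
  qed (simp_all add: inj_on_def)
  obtain s n l where s: "s \<in> S"
    and l: "\<forall>v<n. l v \<in> tuples q R \<and> lsum ?R q (l v) a = \<zero>\<^bsub>R\<^esub>"
    and gen: "\<forall>x\<in>tuples q R. lsum ?R q a x = \<zero>\<^bsub>R\<^esub> \<longrightarrow>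
      (\<exists>g\<in>tuples n R. \<forall>j<q. s \<otimes>\<^bsub>R\<^esub> x j = lsum ?R n (\<lambda>v. l v j) g)"
    using sol[OF a] unfolding S_solvable_def regular_module_simps by auto
  have sR: "s \<in> carrier R" using s submonoid.subset[OF S] by blast
  define L where "L v = restrict (l v) {..<q}" for v
  have L_ker: "L v \<in> ?ker" if v: "v < n" for v
  proof -
    have lv: "l v \<in> tuples q R" "lsum ?R q (l v) a = \<zero>\<^bsub>R\<^esub>" using l v by auto
    have "?p (L v) = lsum ?R q (l v) a"
      unfolding L_def by (rule lsum_restrict[OF RM lv(1) aR])
    then show ?thesis using lv by (simp add: a_kernel_def' L_def)
  qed
  have L: "L \<in> tuples n ?F" using L_ker submod_subset[OF ker] by blast
  define K' where "K' = (\<lambda>g. lsum ?F n g L) ` carrier (power_module n ?R)"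
  have K'F: "submod R K' ?F"
    unfolding K'_def by (rule submod_image[OF power_module[OF RM] F lsum_coeff_mhom[OF F L]])
  have K'_ker: "K' \<subseteq> ?ker"
    unfolding K'_def using L_ker by (auto intro!: submod_lsum[OF ker])
  have "S_finite R S ?K"
    unfolding S_finite_def
  proof (intro exI bexI[OF _ s] conjI ballI)
    interpret K'F: LinearCombinations.submodule R K' ?F by (rule K'F)
    show "submod R K' ?K"
      by (rule submodI[OF K]) (use K'_ker K'F.zero_closed K'F.m_closed K'F.smult_closed in simp_all)
    have K'M: "module R (?F\<lparr>carrier := K'\<rparr>)" by (rule submod_module[OF K'F])
    have LK': "L v \<in> K'" if "v < n" for v
      unfolding K'_def by (rule lsum_image_unit[OF F L that])
    have "finitely_generated R (?F\<lparr>carrier := K'\<rparr>)"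
    proof (rule finitely_generatedI[OF K'M])
      show LK'2: "L \<in> tuples n (?F\<lparr>carrier := K'\<rparr>)" using LK' by simp
      fix x assume "x \<in> carrier (?F\<lparr>carrier := K'\<rparr>)"
      then obtain g where g: "g \<in> carrier (power_module n ?R)" "x = lsum ?F n g L"
        by (auto simp: K'_def)
      then have gR: "g \<in> tuples n R" by auto
      have "x = lsum (?F\<lparr>carrier := K'\<rparr>) n g L"
        unfolding g(2) using LK' by (intro lsum_submod[OF K'F gR, symmetric]) simp
      with gR show "\<exists>c\<in>tuples n R. x = lsum (?F\<lparr>carrier := K'\<rparr>) n c L" by blast
    qed
    then show "finitely_generated R (?K\<lparr>carrier := K'\<rparr>)" by simp
    fix x assume "x \<in> carrier ?K"
    then have x: "x \<in> carrier ?F" "?p x = \<zero>\<^bsub>R\<^esub>" by (auto simp: a_kernel_def')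
    then have xR: "x \<in> tuples q R" by auto
    have "lsum ?R q a x = \<zero>\<^bsub>R\<^esub>" using lsum_regular_comm[OF R a xR] x(2) by simp
    then obtain g where g: "g \<in> tuples n R"
      and sx: "\<forall>j<q. s \<otimes>\<^bsub>R\<^esub> x j = lsum ?R n (\<lambda>v. l v j) g"
      using gen xR by blast
    have "s \<odot>\<^bsub>?F\<^esub> x = lsum ?F n (restrict g {..<n}) L"
    proof (rule PiE_ext[of _ "{..<q}" "\<lambda>_. carrier R"])
      have gr: "restrict g {..<n} \<in> tuples n R" using g by auto
      show "s \<odot>\<^bsub>?F\<^esub> x \<in> {..<q} \<rightarrow>\<^sub>E carrier R"
        using module.smult_closed[OF F sR x(1)] by simp
      show "lsum ?F n (restrict g {..<n}) L \<in> {..<q} \<rightarrow>\<^sub>E carrier R"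
        using lsum_closed[OF F gr L] by simp
      fix j assume j: "j \<in> {..<q}"
      have lj: "(\<lambda>v. l v j) \<in> tuples n R" using l j by auto
      have "lsum ?F n (restrict g {..<n}) L j = lsum ?R n (restrict g {..<n}) (\<lambda>v. L v j)"
        by (rule lsum_direct_product[OF R RM j gr L])
      also have "\<dots> = lsum ?R n g (\<lambda>v. l v j)"
        using gr lj j by (intro lsum_cong[OF RM]) (auto simp: L_def Pi_iff)
      also have "\<dots> = lsum ?R n (\<lambda>v. l v j) g" by (rule lsum_regular_comm[OF R g lj])
      also have "\<dots> = s \<otimes>\<^bsub>R\<^esub> x j" using sx j by simp
      finally show "(s \<odot>\<^bsub>?F\<^esub> x) j = lsum ?F n (restrict g {..<n}) L j" using j by simp
    qed
    moreover have "restrict g {..<n} \<in> carrier (power_module n ?R)" using g by auto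
    ultimately show "s \<odot>\<^bsub>?K\<^esub> x \<in> K'" unfolding K'_def by simp
  qed
  with se fg_free_power_module[OF R] show "S_finitely_presented R S ?A"
    unfolding S_finitely_presented_def by blast
qed

text \<open>The kernel is a copy of the ideal and is generated by the \<open>a j\<close>. The first
  power of \<open>R\<close> stands in for \<open>R\<close> because \<open>finitely_presented\<close>
  requires a free module with elements of type \<open>nat \<Rightarrow> 'r\<close>.\<close>

lemma finitely_presented_cyclic:
  fixes q :: nat
  assumes R: "cring R" and M: "module R M" and p: "p \<in> mhom R (regular_module R) M"
    and surj: "p ` carrier R = carrier M" and a: "a \<in> tuples q R"
    and ker: "\<And>r. r \<in> carrier R \<Longrightarrow> p r = \<zero>\<^bsub>M\<^esub> \<longleftrightarrow> r \<in> Idl\<^bsub>R\<^esub> (a ` {..<q})"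
  shows "finitely_presented R M"
proof -
  let ?R = "regular_module R"
  let ?F = "power_module 1 ?R"
  let ?p = "\<lambda>f. p (f 0)"
  have RM: "module R ?R" by (rule regular_module[OF R])
  have F: "module R ?F" by (rule power_module[OF RM])
  have "(\<lambda>f. f 0) \<in> mhom R ?F ?R" by (rule proj_mhom) simp
  then have p': "?p \<in> mhom R ?F M" by (rule mhom_comp[OF _ p])
  let ?ker = "a_kernel ?F M ?p"
  have ker': "submod R ?ker ?F" by (rule submod_kernel[OF F M p'])
  let ?K = "?F\<lparr>carrier := ?ker\<rparr>"
  have K: "module R ?K" by (rule submod_module[OF ker'])
  have se: "short_exact R ?K ?F M (\<lambda>x. x) ?p"
    unfolding short_exact_def
  proof (intro conjI K F M p' submod_incl[OF ker'])
    show "?p ` carrier ?F = carrier M"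
    proof
      show "?p ` carrier ?F \<subseteq> carrier M" using mhom_closed[OF p'] by blast
      show "carrier M \<subseteq> ?p ` carrier ?F"
      proof
        fix x assume "x \<in> carrier M"
        then obtain r where "r \<in> carrier R" "x = p r" unfolding surj[symmetric] by blast
        then show "x \<in> ?p ` carrier ?F" by (intro image_eqI[of _ _ "\<lambda>_\<in>{..<1}. r"]) auto
      qed
    qed
  qed (simp_all add: inj_on_def)
  define k where "k j = (\<lambda>_\<in>{..<1::nat}. a j)" for j
  have aR: "a j \<in> carrier R" if "j < q" for j using a that by auto
  have A: "a ` {..<q} \<subseteq> carrier R" using aR by auto
  have kF: "k \<in> tuples q ?F" using aR by (auto simp: k_def)
  have "p (a j) = \<zero>\<^bsub>M\<^esub>" if "j < q" for j
    using ker[OF aR[OF that]] ring.genideal_self[OF cring.axioms(1)[OF R] A] that by auto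
  then have kK: "k \<in> tuples q ?K" using kF by (auto simp: a_kernel_def' k_def)
  have "finitely_generated R ?K"
  proof (rule finitely_generatedI[OF K kK])
    fix x assume "x \<in> carrier ?K"
    then have x: "x \<in> carrier ?F" "p (x 0) = \<zero>\<^bsub>M\<^esub>" by (auto simp: a_kernel_def')
    then have "x 0 \<in> Idl\<^bsub>R\<^esub> (a ` {..<q})" using ker by (auto simp: PiE_iff)
    then obtain c where c: "c \<in> carrier (power_module q ?R)" "x 0 = lsum ?R q c a"
      unfolding Idl_eq_lsum[OF R a] by blast
    then have cR: "c \<in> tuples q R" by auto
    have "x = lsum ?F q c k"
    proof (rule PiE_ext[of _ "{..<1}" "\<lambda>_. carrier R"])
      show "x \<in> {..<1} \<rightarrow>\<^sub>E carrier R" using x(1) by simp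
      show "lsum ?F q c k \<in> {..<1} \<rightarrow>\<^sub>E carrier R" using lsum_closed[OF F cR kF] by simp
      fix j :: nat assume j: "j \<in> {..<1}"
      have "lsum ?F q c k j = lsum ?R q c (\<lambda>v. k v j)"
        by (rule lsum_direct_product[OF R RM j cR kF])
      also have "(\<lambda>v. k v j) = a" using j by (simp add: k_def)
      finally show "x j = lsum ?F q c k j" using j c(2) by simp
    qed
    also have "\<dots> = lsum ?K q c k" using kK by (intro lsum_submod[OF ker' cR, symmetric]) simp
    finally show "\<exists>c\<in>tuples q R. x = lsum ?K q c k" using cR by blast
  qed
  with se fg_free_power_module[OF R] show ?thesis
    unfolding finitely_presented_def by blast
qed

text \<open>The product is indexed by a copy of the set of all relations between the \<open>a\<^sub>j\<close>; the components
  of the generic solution then run through all relations simultaneously.\<close>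

lemma S_solvable_of_s_flat:
  fixes N :: "('r, 'n) module"
  assumes R: "cring R" and S: "submonoid S R"
    and inf: "infinite (UNIV :: 'u set)" and card: "carrier R \<lesssim> (UNIV :: 'u set)"
    and N: "module R N" and \<eta>: "\<eta> \<in> mhom R (regular_module R) N" and \<xi>: "\<xi> \<in> mhom R N (regular_module R)"
    and \<xi>\<eta>: "\<And>r. r \<in> carrier R \<Longrightarrow> \<xi> (\<eta> r) = r"
    and flat: "\<And>I :: 'u set. s_flat TYPE('u) R S (direct_product I (\<lambda>_. N))"
    and a: "a \<in> tuples q R"
  shows "S_solvable R S (regular_module R) q {a}"
proof -
  let ?R = "regular_module R"
  let ?J = "Idl\<^bsub>R\<^esub> (a ` {..<q})"
  have RM: "module R ?R" by (rule regular_module[OF R])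
  have A: "a ` {..<q} \<subseteq> carrier R" using a by auto
  have J: "submod R ?J ?R"
    by (rule ideal_imp_submod_regular[OF R ring.genideal_ideal[OF cring.axioms(1)[OF R] A]])
  let ?Q = "quot_module ?R ?J"
  have Q: "module R ?Q" by (rule quot_module[OF J])
  have "carrier ?Q \<lesssim> (UNIV :: 'u set)"
    unfolding quot_module_carrier using lepoll_trans[OF image_lepoll card] by simp
  then obtain i :: "_ \<Rightarrow> 'u" where i: "inj_on i (carrier ?Q)" by (auto simp: lepoll_def)
  \<comment> \<open>The cyclic module R/(a), moved into the universe in which s-flatness is
    tested.\<close>
  define M where "M = copy_module i ?Q"
  note cM = copy_module[OF Q i, folded M_def]
  define p where "p r = i (coset_of ?R ?J r)" for r
  have p: "p \<in> mhom R ?R M"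
    unfolding p_def by (rule mhom_comp[OF coset_of_mhom[OF J] cM(2)])
  have surj: "p ` carrier R = carrier M"
    unfolding M_def copy_module_carrier quot_module_carrier by (auto simp: p_def)
  have ker: "p r = \<zero>\<^bsub>M\<^esub> \<longleftrightarrow> r \<in> ?J" if r: "r \<in> carrier R" for r
  proof -
    have r': "r \<in> carrier ?R" using r by simp
    have "p r = \<zero>\<^bsub>M\<^esub> \<longleftrightarrow> i (coset_of ?R ?J r) = i \<zero>\<^bsub>?Q\<^esub>"
      unfolding p_def mhom_zero[OF Q cM(1,2)] ..
    also have "\<dots> \<longleftrightarrow> coset_of ?R ?J r = \<zero>\<^bsub>?Q\<^esub>"
    proof -
      interpret Q: module R ?Q by (rule Q)
      show ?thesis
        using inj_on_eq_iff[OF i mhom_closed[OF coset_of_mhom[OF J] r'] Q.M.zero_closed] .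
    qed
    also have "\<dots> \<longleftrightarrow> r \<in> ?J" by (rule coset_of_zero_iff[OF J r'])
    finally show ?thesis .
  qed
  have fp: "finitely_presented R M" by (rule finitely_presented_cyclic[OF R cM(1) p surj a ker])
  \<comment> \<open>Solutions are taken extensional, as elements of a free module of finite rank, so
    that \<open>free_module_lepoll\<close> embeds them in \<open>'u\<close>, where the index set has
    to lie.\<close>
  define Rel where "Rel = {c \<in> carrier (free_module R {..<q}). lsum ?R q a c = \<zero>\<^bsub>R\<^esub>}"
  have "{..<q} \<lesssim> (UNIV :: 'u set)" using finite_lepoll_infinite[OF inf] by blast
  then obtain \<iota> :: "_ \<Rightarrow> 'u" where "inj_on \<iota> (carrier (free_module R {..<q}))"
    using free_module_lepoll[OF inf _ card, of "{..<q}"]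
    by (auto simp: lepoll_def simp del: free_module_simps)
  then have \<iota>: "inj_on \<iota> Rel" by (rule inj_on_subset) (auto simp: Rel_def)
  define I where "I = \<iota> ` Rel"
  define L where "L u = inv_into Rel \<iota> u" for u
  have L: "L u \<in> Rel" if "u \<in> I" for u using that unfolding I_def L_def by (rule inv_into_into)
  have LR: "L u j \<in> carrier R" if "u \<in> I" "j < q" for u j
    using L[OF that(1)] that(2) by (auto simp: Rel_def PiE_iff)
  let ?P = "direct_product I (\<lambda>_. N)"
  have P: "module R ?P" by (rule direct_product_module[OF R N])
  obtain s where s: "s \<in> S"
    and ann: "\<forall>t\<in>carrier (Tor1 R M ?P). s \<odot>\<^bsub>Tor1 R M ?P\<^esub> t = \<zero>\<^bsub>Tor1 R M ?P\<^esub>"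
    using flat[of I] fp unfolding s_flat_def by blast
  have sR: "s \<in> carrier R" using s submonoid.subset[OF S] by blast
  \<comment> \<open>The generic solution: its component at the index of a solution is that solution,
    transported by \<open>\<eta>\<close>.\<close>
  define x where "x j = (\<lambda>u\<in>I. \<eta> (L u j))" for j
  have x: "x \<in> tuples q ?P"
    using mhom_closed[OF \<eta>] LR by (auto simp: x_def)
  have ax: "lsum ?P q a x = \<zero>\<^bsub>?P\<^esub>"
  proof (rule PiE_ext[of _ I "\<lambda>_. carrier N"])
    show "lsum ?P q a x \<in> I \<rightarrow>\<^sub>E carrier N" using lsum_closed[OF P a x] by simp
    show "\<zero>\<^bsub>?P\<^esub> \<in> I \<rightarrow>\<^sub>E carrier N"
    proof -
      interpret P: module R ?P by (rule P)
      show ?thesis using P.M.zero_closed by simp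
    qed
    fix u assume u: "u \<in> I"
    have Lu: "L u \<in> tuples q ?R" using LR[OF u] by simp
    have "lsum ?P q a x u = lsum N q a (\<lambda>j. x j u)" by (rule lsum_direct_product[OF R N u a x])
    also have "\<dots> = lsum N q a (\<lambda>j. \<eta> (L u j))" using u by (simp add: x_def)
    also have "\<dots> = \<eta> (lsum ?R q a (L u))" by (rule mhom_lsum[OF RM N \<eta> a Lu, symmetric])
    also have "lsum ?R q a (L u) = \<zero>\<^bsub>?R\<^esub>" using L[OF u] by (simp add: Rel_def)
    also have "\<eta> \<zero>\<^bsub>?R\<^esub> = \<zero>\<^bsub>N\<^esub>" by (rule mhom_zero[OF RM N \<eta>])
    finally show "lsum ?P q a x u = \<zero>\<^bsub>?P\<^esub> u" using u by simp
  qed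
  interpret tor_resolution R M ?P by (intro tor_resolution.intro cM P)
  obtain n l y where l: "\<forall>v<n. l v \<in> tuples q R \<and> lsum ?R q (l v) a = \<zero>\<^bsub>R\<^esub>"
    and y: "y \<in> tuples n ?P" and xy: "\<forall>j<q. s \<odot>\<^bsub>?P\<^esub> x j = lsum ?P n (\<lambda>v. l v j) y"
    by (rule relation_of_annihilated[OF p surj a ker sR ann x ax])
  have "\<exists>g\<in>tuples n R. \<forall>j<q. s \<otimes>\<^bsub>R\<^esub> c j = lsum ?R n (\<lambda>v. l v j) g"
    if c: "c \<in> tuples q R" and ac: "lsum ?R q a c = \<zero>\<^bsub>R\<^esub>" for c
  proof -
    have rc: "restrict c {..<q} \<in> carrier (free_module R {..<q})" using c by auto
    have "lsum ?R q a (restrict c {..<q}) = lsum ?R q a c"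
      using c by (intro lsum_cong[OF RM a]) auto
    then have rc: "restrict c {..<q} \<in> Rel" using rc ac by (simp add: Rel_def)
    \<comment> \<open>At the index of \<open>c\<close> the generic solution specialises to
      \<open>c\<close>; \<open>\<xi>\<close> then leads from \<open>N\<close> back to
      \<open>R\<close>.\<close>
    define u where "u = \<iota> (restrict c {..<q})"
    have u: "u \<in> I" using rc by (simp add: I_def u_def)
    have Lu: "L u j = c j" if "j < q" for j
      unfolding L_def u_def inv_into_f_f[OF \<iota> rc] using that by simp
    have yu: "(\<lambda>v. y v u) \<in> tuples n N" using y u by auto
    have "s \<otimes>\<^bsub>R\<^esub> c j = lsum ?R n (\<lambda>v. l v j) (\<lambda>v. \<xi> (y v u))" if j: "j < q" for j
    proof -
      have lj: "(\<lambda>v. l v j) \<in> tuples n R" using l j by auto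
      have cj: "c j \<in> carrier R" using c j by auto
      have \<eta>c: "\<eta> (c j) \<in> carrier N" using mhom_closed[OF \<eta>, of "c j"] cj by simp
      have "s \<odot>\<^bsub>N\<^esub> \<eta> (c j) = (s \<odot>\<^bsub>?P\<^esub> x j) u" using u Lu[OF j] by (simp add: x_def)
      also have "\<dots> = lsum ?P n (\<lambda>v. l v j) y u" using xy j by simp
      also have "\<dots> = lsum N n (\<lambda>v. l v j) (\<lambda>v. y v u)" by (rule lsum_direct_product[OF R N u lj y])
      finally have "\<xi> (s \<odot>\<^bsub>N\<^esub> \<eta> (c j)) = \<xi> (lsum N n (\<lambda>v. l v j) (\<lambda>v. y v u))" by (rule arg_cong)
      also have "\<xi> (s \<odot>\<^bsub>N\<^esub> \<eta> (c j)) = s \<otimes>\<^bsub>R\<^esub> c j"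
        using mhom_smult[OF \<xi> sR \<eta>c] \<xi>\<eta>[OF cj] by simp
      also have "\<xi> (lsum N n (\<lambda>v. l v j) (\<lambda>v. y v u)) = lsum ?R n (\<lambda>v. l v j) (\<lambda>v. \<xi> (y v u))"
        by (rule mhom_lsum[OF N RM \<xi> lj yu])
      finally show ?thesis .
    qed
    moreover have "(\<lambda>v. \<xi> (y v u)) \<in> tuples n R"
      using mhom_closed[OF \<xi>] yu by (auto simp: Pi_iff)
    ultimately show ?thesis by (intro bexI[of _ "\<lambda>v. \<xi> (y v u)"]) auto
  qed
  with l show ?thesis
    unfolding S_solvable_def by (intro bexI[OF _ s] exI[of _ n] exI[of _ l]) auto
qed

section \<open>Assembling the equivalences\<close>

lemma s_flat_of_S_solvable:
  assumes R: "cring R" and S: "submonoid S R" and N: "module R N"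
    and sol: "\<And>q a. a \<in> tuples q R \<Longrightarrow> S_solvable R S N q {a}"
  shows "s_flat TYPE('u) R S N"
  unfolding s_flat_def
proof (intro conjI N allI impI)
  fix M :: "('a, 'u) module" assume fp: "finitely_presented R M"
  then have "module R M" by (auto simp: finitely_presented_def short_exact_def)
  then interpret tor_resolution R M N using N by (intro tor_resolution.intro)
  show "\<exists>s\<in>S. \<forall>t\<in>carrier (Tor1 R M N). s \<odot>\<^bsub>Tor1 R M N\<^esub> t = \<zero>\<^bsub>Tor1 R M N\<^esub>"
    by (rule Tor1_annihilated[OF S fp S_solvable_system[OF R S N sol]])
qed

text \<open>Sending \<open>x\<close> tensor \<open>y\<close> to \<open>\<xi> y\<close> times
  \<open>x\<close> identifies A tensor N with A, naturally in A, so injectivity passes from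
  \<open>f\<close> to the map it induces.\<close>

lemma flat_of_iso_regular:
  assumes R: "cring R" and N: "module R N"
    and \<eta>: "\<eta> \<in> mhom R (regular_module R) N" and \<xi>: "\<xi> \<in> mhom R N (regular_module R)"
    and \<eta>\<xi>: "\<And>y. y \<in> carrier N \<Longrightarrow> \<eta> (\<xi> y) = y"
  shows "flat TYPE('u) R N"
  unfolding flat_def
proof (intro conjI N allI impI, elim conjE)
  fix A B :: "('a, 'u) module" and f
  assume A: "module R A" and B: "module R B" and f: "f \<in> mhom R A B" and inj: "inj_on f (carrier A)"
  interpret R: cring R by (rule R)
  interpret A: module R A by (rule A)
  interpret TA: tensor_product R A N by (intro tensor_product.intro A N)
  interpret TB: tensor_product R B N by (intro tensor_product.intro B N)
  note fN = tensor_map_mhom[OF A B N f]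
  have one: "\<eta> \<one>\<^bsub>R\<^esub> \<in> carrier N" using mhom_closed[OF \<eta>, of "\<one>\<^bsub>R\<^esub>"] by simp
  have \<xi>R: "\<xi> y \<in> carrier R" if "y \<in> carrier N" for y using mhom_closed[OF \<xi> that] by simp
  have \<xi>_one: "\<xi> y \<odot>\<^bsub>N\<^esub> \<eta> \<one>\<^bsub>R\<^esub> = y" if y: "y \<in> carrier N" for y
  proof -
    have "\<xi> y \<odot>\<^bsub>N\<^esub> \<eta> \<one>\<^bsub>R\<^esub> = \<eta> (\<xi> y \<odot>\<^bsub>regular_module R\<^esub> \<one>\<^bsub>R\<^esub>)"
      by (rule mhom_smult[OF \<eta> \<xi>R[OF y], symmetric]) simp
    also have "\<dots> = \<eta> (\<xi> y)" using \<xi>R[OF y] by simp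
    also have "\<dots> = y" by (rule \<eta>\<xi>[OF y])
    finally show ?thesis .
  qed
  have bil: "bilinear_map R C N C (\<lambda>x y. \<xi> y \<odot>\<^bsub>C\<^esub> x)" if C: "module R C" for C :: "('a, 'u) module"
    unfolding bilinear_map_def
  proof (intro conjI ballI)
    fix y assume "y \<in> carrier N"
    then show "(\<lambda>x. \<xi> y \<odot>\<^bsub>C\<^esub> x) \<in> mhom R C C" by (intro mhom_scale[OF C mhom_id] \<xi>R)
  next
    fix x assume "x \<in> carrier C"
    then show "(\<lambda>y. \<xi> y \<odot>\<^bsub>C\<^esub> x) \<in> mhom R N C"
      by (rule mhom_comp[OF \<xi> bilinear_mapD(1)[OF bilinear_map_smult[OF C]]])
  qed
  let ?kA = "tensor_lift R A N A (\<lambda>x y. \<xi> y \<odot>\<^bsub>A\<^esub> x)"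
  let ?kB = "tensor_lift R B N B (\<lambda>x y. \<xi> y \<odot>\<^bsub>B\<^esub> x)"
  let ?f = "tensor_map R A B N f"
  note kA = TA.tensor_lift_mhom[OF A bil[OF A]] TA.tensor_lift_pure[OF A bil[OF A]]
  note kB = TB.tensor_lift_mhom[OF B bil[OF B]] TB.tensor_lift_pure[OF B bil[OF B]]
  have inv: "TA.pure (?kA t) (\<eta> \<one>\<^bsub>R\<^esub>) = t" if t: "t \<in> carrier TA.T" for t
  proof (rule TA.tensor_hom_ext[OF TA.tensor_module mhom_comp[OF kA(1) TA.pure_left[OF one]] mhom_id _ t])
    fix x y assume x: "x \<in> carrier A" and y: "y \<in> carrier N"
    have "TA.pure (?kA (TA.pure x y)) (\<eta> \<one>\<^bsub>R\<^esub>) = TA.pure (\<xi> y \<odot>\<^bsub>A\<^esub> x) (\<eta> \<one>\<^bsub>R\<^esub>)"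
      unfolding kA(2)[OF x y] ..
    also have "\<dots> = \<xi> y \<odot>\<^bsub>TA.T\<^esub> TA.pure x (\<eta> \<one>\<^bsub>R\<^esub>)"
      by (rule mhom_smult[OF TA.pure_left[OF one] \<xi>R[OF y] x])
    also have "\<dots> = TA.pure x (\<xi> y \<odot>\<^bsub>N\<^esub> \<eta> \<one>\<^bsub>R\<^esub>)"
      by (rule mhom_smult[OF TA.pure_right[OF x] \<xi>R[OF y] one, symmetric])
    finally show "TA.pure (?kA (TA.pure x y)) (\<eta> \<one>\<^bsub>R\<^esub>) = TA.pure x y" unfolding \<xi>_one[OF y] .
  qed
  have nat: "?kB (?f t) = f (?kA t)" if t: "t \<in> carrier TA.T" for t
  proof (rule TA.tensor_hom_ext[OF B mhom_comp[OF fN(1) kB(1)] mhom_comp[OF kA(1) f] _ t])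
    fix x y assume x: "x \<in> carrier A" and y: "y \<in> carrier N"
    show "?kB (?f (TA.pure x y)) = f (?kA (TA.pure x y))"
      unfolding fN(2)[OF x y] kA(2)[OF x y] kB(2)[OF mhom_closed[OF f x] y]
      by (rule mhom_smult[OF f \<xi>R[OF y] x, symmetric])
  qed
  show "inj_on ?f (carrier TA.T)"
  proof (rule inj_onI)
    fix t t' assume t: "t \<in> carrier TA.T" "t' \<in> carrier TA.T" and eq: "?f t = ?f t'"
    have "f (?kA t) = f (?kA t')" unfolding nat[OF t(1), symmetric] nat[OF t(2), symmetric] eq ..
    then have "?kA t = ?kA t'"
      by (rule inj_onD[OF inj _ mhom_closed[OF kA(1) t(1)] mhom_closed[OF kA(1) t(2)]])
    with inv[OF t(1)] have "TA.pure (?kA t') (\<eta> \<one>\<^bsub>R\<^esub>) = t" by (simp only:)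
    with inv[OF t(2)] show "t = t'" by (simp only:)
  qed
qed

lemma projective_of_iso_regular:
  assumes R: "cring R" and N: "module R N"
    and \<eta>: "\<eta> \<in> mhom R (regular_module R) N" and \<xi>: "\<xi> \<in> mhom R N (regular_module R)"
    and \<eta>\<xi>: "\<And>y. y \<in> carrier N \<Longrightarrow> \<eta> (\<xi> y) = y"
  shows "projective TYPE('u) R N"
  unfolding projective_def
proof (intro conjI N allI impI, elim conjE)
  fix A B :: "('a, 'u) module" and g f
  assume A: "module R A" and B: "module R B" and g: "g \<in> mhom R A B"
    and surj: "g ` carrier A = carrier B" and f: "f \<in> mhom R N B"
  interpret R: cring R by (rule R)
  have one: "\<eta> \<one>\<^bsub>R\<^esub> \<in> carrier N" using mhom_closed[OF \<eta>, of "\<one>\<^bsub>R\<^esub>"] by simp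
  have \<xi>R: "\<xi> y \<in> carrier R" if "y \<in> carrier N" for y using mhom_closed[OF \<xi> that] by simp
  have \<xi>_one: "\<xi> y \<odot>\<^bsub>N\<^esub> \<eta> \<one>\<^bsub>R\<^esub> = y" if y: "y \<in> carrier N" for y
  proof -
    have "\<xi> y \<odot>\<^bsub>N\<^esub> \<eta> \<one>\<^bsub>R\<^esub> = \<eta> (\<xi> y \<odot>\<^bsub>regular_module R\<^esub> \<one>\<^bsub>R\<^esub>)"
      by (rule mhom_smult[OF \<eta> \<xi>R[OF y], symmetric]) simp
    also have "\<dots> = \<eta> (\<xi> y)" using \<xi>R[OF y] by simp
    also have "\<dots> = y" by (rule \<eta>\<xi>[OF y])
    finally show ?thesis .
  qed
  obtain x where x: "x \<in> carrier A" "g x = f (\<eta> \<one>\<^bsub>R\<^esub>)"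
    using mhom_closed[OF f one] unfolding surj[symmetric] by force
  show "\<exists>h\<in>mhom R N A. \<forall>y\<in>carrier N. g (h y) = f y"
  proof (intro bexI ballI)
    show "(\<lambda>y. \<xi> y \<odot>\<^bsub>A\<^esub> x) \<in> mhom R N A"
      by (rule mhom_comp[OF \<xi> bilinear_mapD(1)[OF bilinear_map_smult[OF A] x(1)]])
    fix y assume y: "y \<in> carrier N"
    have "g (\<xi> y \<odot>\<^bsub>A\<^esub> x) = f (\<xi> y \<odot>\<^bsub>N\<^esub> \<eta> \<one>\<^bsub>R\<^esub>)"
      unfolding mhom_smult[OF g \<xi>R[OF y] x(1)] mhom_smult[OF f \<xi>R[OF y] one] x(2) ..
    then show "g (\<xi> y \<odot>\<^bsub>A\<^esub> x) = f y" unfolding \<xi>_one[OF y] .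
  qed
qed

lemma s_flat_direct_product:
  assumes "cring R" "submonoid S R" "S_coherent R S"
    and "\<And>i. i \<in> I \<Longrightarrow> module R (M i)" "\<And>i. i \<in> I \<Longrightarrow> eq_flat R (M i)"
  shows "s_flat TYPE('u) R S (direct_product I M)"
proof (rule s_flat_of_S_solvable[OF assms(1,2) direct_product_module[OF assms(1,4)]])
  fix q :: nat and a assume a: "a \<in> tuples q R"
  show "S_solvable R S (direct_product I M) q {a}"
    by (rule S_solvable_direct_product[OF assms(1) submonoid.subset[OF assms(2)] assms(4,5) a
          S_solvable_of_S_coherent[OF assms(1-3) a]])
qed

theorem theorem4p2:
  fixes R :: "('r, 'c) ring_scheme" and S :: "'r set"
  assumes "cring R" and "submonoid S R"
    and "infinite (UNIV :: 'u set)" and "carrier R \<lesssim> (UNIV :: 'u set)"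
  shows "(S_coherent R S \<longleftrightarrow>
           (\<forall>(I :: 'u set) (M :: 'u \<Rightarrow> ('r, 'u) module).
             (\<forall>i\<in>I. flat TYPE('u) R (M i)) \<longrightarrow> s_flat TYPE('u) R S (direct_product I M))) \<and>
         (S_coherent R S \<longleftrightarrow>
           (\<forall>(I :: 'u set) (M :: 'u \<Rightarrow> ('r, 'u) module).
             (\<forall>i\<in>I. projective TYPE('u) R (M i)) \<longrightarrow> s_flat TYPE('u) R S (direct_product I M))) \<and>
         (S_coherent R S \<longleftrightarrow>
           (\<forall>I :: 'u set. s_flat TYPE('u) R S (direct_product I (\<lambda>_. regular_module R))))"
proof -
  note R = assms(1) and S = assms(2)
  let ?R = "regular_module R"
  have RM: "module R ?R" by (rule regular_module[OF R])
  obtain i :: "'r \<Rightarrow> 'u" where "inj_on i (carrier R)" using assms(4) by (auto simp: lepoll_def)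
  then have i: "inj_on i (carrier ?R)" by simp
  \<comment> \<open>The factors in (2) and (3) have elements of type \<open>'u\<close>, so a copy
    takes the place of \<open>R\<close>.\<close>
  define N where "N = copy_module i ?R"
  define k where "k = inv_into (carrier ?R) i"
  note cN = copy_module[OF RM i, folded N_def k_def]
  have ki: "k (i r) = r" if "r \<in> carrier R" for r
    unfolding k_def using inv_into_f_f[OF i] that by simp
  have ik: "i (k y) = y" if "y \<in> carrier N" for y
    using that unfolding k_def N_def copy_module_carrier by (rule f_inv_into_f)
  have coherent: "S_coherent R S"
    if "\<And>I :: 'u set. s_flat TYPE('u) R S (direct_product I (\<lambda>_. N))"
    by (rule S_coherent_of_S_solvable[OF R S S_solvable_of_s_flat[OF R S assms(3,4) cN ki that]])
  have coherent': "S_coherent R S"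
    if "\<And>I :: 'u set. s_flat TYPE('u) R S (direct_product I (\<lambda>_. ?R))"
    by (rule S_coherent_of_S_solvable[OF R S
          S_solvable_of_s_flat[OF R S assms(3,4) RM mhom_id mhom_id refl that]])
  have flatN: "flat TYPE('u) R N" by (rule flat_of_iso_regular[OF R cN ik])
  have projN: "projective TYPE('u) R N" by (rule projective_of_iso_regular[OF R cN ik])
  show ?thesis
  proof (intro conjI iffI allI impI)
    fix I :: "'u set" and M :: "'u \<Rightarrow> ('r, 'u) module"
    assume "S_coherent R S" and M: "\<forall>i\<in>I. flat TYPE('u) R (M i)"
    then show "s_flat TYPE('u) R S (direct_product I M)"
      by (intro s_flat_direct_product[OF R S] eq_flat_of_flat[OF R assms(4)]) (auto simp: flat_def)
  next
    assume "\<forall>(I :: 'u set) (M :: 'u \<Rightarrow> ('r, 'u) module).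
      (\<forall>i\<in>I. flat TYPE('u) R (M i)) \<longrightarrow> s_flat TYPE('u) R S (direct_product I M)"
    then show "S_coherent R S" using flatN by (intro coherent) simp
  next
    fix I :: "'u set" and M :: "'u \<Rightarrow> ('r, 'u) module"
    assume "S_coherent R S" and M: "\<forall>i\<in>I. projective TYPE('u) R (M i)"
    then show "s_flat TYPE('u) R S (direct_product I M)"
      by (intro s_flat_direct_product[OF R S] eq_flat_of_projective[OF assms(3,4)])
        (auto simp: projective_def)
  next
    assume "\<forall>(I :: 'u set) (M :: 'u \<Rightarrow> ('r, 'u) module).
      (\<forall>i\<in>I. projective TYPE('u) R (M i)) \<longrightarrow> s_flat TYPE('u) R S (direct_product I M)"
    then show "S_coherent R S" using projN by (intro coherent) simp
  next
    fix I :: "'u set"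
    assume "S_coherent R S"
    then show "s_flat TYPE('u) R S (direct_product I (\<lambda>_. ?R))"
      by (rule s_flat_direct_product[OF R S _ RM eq_flat_regular[OF R]])
  next
    assume "\<forall>I :: 'u set. s_flat TYPE('u) R S (direct_product I (\<lambda>_. ?R))"
    then show "S_coherent R S" by (intro coherent') simp
  qed
qed

end
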